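(* Let $G$ be a group acting isometrically on two leafless trees $T_1,T_2$ (not assumed to be metrically complete). Assume that there is a coarse equivalence $f:T_1\to T_2$, that $T_1$ has at least $3$ ends and that the induced map $\partial f:\partial T_1\to\partial T_2$ between the ends of the trees is $G$-equivariant. If the $G$-action on $\partial T_1$ is $2$-transitive, then (after rescaling the metric on $T_2$ by a positive constant) there is a $G$-equivariant isometry $\bar f:T_1\to T_2$ with $\partial f=\partial\bar f$. If $T_1$ has at least two branch points, then $\bar f$ is unique and has finite distance from $f$.
   Context: Geodesics are isometric embeddings of closed intervals $J\subseteq\mathbb R$. A tree ($\mathbb R$-tree) is a metric space $T$ such that (T1) any two points $x,y$ are joined by a unique geodesic $\gamma:[0,d(x,y)]\to T$, with image $[x,y]$, and (T2) if $0<r<s$ and $\gamma:[0,s]\to T$ is an injection whose restrictions to $[0,r]$ and $[r,s]$ are geodesics, then $\gamma$ is a geodesic. A tree is leafless if every geodesic $J\to T$ extends to a geodesic $\mathbb R\to T$. An apartment in $T$ is an isometric image of $\mathbb R$. A ray is an isometric image of $[0,\infty)$; two rays are equivalent if their intersection is a ray; the equivalence classes are the ends of $T$, and $\partial T$ is the set of ends. For distinct ends $u,v$ there is a unique apartment $(u,v)$ with ends $u,v$. A point $z$ is a branch point if there are points $u,v,w$ distinct from $z$ with $[u,v]\cap[v,w]\cap[w,u]=\{z\}$. A map $f:X\to Y$ of metric spaces is controlled if there is a monotonic function $\rho:\mathbb R_{\ge0}\to\mathbb R_{\ge0}$ with $d(f(x),f(y))\le\rho(d(x,y))$ for all $x,y$;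 it is coarse if moreover preimages of bounded sets are bounded. Two maps $f,g:X\to Y$ have finite distance if $\{d(f(x),g(x)):x\in X\}$ is bounded. A coarse equivalence is a coarse map $f:X\to Y$ for which there is a coarse map $g:Y\to X$ such that $g\circ f$ and $f\circ g$ have finite distance from the identity maps. An isometry is a surjective distance-preserving map. For a coarse equivalence $f:T_1\to T_2$ of leafless trees, each apartment $A\subseteq T_1$ determines a unique apartment $f_*A\subseteq T_2$ at finite Hausdorff distance from $f(A)$. If $T_1$ has at least $3$ ends, there is a unique bijection $\partial f:\partial T_1\to\partial T_2$ with $f_*(u,v)=(\partial f(u),\partial f(v))$ for all distinct $u,v\in\partial T_1$; this is the induced map. The action on $\partial T_1$ is $2$-transitive if for all ends $u\ne v$ and $u'\neq v'$ there is $g\in G$ with $g(u)=u'$, $g(v)=v'$. *)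

theory Defs
  imports "HOL-Analysis.Analysis" "HOL-Algebra.Group_Action"
begin

text \<open>
  A metric space is a type of class \<open>metric_space\<close>, which need not be complete; properties
  of the space itself, such as being a tree, are predicates on \<open>'a itself\<close>.
\<close>


section \<open>Geodesics and trees\<close>

definition geodesic :: "real set \<Rightarrow> (real \<Rightarrow> 'a::metric_space) \<Rightarrow> bool" where
  "geodesic J \<gamma> \<longleftrightarrow> closed J \<and> is_interval J \<and> J \<noteq> {} \<and>
     (\<forall>s\<in>J. \<forall>t\<in>J. dist (\<gamma> s) (\<gamma> t) = dist s t)"

definition geodesic_between :: "'a::metric_space \<Rightarrow> 'a \<Rightarrow> (real \<Rightarrow> 'a) \<Rightarrow> bool" where
  "geodesic_between x y \<gamma> \<longleftrightarrow>
     geodesic {0..dist x y} \<gamma> \<and> \<gamma> 0 = x \<and> \<gamma> (dist x y) = y"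

text \<open>
  In the first conjunct, \<open>extensional\<close> normalizes the values outside of the domain
  \<open>{0..dist x y}\<close>, so that the uniqueness only concerns the map on that interval.
\<close>

definition tree :: "'a::metric_space itself \<Rightarrow> bool" where
  "tree _ \<longleftrightarrow>
     (\<forall>x y::'a. \<exists>!\<gamma>. \<gamma> \<in> extensional {0..dist x y} \<and> geodesic_between x y \<gamma>) \<and>
     (\<forall>r s. \<forall>\<gamma>::real \<Rightarrow> 'a. 0 < r \<and> r < s \<and> inj_on \<gamma> {0..s} \<and>
        geodesic {0..r} \<gamma> \<and> geodesic {r..s} \<gamma> \<longrightarrow> geodesic {0..s} \<gamma>)"

text \<open>The intervals \<open>J\<close> may be degenerate or unbounded.\<close>

definition leafless :: "'a::metric_space itself \<Rightarrow> bool" where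
  "leafless _ \<longleftrightarrow> (\<forall>J. \<forall>\<gamma>::real \<Rightarrow> 'a. geodesic J \<gamma> \<longrightarrow>
     (\<exists>\<gamma>'. geodesic UNIV \<gamma>' \<and> (\<forall>t\<in>J. \<gamma>' t = \<gamma> t)))"

definition tree_segment :: "'a::metric_space \<Rightarrow> 'a \<Rightarrow> 'a set" where
  "tree_segment x y = {\<gamma> t | \<gamma> t. geodesic_between x y \<gamma> \<and> t \<in> {0..dist x y}}"

definition branch_point :: "'a::metric_space \<Rightarrow> bool" where
  "branch_point z \<longleftrightarrow> (\<exists>u v w. u \<noteq> z \<and> v \<noteq> z \<and> w \<noteq> z \<and>
     tree_segment u v \<inter> tree_segment v w \<inter> tree_segment w u = {z})"


section \<open>Apartments and ends\<close>

definition apartment :: "'a::metric_space set \<Rightarrow> bool" where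
  "apartment A \<longleftrightarrow> (\<exists>\<gamma>. geodesic UNIV \<gamma> \<and> A = range \<gamma>)"

definition ray :: "'a::metric_space set \<Rightarrow> bool" where
  "ray R \<longleftrightarrow> (\<exists>\<gamma>. geodesic {0..} \<gamma> \<and> R = \<gamma> ` {0..})"

definition ray_equiv :: "('a::metric_space set \<times> 'a set) set" where
  "ray_equiv = {(R, R'). ray R \<and> ray R' \<and> ray (R \<inter> R')}"

definition ends :: "'a::metric_space set set set" where
  "ends = {R. ray R} // ray_equiv"

definition ends_of :: "'a::metric_space set \<Rightarrow> 'a set set set" where
  "ends_of A = {u \<in> ends. \<exists>R\<in>u. R \<subseteq> A}"

definition apartment_between :: "'a::metric_space set set \<Rightarrow> 'a set set \<Rightarrow> 'a set" where
  "apartment_between u v = (THE A. apartment A \<and> ends_of A = {u, v})"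


section \<open>Coarse maps\<close>

definition controlled :: "('a::metric_space \<Rightarrow> 'b::metric_space) \<Rightarrow> bool" where
  "controlled f \<longleftrightarrow> (\<exists>\<rho>::real \<Rightarrow> real. mono_on {0..} \<rho> \<and> (\<forall>t\<ge>0. 0 \<le> \<rho> t) \<and>
     (\<forall>x y. dist (f x) (f y) \<le> \<rho> (dist x y)))"

definition coarse :: "('a::metric_space \<Rightarrow> 'b::metric_space) \<Rightarrow> bool" where
  "coarse f \<longleftrightarrow> controlled f \<and> (\<forall>B. bounded B \<longrightarrow> bounded (f -` B))"

definition finite_distance :: "('a \<Rightarrow> 'b::metric_space) \<Rightarrow> ('a \<Rightarrow> 'b) \<Rightarrow> bool" where
  "finite_distance f g \<longleftrightarrow> bounded (range (\<lambda>x. dist (f x) (g x)))"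

definition coarse_equivalence :: "('a::metric_space \<Rightarrow> 'b::metric_space) \<Rightarrow> bool" where
  "coarse_equivalence f \<longleftrightarrow> coarse f \<and>
     (\<exists>g. coarse g \<and> finite_distance (g \<circ> f) id \<and> finite_distance (f \<circ> g) id)"

definition finite_Hausdorff_distance :: "'a::metric_space set \<Rightarrow> 'a set \<Rightarrow> bool" where
  "finite_Hausdorff_distance A B \<longleftrightarrow>
     (\<exists>r. (\<forall>x\<in>A. \<exists>y\<in>B. dist x y \<le> r) \<and> (\<forall>y\<in>B. \<exists>x\<in>A. dist x y \<le> r))"

definition push_apartment ::
    "('a::metric_space \<Rightarrow> 'b::metric_space) \<Rightarrow> 'a set \<Rightarrow> 'b set" where
  "push_apartment f A = (THE B. apartment B \<and> finite_Hausdorff_distance B (f ` A))"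

text \<open>
  The map induced on the ends by a coarse equivalence between leafless trees, the first of
  which has at least three ends. It is made \<open>undefined\<close> off \<open>ends\<close>, so that equality of
  two such maps means equality on \<open>ends\<close>. Multiplying a metric by a positive constant
  changes neither the rays, the apartments and the ends nor finiteness of the Hausdorff
  distance, hence not the induced map either.
\<close>

definition boundary_map ::
    "('a::metric_space \<Rightarrow> 'b::metric_space) \<Rightarrow> 'a set set \<Rightarrow> 'b set set" where
  "boundary_map f = (THE \<phi>. \<phi> \<in> extensional ends \<and> bij_betw \<phi> ends ends \<and>
     (\<forall>u\<in>ends. \<forall>v\<in>ends. u \<noteq> v \<longrightarrow>
        push_apartment f (apartment_between u v) = apartment_between (\<phi> u) (\<phi> v)))"


section \<open>Isometries and isometric group actions\<close>

text \<open>Isometries onto the codomain with its metric multiplied by \<open>c\<close>.\<close>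

definition isometry_rescaled ::
    "real \<Rightarrow> ('a::metric_space \<Rightarrow> 'b::metric_space) \<Rightarrow> bool" where
  "isometry_rescaled c h \<longleftrightarrow> surj h \<and> (\<forall>x y. c * dist (h x) (h y) = dist x y)"

definition isometric_action ::
    "('g, 'm) monoid_scheme \<Rightarrow> ('g \<Rightarrow> 'a::metric_space \<Rightarrow> 'a) \<Rightarrow> bool" where
  "isometric_action G \<alpha> \<longleftrightarrow> group_action G UNIV \<alpha> \<and>
     (\<forall>g\<in>carrier G. \<forall>x y. dist (\<alpha> g x) (\<alpha> g y) = dist x y)"

definition end_action ::
    "('g \<Rightarrow> 'a::metric_space \<Rightarrow> 'a) \<Rightarrow> 'g \<Rightarrow> 'a set set \<Rightarrow> 'a set set" where
  "end_action \<alpha> g u = (\<lambda>R. \<alpha> g ` R) ` u"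

definition equivariant_on ::
    "('g, 'm) monoid_scheme \<Rightarrow> 'x set \<Rightarrow> ('g \<Rightarrow> 'x \<Rightarrow> 'x) \<Rightarrow> ('g \<Rightarrow> 'y \<Rightarrow> 'y) \<Rightarrow>
      ('x \<Rightarrow> 'y) \<Rightarrow> bool" where
  "equivariant_on G X \<alpha> \<beta> h \<longleftrightarrow> (\<forall>g\<in>carrier G. \<forall>x\<in>X. h (\<alpha> g x) = \<beta> g (h x))"

definition two_transitive_on ::
    "('g, 'm) monoid_scheme \<Rightarrow> 'x set \<Rightarrow> ('g \<Rightarrow> 'x \<Rightarrow> 'x) \<Rightarrow> bool" where
  "two_transitive_on G X \<alpha> \<longleftrightarrow>
     (\<forall>u\<in>X. \<forall>v\<in>X. \<forall>u'\<in>X. \<forall>v'\<in>X. u \<noteq> v \<and> u' \<noteq> v' \<longrightarrow>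
        (\<exists>g\<in>carrier G. \<alpha> g u = u' \<and> \<alpha> g v = v'))"

end

theory Submission
  imports Defs
begin

text \<open>
  The isometry is found from the action on the ends alone; the coarse equivalence only provides
  the bijection \<open>bd\<close> between the ends, the comparability of translation lengths, and the estimate
  for the distance between the isometry and the coarse equivalence.

  An isometry that fixes an end \<open>u\<close> changes the Busemann function of \<open>u\<close> by a constant, its
  shift. If an element of the group fixes two ends, it translates the apartments between
  these ends in both trees. The coarse equivalence maps a center of three ends, the
  point where their tripod branches, close to the center of the corresponding ends
  (\<open>center_image_close\<close>, a consequence of the stability of geodesics). Iterating the translation
  shows that the two shifts bound each other linearly, and a Lipschitz homomorphism
  between subgroups of the reals is linear. As an isometry with a nonzero shift at one fixed end has
  an axis, and as the action on pairs of ends is transitive, all shifts in the second tree are those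
  in the first one times a single positive constant \<open>c\<close> (\<open>ratio_exists\<close>). This includes the case in
  which all shifts vanish, where any \<open>c\<close> will do.

  The key step is that distances between centers are scaled by \<open>c\<close> as well, although two centers
  need not lie in the same orbit. On the apartment between \<open>u\<close> and \<open>v\<close> let \<open>z\<close> be the center of
  \<open>u\<close>, \<open>v\<close>, \<open>w\<close>. By 2-transitivity there are elements that fix \<open>v\<close> and move \<open>u\<close> to \<open>w\<close>, that fix
  \<open>w\<close> and move \<open>v\<close> to \<open>u\<close>, and that fix \<open>u\<close> and move \<open>w\<close> to \<open>v\<close>. Their composition reverses the
  apartment, and the displacement of \<open>z\<close> under it is a combination of the three shifts
  (\<open>shift_around_tripod\<close>). Comparing the reversals that belong to two ends \<open>w\<close> expresses the
  distance between the two centers by shifts (\<open>distance_from_reflections\<close>,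
  \<open>center_displacement\<close>).

  The image of a point is then the point with the same Busemann coordinates with respect to
  all ends and all matched centers, up to the factor \<open>c\<close>. That this system of equations is
  solvable is the content of \<open>correspondsI\<close>; its solution is unique, depends equivariantly on the
  point and scales distances by \<open>c\<close>, since a distance in a leafless tree is the maximum of the
  differences of Busemann functions. Two different branch points force a nonzero shift, so that
  centers are coarsely dense, which gives the finite distance to the coarse equivalence; and they
  fix the scaling factor of any isometry with the same boundary map, which gives uniqueness.
\<close>

section \<open>Geodesics and the four-point inequality\<close>

lemma geodesicD: "geodesic J \<gamma> \<Longrightarrow> s \<in> J \<Longrightarrow> t \<in> J \<Longrightarrow> dist (\<gamma> s) (\<gamma> t) = \<bar>s - t\<bar>"
  by (auto simp: geodesic_def dist_real_def)

lemma geodesic_iff: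
  "geodesic UNIV \<gamma> \<longleftrightarrow> (\<forall>s t. dist (\<gamma> s) (\<gamma> t) = \<bar>s - t\<bar>)"
  "geodesic {a..} \<gamma> \<longleftrightarrow> (\<forall>s\<ge>a. \<forall>t\<ge>a. dist (\<gamma> s) (\<gamma> t) = \<bar>s - t\<bar>)"
  "geodesic {a..b} \<gamma> \<longleftrightarrow>
     a \<le> b \<and> (\<forall>s\<in>{a..b}. \<forall>t\<in>{a..b}. dist (\<gamma> s) (\<gamma> t) = \<bar>s - t\<bar>)"
  by (auto simp: geodesic_def dist_real_def is_interval_univ is_interval_ci is_interval_cc)

text \<open>
  A nonexpanding path whose endpoints are as far apart as its parameters cannot lose length
  anywhere in between.
\<close>

lemma isometric_if_nonexpanding:
  fixes \<gamma> :: "real \<Rightarrow> 'a::metric_space"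
  assumes lip: "\<And>s t. a \<le> s \<Longrightarrow> s \<le> t \<Longrightarrow> t \<le> b \<Longrightarrow> dist (\<gamma> s) (\<gamma> t) \<le> t - s"
    and ends: "b - a \<le> dist (\<gamma> a) (\<gamma> b)"
    and st: "s \<in> {a..b}" "t \<in> {a..b}"
  shows "dist (\<gamma> s) (\<gamma> t) = \<bar>s - t\<bar>"
proof -
  have *: "dist (\<gamma> s) (\<gamma> t) = t - s" if "a \<le> s" "s \<le> t" "t \<le> b" for s t
    using lip[of a s] lip[of s t] lip[of t b] that ends
      dist_triangle[of "\<gamma> a" "\<gamma> b" "\<gamma> s"] dist_triangle[of "\<gamma> s" "\<gamma> b" "\<gamma> t"] by auto
  show ?thesis using *[of s t] *[of t s] st by (cases "s \<le> t") (auto simp: dist_commute)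
qed

text \<open>
  By the triangle inequality, gluing two geodesic pieces only requires to know the distance
  between the two extreme points.
\<close>

lemma isometric_concat:
  fixes \<gamma> \<delta> :: "real \<Rightarrow> 'a::metric_space"
  assumes \<gamma>: "\<And>s t. s \<in> {a..b} \<Longrightarrow> t \<in> {a..b} \<Longrightarrow> dist (\<gamma> s) (\<gamma> t) = \<bar>s - t\<bar>"
    and \<delta>: "\<And>s t. s \<in> {b..c} \<Longrightarrow> t \<in> {b..c} \<Longrightarrow> dist (\<delta> s) (\<delta> t) = \<bar>s - t\<bar>"
    and eq: "\<gamma> b = \<delta> b" "a \<le> b" "b \<le> c"
    and len: "c - a \<le> dist (\<gamma> a) (\<delta> c)"
    and st: "s \<in> {a..c}" "t \<in> {a..c}"
  defines "\<eta> \<equiv> (\<lambda>t. if t \<le> b then \<gamma> t else \<delta> t)"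
  shows "dist (\<eta> s) (\<eta> t) = \<bar>s - t\<bar>"
proof (rule isometric_if_nonexpanding[OF _ _ st])
  fix s t assume st: "a \<le> s" "s \<le> t" "t \<le> c"
  have "dist (\<gamma> s) (\<delta> t) \<le> t - s" if "s \<le> b" "b < t"
    using \<gamma>[of s b] \<delta>[of b t] that st eq dist_triangle[of "\<gamma> s" "\<delta> t" "\<gamma> b"] by auto
  then show "dist (\<eta> s) (\<eta> t) \<le> t - s"
    using \<gamma>[of s t] \<delta>[of s t] st by (auto simp: \<eta>_def)
next
  have "\<eta> c = \<delta> c" using eq by (auto simp: \<eta>_def)
  then show "c - a \<le> dist (\<eta> a) (\<eta> c)" using len eq by (simp add: \<eta>_def)
qed

locale leafless_tree =
  fixes T :: "'a::metric_space itself"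
  assumes tree: "tree T" and leafless: "leafless T"
begin

lemma geodesic_between_exists: "\<exists>\<gamma>. geodesic_between (x::'a) y \<gamma>"
  using tree unfolding tree_def by blast

lemma geodesic_between_unique:
  assumes "geodesic_between (x::'a) y \<gamma>" "geodesic_between x y \<gamma>'" "t \<in> {0..dist x y}"
  shows "\<gamma> t = \<gamma>' t"
proof -
  have ex1: "\<exists>!\<gamma>. \<gamma> \<in> extensional {0..dist x y} \<and> geodesic_between x y \<gamma>"
    using tree unfolding tree_def by blast
  have *: "geodesic_between x y (restrict \<delta> {0..dist x y})" if "geodesic_between x y \<delta>" for \<delta>
    using that by (auto simp: geodesic_between_def geodesic_iff)
  have "restrict \<gamma> {0..dist x y} = restrict \<gamma>' {0..dist x y}"
    using ex1 *[OF assms(1)] *[OF assms(2)] by (metis restrict_extensional)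
  then show ?thesis using assms(3) by (metis restrict_apply')
qed

lemma geodesic_through:
  assumes "dist (x::'a) p + dist p y = dist x y"
  shows "\<exists>\<gamma>. geodesic_between x y \<gamma> \<and> \<gamma> (dist x p) = p"
proof -
  obtain \<gamma> \<delta> where \<gamma>: "geodesic_between x p \<gamma>" and \<delta>: "geodesic_between p y \<delta>"
    using geodesic_between_exists by meson
  let ?a = "dist x p" and ?D = "dist x y"
  define \<eta> where "\<eta> = (\<lambda>t. if t \<le> ?a then \<gamma> t else \<delta> (t - ?a))"
  have 1: "\<gamma> 0 = x" "\<gamma> ?a = p" "\<delta> 0 = p" "\<delta> (dist p y) = y"
    "\<And>s t. s \<in> {0..?a} \<Longrightarrow> t \<in> {0..?a} \<Longrightarrow> dist (\<gamma> s) (\<gamma> t) = \<bar>s - t\<bar>"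
    "\<And>s t. s \<in> {0..dist p y} \<Longrightarrow> t \<in> {0..dist p y} \<Longrightarrow> dist (\<delta> s) (\<delta> t) = \<bar>s - t\<bar>"
    using \<gamma> \<delta> by (auto simp: geodesic_between_def geodesic_iff)
  have eq: "?D - ?a = dist p y" using assms by simp
  have "dist (\<eta> s) (\<eta> t) = \<bar>s - t\<bar>" if "s \<in> {0..?D}" "t \<in> {0..?D}" for s t
    unfolding \<eta>_def
    by (rule isometric_concat[where a = 0 and c = ?D]) (use 1 assms that zero_le_dist[of p y] zero_le_dist[of x p] in \<open>auto simp: eq simp del: zero_le_dist\<close>)
  moreover have "\<eta> 0 = x" "\<eta> ?a = p"
    using 1 by (auto simp: \<eta>_def)
  moreover have "\<eta> ?D = y"
  proof (cases "p = y")
    case False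
    then have "\<not> ?D \<le> ?a" using assms by (metis dist_le_zero_iff add_le_same_cancel1)
    then show ?thesis using 1 eq by (simp add: \<eta>_def)
  qed (use 1 in \<open>simp add: \<eta>_def\<close>)
  ultimately show ?thesis
    by (intro exI[of _ \<eta>]) (auto simp: geodesic_between_def geodesic_iff)
qed

lemma geodesic_between_point:
  assumes "geodesic_between (x::'a) y \<gamma>" "0 \<le> t" "t \<le> dist x y"
  shows "dist x (\<gamma> t) = t" "dist (\<gamma> t) y = dist x y - t"
  using assms geodesicD[of "{0..dist x y}" \<gamma> 0 t] geodesicD[of "{0..dist x y}" \<gamma> t "dist x y"]
  by (auto simp: geodesic_between_def)

lemma between_unique:
  assumes "dist (x::'a) p + dist p y = dist x y" "dist x q + dist q y = dist x y"
    and "dist x p = dist x q"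
  shows "p = q"
proof -
  obtain \<gamma> \<delta> where "geodesic_between x y \<gamma>" "\<gamma> (dist x p) = p"
    "geodesic_between x y \<delta>" "\<delta> (dist x q) = q"
    using geodesic_through assms by meson
  then show ?thesis
    using geodesic_between_unique[of x y \<gamma> \<delta> "dist x p"] assms
    by (metis atLeastAtMost_iff le_add_same_cancel1 zero_le_dist)
qed

lemma segment_iff: "p \<in> tree_segment (x::'a) y \<longleftrightarrow> dist x p + dist p y = dist x y"
proof
  assume "p \<in> tree_segment x y"
  then show "dist x p + dist p y = dist x y"
    by (auto simp: tree_segment_def geodesic_between_point)
next
  assume "dist x p + dist p y = dist x y"
  then obtain \<gamma> where "geodesic_between x y \<gamma>" "\<gamma> (dist x p) = p" using geodesic_through by blast
  moreover have "dist x p \<in> {0..dist x y}" using \<open>dist x p + dist p y = dist x y\<close>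
    by (metis atLeastAtMost_iff le_add_same_cancel1 zero_le_dist)
  ultimately show "p \<in> tree_segment x y"
    unfolding tree_segment_def by (smt (verit) mem_Collect_eq)
qed

text \<open>
  The hypothesis makes the concatenation of the two geodesics injective, which is what the
  second axiom of a tree asks for.
\<close>

lemma concat_if_disjoint:
  assumes disj: "\<And>p. dist y p + dist p m = dist y m \<Longrightarrow> dist m p + dist p z = dist m z \<Longrightarrow> p = m"
  shows "dist (y::'a) z = dist y m + dist m z"
proof (cases "y = m \<or> z = m")
  case True
  then show ?thesis by auto
next
  case False
  obtain \<gamma> \<delta> where \<gamma>: "geodesic_between y m \<gamma>" and \<delta>: "geodesic_between m z \<delta>"
    using geodesic_between_exists by meson
  let ?r = "dist y m" and ?s = "dist y m + dist m z"
  define \<eta> where "\<eta> = (\<lambda>t. if t \<le> ?r then \<gamma> t else \<delta> (t - ?r))"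
  have 1: "\<gamma> 0 = y" "\<gamma> ?r = m" "\<delta> 0 = m" "\<delta> (dist m z) = z"
    "\<And>s t. s \<in> {0..?r} \<Longrightarrow> t \<in> {0..?r} \<Longrightarrow> dist (\<gamma> s) (\<gamma> t) = \<bar>s - t\<bar>"
    "\<And>s t. s \<in> {0..dist m z} \<Longrightarrow> t \<in> {0..dist m z} \<Longrightarrow> dist (\<delta> s) (\<delta> t) = \<bar>s - t\<bar>"
    using \<gamma> \<delta> by (auto simp: geodesic_between_def geodesic_iff)
  have pos: "0 < ?r" "?r < ?s" using False by auto
  have g1: "geodesic {0..?r} \<eta>" using 1 by (auto simp: geodesic_iff \<eta>_def)
  have \<eta>2: "\<eta> t = \<delta> (t - ?r)" if "t \<in> {?r..?s}" for t
    using that 1 by (auto simp: \<eta>_def)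
  have g2: "geodesic {?r..?s} \<eta>" using 1 by (auto simp: geodesic_iff \<eta>2)
  have cross: False if "0 \<le> s" "s \<le> ?r" "?r < t" "t \<le> ?s" "\<eta> s = \<eta> t" for s t
  proof -
    have "\<gamma> s = m"
    proof (rule disj)
      show "dist y (\<gamma> s) + dist (\<gamma> s) m = dist y m"
        using geodesic_between_point[OF \<gamma>] that by auto
      have "\<gamma> s = \<delta> (t - ?r)" using that by (auto simp: \<eta>_def)
      then show "dist m (\<gamma> s) + dist (\<gamma> s) z = dist m z"
        using geodesic_between_point[OF \<delta>, of "t - ?r"] that by auto
    qed
    then have "\<delta> (t - ?r) = \<delta> 0" using that 1 by (auto simp: \<eta>_def)
    then show False using 1(6)[of "t - ?r" 0] that by auto
  qed
  have "inj_on \<eta> {0..?s}"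
  proof (rule inj_onI)
    fix s t assume st: "s \<in> {0..?s}" "t \<in> {0..?s}" "\<eta> s = \<eta> t"
    consider "s \<le> ?r" "t \<le> ?r" | "s \<le> ?r" "?r < t" | "t \<le> ?r" "?r < s" | "?r < s" "?r < t"
      by linarith
    then show "s = t"
    proof cases
      case 1 then show ?thesis using geodesicD[OF g1, of s t] st by auto
    next
      case 2 then show ?thesis using cross[of s t] st by auto
    next
      case 3 then show ?thesis using cross[of t s] st by auto
    next
      case 4 then show ?thesis using geodesicD[OF g2, of s t] st by auto
    qed
  qed
  then have "geodesic {0..?s} \<eta>"
    using tree pos g1 g2 unfolding tree_def by blast
  from geodesicD[OF this, of 0 ?s] show ?thesis
    using 1 pos \<eta>2[of ?s] by (auto simp: \<eta>_def)
qed

text \<open>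
  The median is the point at which the geodesics from \<open>x\<close> to \<open>y\<close> and to \<open>z\<close> separate: behind it
  they are disjoint, so that their remainders form a geodesic from \<open>y\<close> to \<open>z\<close>.
\<close>

lemma median_exists:
  "\<exists>m::'a. dist x m + dist m y = dist x y \<and> dist x m + dist m z = dist x z \<and>
     dist y m + dist m z = dist y z"
proof -
  obtain \<gamma> \<delta> where \<gamma>: "geodesic_between x y \<gamma>" and \<delta>: "geodesic_between x z \<delta>"
    using geodesic_between_exists by meson
  define S where "S = {t. 0 \<le> t \<and> t \<le> dist x y \<and> t \<le> dist x z \<and> \<gamma> t = \<delta> t}"
  have "0 \<in> S" using \<gamma> \<delta> by (auto simp: S_def geodesic_between_def)
  have bdd: "bdd_above S" by (auto simp: S_def intro: bdd_aboveI[of _ "dist x y"])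
  define r where "r = Sup S"
  have up: "t \<le> r" if "t \<in> S" for t using that bdd by (simp add: r_def cSup_upper)
  have r0: "0 \<le> r" using up \<open>0 \<in> S\<close> by blast
  have rle: "r \<le> dist x y" "r \<le> dist x z"
    unfolding r_def using \<open>0 \<in> S\<close> by (auto intro!: cSup_least simp: S_def)
  have "\<gamma> r = \<delta> r"
  proof (rule ccontr)
    assume "\<gamma> r \<noteq> \<delta> r"
    then have "r - dist (\<gamma> r) (\<delta> r) / 2 < r" by simp
    then obtain t where t: "t \<in> S" "r - dist (\<gamma> r) (\<delta> r) / 2 < t"
      unfolding r_def using less_cSup_iff[of S] bdd \<open>0 \<in> S\<close> by blast
    have "dist (\<gamma> r) (\<gamma> t) = r - t" "dist (\<delta> t) (\<delta> r) = r - t"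
      using geodesicD[of _ \<gamma> r t] geodesicD[of _ \<delta> t r] \<gamma> \<delta> t up[OF t(1)] r0 rle
      by (auto simp: S_def geodesic_between_def)
    then show False
      using dist_triangle[of "\<gamma> r" "\<delta> r" "\<gamma> t"] t by (auto simp: S_def)
  qed
  define m where "m = \<gamma> r"
  have my: "dist x m = r" "dist m y = dist x y - r" and mz: "dist m z = dist x z - r"
    using geodesic_between_point[OF \<gamma> r0 rle(1)] geodesic_between_point[OF \<delta> r0 rle(2)]
      \<open>\<gamma> r = \<delta> r\<close> by (auto simp: m_def)
  have "dist y z = dist y m + dist m z"
  proof (rule concat_if_disjoint)
    fix p assume p: "dist y p + dist p m = dist y m" "dist m p + dist p z = dist m z"
    have py: "dist x p + dist p y = dist x y"
      using p my dist_triangle[of x p m] dist_triangle[of x y p] by (simp add: dist_commute)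
    have pz: "dist x p + dist p z = dist x z"
      using p my mz dist_triangle[of x p m] dist_triangle[of x z p] by (simp add: dist_commute)
    let ?t = "dist x p"
    have t: "?t \<le> dist x y" "?t \<le> dist x z"
      using py pz zero_le_dist[of p y] zero_le_dist[of p z] by linarith+
    have "\<gamma> ?t = p"
      using between_unique[of x "\<gamma> ?t" y p] geodesic_between_point[OF \<gamma> _ t(1)] py by auto
    moreover have "\<delta> ?t = p"
      using between_unique[of x "\<delta> ?t" z p] geodesic_between_point[OF \<delta> _ t(2)] pz by auto
    ultimately have "?t \<in> S" using t by (auto simp: S_def)
    then have "?t \<le> r" by (rule up)
    moreover have "dist x p = r + dist m p"
      using p my py by (simp add: dist_commute)
    ultimately show "p = m" by (metis add_le_same_cancel1 dist_le_zero_iff)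
  qed
  then show ?thesis using my mz by (intro exI[of _ m]) auto
qed

text \<open>
  A path that turned back would have a point \<open>p \<noteq> n\<close> on both pieces. The median of \<open>p\<close>, \<open>m\<close> and
  \<open>n\<close> can only be \<open>n\<close>, so that \<open>n\<close> lies between \<open>p\<close> and \<open>m\<close>; but both precede \<open>n\<close> on the
  geodesic from \<open>z\<close>, which forces \<open>p = n\<close>.
\<close>

lemma concat_overlapping:
  assumes "dist z m + dist m n = dist z n" "dist m n + dist n w = dist m w" "m \<noteq> (n::'a)"
  shows "dist z w = dist z n + dist n w"
proof (rule concat_if_disjoint)
  fix p assume p: "dist z p + dist p n = dist z n" "dist n p + dist p w = dist n w"
  obtain q where q: "dist p q + dist q m = dist p m" "dist p q + dist q n = dist p n"
    "dist m q + dist q n = dist m n"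
    using median_exists[of p m n] by blast
  have "dist z q + dist q n = dist z n"
    using p q dist_triangle[of z q p] dist_triangle[of z n q] by auto
  moreover have qw: "dist n q + dist q w = dist n w"
    using p q dist_triangle[of q w p] dist_triangle[of n w q] by (simp add: dist_commute)
  have "q = n"
  proof -
    have "dist m w \<le> dist m q + dist q w" by (rule dist_triangle)
    then have "dist q n = 0"
      using q(3) qw assms(2) zero_le_dist[of q n] dist_commute[of q n] by linarith
    then show ?thesis by simp
  qed
  then have "dist p n + dist n m = dist p m" using q by simp
  moreover have "dist z m \<le> dist z n" "dist z p \<le> dist z n"
    using assms p zero_le_dist by (metis le_add_same_cancel1)+
  ultimately show "p = n"
  proof -
    obtain \<gamma> \<delta> where g: "geodesic_between z n \<gamma>" "\<gamma> (dist z m) = m"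
      "geodesic_between z n \<delta>" "\<delta> (dist z p) = p"
      using geodesic_through[OF assms(1)] geodesic_through[OF p(1)] by blast
    have "\<gamma> (dist z p) = p"
      using geodesic_between_unique[OF g(1,3), of "dist z p"] g \<open>dist z p \<le> dist z n\<close> by auto
    then have "dist p m = \<bar>dist z p - dist z m\<bar>"
      using geodesicD[of "{0..dist z n}" \<gamma> "dist z p" "dist z m"] g
        \<open>dist z p \<le> dist z n\<close> \<open>dist z m \<le> dist z n\<close> by (auto simp: geodesic_between_def)
    moreover have "0 < dist m n" using assms(3) by simp
    ultimately have "dist p n = 0"
      using \<open>dist p n + dist n m = dist p m\<close> p(1) assms(1) dist_commute[of n m]
        zero_le_dist[of p n] by linarith
    then show ?thesis by simp
  qed
qed

text \<open>
  Compare the points \<open>m\<close> and \<open>n\<close> at which the branches to \<open>z\<close> and to \<open>w\<close> leave the geodesic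
  from \<open>x\<close> to \<open>y\<close>: if they differ, the geodesic from \<open>z\<close> to \<open>w\<close> runs through both. From here on,
  this inequality replaces the second axiom of a tree, and most facts about the position of
  points reduce to linear arithmetic with distances.
\<close>

lemma four_point:
  "dist (x::'a) y + dist z w \<le> max (dist x z + dist y w) (dist x w + dist y z)"
proof -
  obtain m where m: "dist x m + dist m y = dist x y" "dist x m + dist m z = dist x z"
     "dist y m + dist m z = dist y z" using median_exists[of x y z] by blast
  obtain n where n: "dist x n + dist n y = dist x y" "dist x n + dist n w = dist x w"
     "dist y n + dist n w = dist y w" using median_exists[of x y w] by blast
  have main: "dist x y + dist z w \<le> dist x w + dist y z"
    if m: "dist x m + dist m y = dist x y" "dist x m + dist m z = dist x z"
     "dist y m + dist m z = dist y z"
    and n: "dist x n + dist n y = dist x y" "dist x n + dist n w = dist x w"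
     "dist y n + dist n w = dist y w" and less: "dist x m < dist x n" for m n z w
  proof -
    obtain \<gamma> \<delta> where g: "geodesic_between x y \<gamma>" "\<gamma> (dist x m) = m"
      "geodesic_between x y \<delta>" "\<delta> (dist x n) = n"
      using geodesic_through[OF m(1)] geodesic_through[OF n(1)] by blast
    have le: "dist x m \<le> dist x y" "dist x n \<le> dist x y"
      using m n zero_le_dist by (metis le_add_same_cancel1)+
    have "\<gamma> (dist x n) = n"
      using geodesic_between_unique[OF g(1,3), of "dist x n"] g le by auto
    then have mn: "dist m n = dist x n - dist x m"
      using geodesicD[of "{0..dist x y}" \<gamma> "dist x m" "dist x n"] g le less
      by (auto simp: geodesic_between_def)
    have "dist z m + dist m n = dist z n"
      using dist_triangle[of z y n] dist_triangle[of z n m] m n mn by (simp add: dist_commute)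
    moreover have "dist m n + dist n w = dist m w"
      using dist_triangle[of x w m] dist_triangle[of m w n] m n mn by (simp add: dist_commute)
    moreover have "m \<noteq> n" using less by auto
    ultimately have "dist z w = dist z n + dist n w" by (rule concat_overlapping)
    then show ?thesis using m n mn \<open>dist z m + dist m n = dist z n\<close> by (simp add: dist_commute)
  qed
  consider "dist x m < dist x n" | "dist x n < dist x m" | "dist x m = dist x n" by linarith
  then show ?thesis
  proof cases
    case 1
    then show ?thesis using main[OF m n] by auto
  next
    case 2
    then show ?thesis using main[OF n m] by (auto simp: dist_commute)
  next
    case 3
    then have "m = n" using between_unique m n by blast
    then show ?thesis using m n dist_triangle[of z w m] by (auto simp: dist_commute)
  qed
qed

end

section \<open>Rays and ends\<close>

definition end_of :: "(real \<Rightarrow> 'a::metric_space) \<Rightarrow> 'a set set" where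
  "end_of \<rho> = ray_equiv `` {\<rho> ` {0..}}"

text \<open>
  Rays are handled through their parametrizations: two of them are equivalent precisely when
  they agree after shifting the parameters.
\<close>

definition same_tail :: "(real \<Rightarrow> 'a) \<Rightarrow> (real \<Rightarrow> 'a) \<Rightarrow> bool" where
  "same_tail \<rho> \<sigma> \<longleftrightarrow> (\<exists>a\<ge>0. \<exists>b\<ge>0. \<forall>t\<ge>0. \<rho> (a + t) = \<sigma> (b + t))"

text \<open>
  A ray inside a ray or a line is parametrized by such a function: it runs with unit speed in
  one of the two directions.
\<close>

lemma isometric_half_line:
  fixes s :: "real \<Rightarrow> real"
  assumes iso: "\<And>t t'. 0 \<le> t \<Longrightarrow> 0 \<le> t' \<Longrightarrow> \<bar>s t - s t'\<bar> = \<bar>t - t'\<bar>"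
  shows "(\<forall>t\<ge>0. s t = s 0 + t) \<or> (\<forall>t\<ge>0. s t = s 0 - t)"
proof -
  have 1: "s t = s 0 + t \<or> s t = s 0 - t" if "0 \<le> t" for t
    using iso[of t 0] that by (auto simp: abs_if split: if_splits)
  have 2: "(s t = s 0 + t) = (s t' = s 0 + t')" if "0 < t" "0 < t'" for t t'
    using iso[of t t'] 1[of t] 1[of t'] that by (auto simp: abs_if split: if_splits)
  have "(\<forall>t>0. s t = s 0 + t) \<or> (\<forall>t>0. s t = s 0 - t)"
    using 1 2 by (metis less_eq_real_def)
  then show ?thesis by (metis add_cancel_right_right diff_zero less_eq_real_def)
qed

lemma same_tail_sym: "same_tail \<rho> \<sigma> \<Longrightarrow> same_tail \<sigma> \<rho>"
  unfolding same_tail_def by metis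

lemma same_tail_trans:
  assumes "same_tail \<rho> \<sigma>" "same_tail \<sigma> \<tau>"
  shows "same_tail \<rho> \<tau>"
proof -
  obtain a b c d where 1: "0 \<le> a" "0 \<le> b" "\<And>t. 0 \<le> t \<Longrightarrow> \<rho> (a + t) = \<sigma> (b + t)"
    and 2: "0 \<le> c" "0 \<le> d" "\<And>t. 0 \<le> t \<Longrightarrow> \<sigma> (c + t) = \<tau> (d + t)"
    using assms unfolding same_tail_def by metis
  have "\<rho> ((a + c) + t) = \<tau> ((d + b) + t)" if "0 \<le> t" for t
  proof -
    have "\<rho> (a + (c + t)) = \<sigma> (b + (c + t))" using 1(3)[of "c + t"] 2(1) that by simp
    moreover have "\<sigma> (c + (b + t)) = \<tau> (d + (b + t))" using 2(3)[of "b + t"] 1(2) that by simp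
    ultimately show ?thesis by (simp add: ac_simps)
  qed
  then show ?thesis unfolding same_tail_def
    using 1 2 by (intro exI[of _ "a + c"] conjI exI[of _ "d + b"]) auto
qed

lemma ray_subset_ray:
  assumes \<rho>: "geodesic {0..} \<rho>" and \<eta>: "geodesic {0..} \<eta>" and sub: "\<eta> ` {0..} \<subseteq> \<rho> ` {0..}"
  shows "\<exists>a\<ge>0. \<forall>t\<ge>0. \<eta> t = \<rho> (a + t)"
proof -
  have "\<forall>t\<in>{0..}. \<exists>s. 0 \<le> s \<and> \<eta> t = \<rho> s" using sub by auto
  then obtain s where s: "\<And>t. 0 \<le> t \<Longrightarrow> 0 \<le> s t \<and> \<eta> t = \<rho> (s t)" by (metis atLeast_iff)
  have "\<bar>s t - s t'\<bar> = \<bar>t - t'\<bar>" if "0 \<le> t" "0 \<le> t'" for t t'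
    using s[OF that(1)] s[OF that(2)] geodesicD[OF \<rho>, of "s t" "s t'"]
      geodesicD[OF \<eta>, of t t'] that by simp
  from isometric_half_line[of s, OF this]
  have plus: "\<forall>t\<ge>0. s t = s 0 + t"
  proof
    assume minus: "\<forall>t\<ge>0. s t = s 0 - t"
    have "0 \<le> s 0 + 1" using s[of 0] by simp
    then have "s (s 0 + 1) = s 0 - (s 0 + 1)" "0 \<le> s (s 0 + 1)" using minus s by blast+
    then show ?thesis by simp
  next
    assume "\<forall>t\<ge>0. s t = s 0 + t"
    then show ?thesis .
  qed
  have "\<eta> t = \<rho> (s 0 + t)" if "0 \<le> t" for t
    using s[OF that] plus[rule_format, OF that] by metis
  moreover have "0 \<le> s 0" using s[of 0] by simp
  ultimately show ?thesis by blast
qed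

lemma geodesic_shift: "geodesic {0..} \<rho> \<Longrightarrow> 0 \<le> a \<Longrightarrow> geodesic {0..} (\<lambda>t. \<rho> (a + t))"
  by (auto simp: geodesic_iff)

context leafless_tree
begin

text \<open>
  If the tails agree, the parameters at which the rays meet differ by a constant \<open>d\<close>, and the
  set \<open>E\<close> of these parameters on \<open>\<rho>\<close> is closed upwards; that it contains its infimum makes the
  intersection a ray.
\<close>

lemma same_tail_iff_ray_equiv:
  assumes \<rho>: "geodesic {0..} (\<rho>::real \<Rightarrow> 'a)" and \<sigma>: "geodesic {0..} \<sigma>"
  shows "(\<rho> ` {0..}, \<sigma> ` {0..}) \<in> ray_equiv \<longleftrightarrow> same_tail \<rho> \<sigma>"
proof
  assume "(\<rho> ` {0..}, \<sigma> ` {0..}) \<in> ray_equiv"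
  then obtain \<eta> where "geodesic {0..} \<eta>" "\<rho> ` {0..} \<inter> \<sigma> ` {0..} = \<eta> ` {0..}"
    by (auto simp: ray_equiv_def ray_def)
  then show "same_tail \<rho> \<sigma>"
    using ray_subset_ray[OF \<rho>, of \<eta>] ray_subset_ray[OF \<sigma>, of \<eta>] unfolding same_tail_def
    by (metis inf_le1 inf_le2)
next
  assume "same_tail \<rho> \<sigma>"
  then obtain a b where ab: "0 \<le> a" "0 \<le> b" "\<And>t. 0 \<le> t \<Longrightarrow> \<rho> (a + t) = \<sigma> (b + t)"
    unfolding same_tail_def by metis
  define d where "d = b - a"
  define E where "E = {s. 0 \<le> s \<and> 0 \<le> s + d \<and> \<rho> s = \<sigma> (s + d)}"
  have dist\<rho>: "dist (\<rho> s) (\<rho> t) = \<bar>s - t\<bar>" if "0 \<le> s" "0 \<le> t" for s t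
    using \<rho> that by (auto simp: geodesic_iff)
  have dist\<sigma>: "dist (\<sigma> s) (\<sigma> t) = \<bar>s - t\<bar>" if "0 \<le> s" "0 \<le> t" for s t
    using \<sigma> that by (auto simp: geodesic_iff)
  have aE: "a + t \<in> E" if "0 \<le> t" for t
  proof -
    have eq: "b + t = a + t + d" by (simp add: d_def)
    then have "\<rho> (a + t) = \<sigma> (a + t + d)" using ab(3)[OF that] by metis
    moreover have "0 \<le> a + t" "0 \<le> a + t + d" using ab(1,2) that eq by linarith+
    ultimately show ?thesis by (simp add: E_def)
  qed
  have meet: "t = s + d \<and> s \<in> E" if "0 \<le> s" "0 \<le> t" "\<rho> s = \<sigma> t" for s t
  proof -
    let ?N = "a + s + t + \<bar>d\<bar> + 1"
    have N: "\<rho> ?N = \<sigma> (?N + d)" "0 \<le> ?N + d" using aE[of "s + t + \<bar>d\<bar> + 1"] that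
      by (auto simp: E_def algebra_simps)
    have "?N - s = ?N + d - t" using dist\<rho>[of ?N s] dist\<sigma>[of "?N + d" t] N that ab by auto
    then show ?thesis using that by (auto simp: E_def)
  qed
  have upward: "s' \<in> E" if "s \<in> E" "s \<le> s'" for s s'
  proof -
    let ?N = "a + s'"
    have N: "?N \<in> E" using aE[of s'] that by (auto simp: E_def)
    have "\<rho> s' = \<sigma> (s' + d)"
    proof (rule between_unique[of "\<rho> s" _ "\<rho> ?N"])
      have nn: "0 \<le> s" "0 \<le> s'" "0 \<le> ?N" "0 \<le> s + d" "0 \<le> s' + d" "0 \<le> ?N + d"
        using that N ab by (auto simp: E_def)
      have eqs: "\<rho> s = \<sigma> (s + d)" "\<rho> ?N = \<sigma> (?N + d)" using that N by (auto simp: E_def)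
      have 1: "dist (\<rho> s) (\<rho> s') = s' - s" "dist (\<rho> s') (\<rho> ?N) = ?N - s'"
        "dist (\<rho> s) (\<rho> ?N) = ?N - s"
        using dist\<rho>[OF nn(1,2)] dist\<rho>[OF nn(2,3)] dist\<rho>[OF nn(1,3)] that ab by simp_all
      have 2: "dist (\<rho> s) (\<sigma> (s' + d)) = s' - s" "dist (\<sigma> (s' + d)) (\<rho> ?N) = ?N - s'"
        using dist\<sigma>[OF nn(4,5)] dist\<sigma>[OF nn(5,6)] that ab unfolding eqs by simp_all
      show "dist (\<rho> s) (\<rho> s') + dist (\<rho> s') (\<rho> ?N) = dist (\<rho> s) (\<rho> ?N)"
        "dist (\<rho> s) (\<sigma> (s' + d)) + dist (\<sigma> (s' + d)) (\<rho> ?N) = dist (\<rho> s) (\<rho> ?N)"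
        "dist (\<rho> s) (\<rho> s') = dist (\<rho> s) (\<sigma> (s' + d))"
        using 1 2 by simp_all
    qed
    then show ?thesis using that by (auto simp: E_def)
  qed
  define s0 where "s0 = Inf E"
  have bdd: "bdd_below E" by (auto simp: E_def intro: bdd_belowI[of _ 0])
  have lower: "s0 \<le> s" if "s \<in> E" for s using that bdd by (simp add: s0_def cInf_lower)
  have "0 \<le> s0" "- d \<le> s0" unfolding s0_def using aE[of 0]
    by (auto intro!: cInf_greatest simp: E_def)
  have "\<rho> s0 = \<sigma> (s0 + d)"
  proof (rule ccontr)
    assume "\<rho> s0 \<noteq> \<sigma> (s0 + d)"
    then have "s0 < s0 + dist (\<rho> s0) (\<sigma> (s0 + d)) / 2" by simp
    then obtain s where s: "s \<in> E" "s < s0 + dist (\<rho> s0) (\<sigma> (s0 + d)) / 2"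
      unfolding s0_def using cInf_less_iff[OF _ bdd] aE[of 0] by (metis empty_iff order_refl)
    have "dist (\<rho> s0) (\<rho> s) = s - s0" "dist (\<sigma> (s + d)) (\<sigma> (s0 + d)) = s - s0"
      using s(1) lower[OF s(1)] \<open>0 \<le> s0\<close> \<open>-d \<le> s0\<close> dist\<rho>[of s0 s] dist\<sigma>[of "s + d" "s0 + d"]
      by (simp_all add: E_def)
    moreover have "\<rho> s = \<sigma> (s + d)" using s(1) by (simp add: E_def)
    ultimately show False using s dist_triangle[of "\<rho> s0" "\<sigma> (s0 + d)" "\<rho> s"] by simp
  qed
  then have s0: "s0 \<in> E" using \<open>0 \<le> s0\<close> \<open>-d \<le> s0\<close> by (auto simp: E_def)
  have "\<rho> ` {0..} \<inter> \<sigma> ` {0..} = (\<lambda>t. \<rho> (s0 + t)) ` {0..}"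
  proof (intro subset_antisym subsetI)
    fix x assume "x \<in> \<rho> ` {0..} \<inter> \<sigma> ` {0..}"
    then obtain s t where st: "0 \<le> s" "0 \<le> t" "x = \<rho> s" "x = \<sigma> t" by auto
    then have "s0 \<le> s" using meet[of s t] lower by auto
    then show "x \<in> (\<lambda>t. \<rho> (s0 + t)) ` {0..}" using st by (intro image_eqI[of _ _ "s - s0"]) auto
  next
    fix x assume "x \<in> (\<lambda>t. \<rho> (s0 + t)) ` {0..}"
    then obtain t where "0 \<le> t" "x = \<rho> (s0 + t)" by auto
    moreover have "s0 + t \<in> E" using upward[OF s0] \<open>0 \<le> t\<close> by auto
    ultimately have "x = \<rho> (s0 + t)" "x = \<sigma> (s0 + t + d)" "s0 + t \<in> {0..}" "s0 + t + d \<in> {0..}"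
      by (auto simp: E_def)
    then show "x \<in> \<rho> ` {0..} \<inter> \<sigma> ` {0..}" by (metis IntI image_eqI)
  qed
  moreover have "ray ((\<lambda>t. \<rho> (s0 + t)) ` {0..})"
    unfolding ray_def using geodesic_shift[OF \<rho> \<open>0 \<le> s0\<close>] by blast
  ultimately show "(\<rho> ` {0..}, \<sigma> ` {0..}) \<in> ray_equiv"
    using \<rho> \<sigma> by (auto simp: ray_equiv_def ray_def)
qed

lemma equiv_ray_equiv: "equiv {R::'a set. ray R} ray_equiv"
proof (rule equivI)
  show "ray_equiv \<subseteq> {R::'a set. ray R} \<times> {R. ray R}" by (auto simp: ray_equiv_def)
  show "refl_on {R::'a set. ray R} ray_equiv" by (auto simp: refl_on_def ray_equiv_def)
  show "sym (ray_equiv :: ('a set \<times> 'a set) set)"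
    by (auto simp: sym_def ray_equiv_def Int_commute)
  show "trans (ray_equiv :: ('a set \<times> 'a set) set)"
  proof (rule transI)
    fix R R' R'' :: "'a set" assume a: "(R, R') \<in> ray_equiv" "(R', R'') \<in> ray_equiv"
    then obtain \<rho> \<sigma> \<tau> where "geodesic {0..} \<rho>" "R = \<rho> ` {0..}" "geodesic {0..} \<sigma>"
      "R' = \<sigma> ` {0..}" "geodesic {0..} \<tau>" "R'' = \<tau> ` {0..}"
      by (auto simp: ray_equiv_def ray_def)
    then show "(R, R'') \<in> ray_equiv"
      using a same_tail_iff_ray_equiv[of \<rho> \<sigma>] same_tail_iff_ray_equiv[of \<sigma> \<tau>]
        same_tail_iff_ray_equiv[of \<rho> \<tau>] same_tail_trans[of \<rho> \<sigma> \<tau>] by simp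
  qed
qed

lemma end_of_eq_iff:
  assumes "geodesic {0..} (\<rho>::real \<Rightarrow> 'a)" "geodesic {0..} \<sigma>"
  shows "end_of \<rho> = end_of \<sigma> \<longleftrightarrow> same_tail \<rho> \<sigma>"
  unfolding end_of_def same_tail_iff_ray_equiv[OF assms, symmetric]
  using assms by (intro eq_equiv_class_iff[OF equiv_ray_equiv]) (auto simp: ray_def)

lemma end_of_in_ends: "geodesic {0..} (\<rho>::real \<Rightarrow> 'a) \<Longrightarrow> end_of \<rho> \<in> ends"
  unfolding end_of_def ends_def by (rule quotientI) (auto simp: ray_def)

lemma ends_cases:
  assumes "u \<in> ends"
  obtains \<rho> :: "real \<Rightarrow> 'a" where "geodesic {0..} \<rho>" "end_of \<rho> = u"
  using assms unfolding ends_def quotient_def end_of_def ray_def by blast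

lemma in_end_of_iff:
  assumes "geodesic {0..} (\<rho>::real \<Rightarrow> 'a)"
  shows "R \<in> end_of \<rho> \<longleftrightarrow> (\<exists>\<sigma>. geodesic {0..} \<sigma> \<and> R = \<sigma> ` {0..} \<and> end_of \<sigma> = end_of \<rho>)"
proof
  assume "R \<in> end_of \<rho>"
  then have R: "(\<rho> ` {0..}, R) \<in> ray_equiv" by (simp add: end_of_def)
  then obtain \<sigma> where "geodesic {0..} \<sigma>" "R = \<sigma> ` {0..}" by (auto simp: ray_equiv_def ray_def)
  moreover have "end_of \<sigma> = end_of \<rho>"
    using R calculation assms same_tail_iff_ray_equiv end_of_eq_iff same_tail_sym by metis
  ultimately show "\<exists>\<sigma>. geodesic {0..} \<sigma> \<and> R = \<sigma> ` {0..} \<and> end_of \<sigma> = end_of \<rho>" by blast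
next
  assume "\<exists>\<sigma>. geodesic {0..} \<sigma> \<and> R = \<sigma> ` {0..} \<and> end_of \<sigma> = end_of \<rho>"
  then obtain \<sigma> where \<sigma>: "geodesic {0..} \<sigma>" "R = \<sigma> ` {0..}" "end_of \<sigma> = end_of \<rho>" by blast
  then have "(\<rho> ` {0..}, R) \<in> ray_equiv"
    using assms same_tail_iff_ray_equiv end_of_eq_iff by metis
  then show "R \<in> end_of \<rho>" by (simp add: end_of_def)
qed

lemma end_of_shift:
  assumes "geodesic {0..} (\<rho>::real \<Rightarrow> 'a)" "0 \<le> a"
  shows "end_of (\<lambda>t. \<rho> (a + t)) = end_of \<rho>"
proof -
  have "same_tail (\<lambda>t. \<rho> (a + t)) \<rho>" unfolding same_tail_def
    using assms by (intro exI[of _ 0] conjI exI[of _ a]) auto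
  then show ?thesis using assms geodesic_shift end_of_eq_iff by blast
qed

lemma dist_ray_eventually:
  assumes \<rho>: "geodesic {0..} (\<rho>::real \<Rightarrow> 'a)" and t: "dist x (\<rho> 0) \<le> s" "s \<le> t"
  shows "dist x (\<rho> t) = dist x (\<rho> s) + (t - s)"
proof -
  have s0: "0 \<le> s" using t zero_le_dist order_trans by blast
  have "dist (\<rho> 0) (\<rho> t) = t" "dist (\<rho> s) (\<rho> t) = t - s" "dist (\<rho> 0) (\<rho> s) = s"
    using \<rho> s0 t by (auto simp: geodesic_iff)
  moreover have "dist x (\<rho> s) + dist (\<rho> 0) (\<rho> t)
      \<le> max (dist x (\<rho> 0) + dist (\<rho> s) (\<rho> t)) (dist x (\<rho> t) + dist (\<rho> s) (\<rho> 0))"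
    by (rule four_point)
  ultimately show ?thesis
    using dist_triangle[of x "\<rho> t" "\<rho> s"] t zero_le_dist[of x "\<rho> s"] dist_commute[of "\<rho> s" "\<rho> 0"]
      dist_triangle[of "\<rho> s" "\<rho> t" x] dist_commute[of "\<rho> s" x] by linarith
qed

text \<open>
  The last hypothesis bounds the distance from \<open>p\<close> by the Gromov product of \<open>x\<close> and \<open>y\<close>; up to
  there the four-point inequality keeps the first geodesic on the second one.
\<close>

lemma agree_up_to_product:
  assumes "dist p X + dist X x = dist p x" "dist p Y + dist Y y = dist p y"
    and "dist p X = dist p (Y::'a)" "2 * dist p X \<le> dist p x + dist p y - dist x y"
  shows "X = Y"
proof -
  have "dist X y \<le> dist p y - dist p X"
    using four_point[of X y p x] assms by (auto simp: dist_commute max_def split: if_splits)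
  moreover have "dist X Y + dist p y \<le> max (dist X p + dist Y y) (dist X y + dist Y p)"
    by (rule four_point)
  ultimately have "dist X Y \<le> 0"
    using assms dist_commute[of X p] dist_commute[of Y p] by linarith
  then show ?thesis by simp
qed

lemma rays_diverge:
  assumes \<rho>: "geodesic {0..} (\<rho>::real \<Rightarrow> 'a)" and \<sigma>: "geodesic {0..} \<sigma>" and "\<rho> 0 = \<sigma> 0"
  obtains "\<And>t. 0 \<le> t \<Longrightarrow> \<rho> t = \<sigma> t"
  | r where "0 \<le> r" "\<And>t. 0 \<le> t \<Longrightarrow> t \<le> r \<Longrightarrow> \<rho> t = \<sigma> t"
    "\<And>s t. r \<le> s \<Longrightarrow> r \<le> t \<Longrightarrow> dist (\<rho> s) (\<sigma> t) = s + t - 2 * r"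
proof -
  have d: "dist (\<rho> s) (\<rho> t) = \<bar>s - t\<bar>" "dist (\<sigma> s) (\<sigma> t) = \<bar>s - t\<bar>" if "0 \<le> s" "0 \<le> t" for s t
    using \<rho> \<sigma> that by (auto simp: geodesic_iff)
  have down: "\<rho> s = \<sigma> s" if "\<rho> t = \<sigma> t" "0 \<le> s" "s \<le> t" for s t
    using between_unique[of "\<rho> 0" "\<rho> s" "\<rho> t" "\<sigma> s"] that assms(3) d(1)[of 0 s] d(1)[of s t]
      d(1)[of 0 t] d(2)[of 0 s] d(2)[of s t] by simp
  define S where "S = {t. 0 \<le> t \<and> \<rho> t = \<sigma> t}"
  show thesis
  proof (cases "bdd_above S")
    case False
    have "\<rho> t = \<sigma> t" if "0 \<le> t" for t
    proof -
      obtain s where "s \<in> S" "t < s" using False unfolding bdd_above_def by (meson not_le)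
      then show ?thesis using down[of s t] that by (auto simp: S_def)
    qed
    then show thesis by (rule that(1))
  next
    case True
    define r where "r = Sup S"
    have "0 \<in> S" using assms by (auto simp: S_def)
    have up: "t \<le> r" if "t \<in> S" for t using that True by (simp add: r_def cSup_upper)
    have r0: "0 \<le> r" using up \<open>0 \<in> S\<close> by blast
    have prod: "s + t - dist (\<rho> s) (\<sigma> t) \<le> 2 * r" if "0 \<le> s" "0 \<le> t" for s t
    proof -
      define k where "k = (s + t - dist (\<rho> s) (\<sigma> t)) / 2"
      have "\<bar>s - t\<bar> \<le> dist (\<rho> s) (\<sigma> t)" "dist (\<rho> s) (\<sigma> t) \<le> s + t"
        using dist_triangle[of "\<rho> 0" "\<rho> s" "\<sigma> t"] dist_triangle[of "\<rho> 0" "\<sigma> t" "\<rho> s"]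
          dist_triangle[of "\<rho> s" "\<sigma> t" "\<rho> 0"] d[of 0 s] d[of 0 t] d[of s 0] that assms(3)
        by (auto simp: dist_commute)
      then have k: "0 \<le> k" "k \<le> s" "k \<le> t" by (auto simp: k_def)
      have "\<rho> k = \<sigma> k"
        by (rule agree_up_to_product[of "\<rho> 0" _ "\<rho> s" _ "\<sigma> t"])
          (use k that assms(3) d(1)[of 0 k] d(1)[of k s] d(1)[of 0 s] d(2)[of 0 k] d(2)[of k t]
            d(2)[of 0 t] in \<open>simp_all, simp add: k_def\<close>)
      then show ?thesis using up[of k] k by (auto simp: S_def k_def)
    qed
    have "\<rho> r = \<sigma> r"
    proof (rule ccontr)
      assume "\<rho> r \<noteq> \<sigma> r"
      then have "r - dist (\<rho> r) (\<sigma> r) / 2 < r" by simp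
      then obtain t where t: "t \<in> S" "r - dist (\<rho> r) (\<sigma> r) / 2 < t"
        unfolding r_def using less_cSup_iff[of S] True \<open>0 \<in> S\<close> by blast
      have "dist (\<rho> r) (\<rho> t) = r - t" "dist (\<sigma> t) (\<sigma> r) = r - t"
        using t up[OF t(1)] r0 d(1)[of r t] d(2)[of t r] by (simp_all add: S_def)
      moreover have "\<rho> t = \<sigma> t" using t by (simp add: S_def)
      ultimately show False using t dist_triangle[of "\<rho> r" "\<sigma> r" "\<rho> t"] by simp
    qed
    show thesis
    proof (rule that(2)[OF r0])
      show "\<rho> t = \<sigma> t" if "0 \<le> t" "t \<le> r" for t using down[OF \<open>\<rho> r = \<sigma> r\<close>] that by auto
      show "dist (\<rho> s) (\<sigma> t) = s + t - 2 * r" if "r \<le> s" "r \<le> t" for s t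
        using prod[of s t] dist_triangle[of "\<rho> s" "\<sigma> t" "\<rho> r"] d[of s r] d[of r t] that r0
          \<open>\<rho> r = \<sigma> r\<close> by auto
    qed
  qed
qed

definition ray_from :: "'a \<Rightarrow> 'a set set \<Rightarrow> (real \<Rightarrow> 'a) \<Rightarrow> bool" where
  "ray_from p u \<rho> \<longleftrightarrow> geodesic {0..} \<rho> \<and> \<rho> 0 = p \<and> end_of \<rho> = u"

lemma ray_from_exists:
  assumes "u \<in> ends"
  shows "\<exists>\<rho>. ray_from p u \<rho>"
proof -
  obtain \<sigma> :: "real \<Rightarrow> 'a" where \<sigma>: "geodesic {0..} \<sigma>" "end_of \<sigma> = u"
    using ends_cases[OF assms] .
  define s where "s = dist p (\<sigma> 0)"
  define a where "a = dist p (\<sigma> s)"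
  have "0 \<le> s" "0 \<le> a" by (auto simp: s_def a_def)
  have far: "dist p (\<sigma> t) = a + (t - s)" if "s \<le> t" for t
    using dist_ray_eventually[OF \<sigma>(1), of p s t] that by (simp add: s_def a_def)
  obtain \<gamma> where \<gamma>: "geodesic_between p (\<sigma> s) \<gamma>" using geodesic_between_exists by blast
  define \<rho> where "\<rho> = (\<lambda>t. if t \<le> a then \<gamma> t else \<sigma> (s - a + t))"
  have \<gamma>': "dist (\<gamma> x) (\<gamma> y) = \<bar>x - y\<bar>" if "x \<in> {0..a}" "y \<in> {0..a}" for x y
    using \<gamma> that by (auto simp: geodesic_between_def geodesic_iff a_def)
  have \<gamma>'': "\<gamma> 0 = p" "\<gamma> a = \<sigma> s" using \<gamma> by (auto simp: geodesic_between_def a_def)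
  have "dist (\<rho> x) (\<rho> y) = \<bar>x - y\<bar>" if "0 \<le> x" "0 \<le> y" for x y
    unfolding \<rho>_def
    by (rule isometric_concat[where a = 0 and c = "a + x + y"])
      (use that \<gamma>' \<gamma>'' \<sigma> \<open>0 \<le> s\<close> \<open>0 \<le> a\<close> far[of "s + x + y"] in
        \<open>auto simp: geodesic_iff add.assoc\<close>)
  then have ray: "geodesic {0..} \<rho>" by (auto simp: geodesic_iff)
  have "\<rho> (a + t) = \<sigma> (s + t)" if "0 \<le> t" for t using that \<gamma>'' by (auto simp: \<rho>_def)
  then have "same_tail \<rho> \<sigma>" unfolding same_tail_def using \<open>0 \<le> s\<close> \<open>0 \<le> a\<close> by blast
  then have "end_of \<rho> = u" using end_of_eq_iff[OF ray \<sigma>(1)] \<sigma>(2) by simp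
  moreover have "\<rho> 0 = p" using \<gamma>'' \<open>0 \<le> a\<close> by (auto simp: \<rho>_def)
  ultimately show ?thesis using ray by (auto simp: ray_from_def)
qed

lemma rays_from_diverge:
  assumes "ray_from p u \<rho>" "ray_from p v \<sigma>" "u \<noteq> v"
  obtains r where "0 \<le> r" "\<And>t. 0 \<le> t \<Longrightarrow> t \<le> r \<Longrightarrow> \<rho> t = \<sigma> t"
    "\<And>s t. r \<le> s \<Longrightarrow> r \<le> t \<Longrightarrow> dist (\<rho> s) (\<sigma> t) = s + t - 2 * r"
proof -
  have "\<not> (\<forall>t\<ge>0. \<rho> t = \<sigma> t)"
  proof
    assume "\<forall>t\<ge>0. \<rho> t = \<sigma> t"
    then have "same_tail \<rho> \<sigma>" unfolding same_tail_def by (metis add_0 order_refl)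
    then show False using assms end_of_eq_iff by (auto simp: ray_from_def)
  qed
  then show thesis
    using rays_diverge[of \<rho> \<sigma>] assms that unfolding ray_from_def by metis
qed

lemma ray_from_unique:
  assumes "ray_from p u \<rho>" "ray_from p u \<sigma>" "0 \<le> t"
  shows "\<rho> t = \<sigma> t"
proof (rule ccontr)
  assume neq: "\<rho> t \<noteq> \<sigma> t"
  have g: "geodesic {0..} \<rho>" "geodesic {0..} \<sigma>" "\<rho> 0 = \<sigma> 0"
    using assms by (auto simp: ray_from_def)
  obtain r where r: "0 \<le> r" "\<And>s t. r \<le> s \<Longrightarrow> r \<le> t \<Longrightarrow> dist (\<rho> s) (\<sigma> t) = s + t - 2 * r"
    using rays_diverge[OF g] neq assms(3) by metis
  obtain a b where ab: "0 \<le> a" "0 \<le> b" "\<And>t. 0 \<le> t \<Longrightarrow> \<rho> (a + t) = \<sigma> (b + t)"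
    using assms end_of_eq_iff[of \<rho> \<sigma>] unfolding ray_from_def same_tail_def by metis
  have "dist (\<rho> (a + (r + 1))) (\<sigma> (b + (r + 1))) = a + b + 2"
    using r(1) r(2)[of "a + (r + 1)" "b + (r + 1)"] ab(1,2) by simp
  moreover have "\<rho> (a + (r + 1)) = \<sigma> (b + (r + 1))" using ab(3)[of "r + 1"] r(1) by simp
  ultimately show False using ab(1,2) by simp
qed

text \<open>
  Rays to different ends diverge linearly, hence cannot come close to each other at points
  arbitrarily far out.
\<close>

lemma end_of_eqI:
  assumes \<rho>: "geodesic {0..} (\<rho>::real \<Rightarrow> 'a)" and \<sigma>: "geodesic {0..} \<sigma>"
    and near: "\<And>N. \<exists>s\<ge>N. \<exists>t\<ge>0. dist (\<rho> s) (\<sigma> t) \<le> r"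
  shows "end_of \<rho> = end_of \<sigma>"
proof (rule ccontr)
  assume neq: "end_of \<rho> \<noteq> end_of \<sigma>"
  obtain \<tau> where \<tau>: "ray_from (\<rho> 0) (end_of \<sigma>) \<tau>"
    using ray_from_exists end_of_in_ends[OF \<sigma>] by blast
  have \<rho>': "ray_from (\<rho> 0) (end_of \<rho>) \<rho>" using \<rho> by (auto simp: ray_from_def)
  obtain k where k: "0 \<le> k" "\<And>s t. k \<le> s \<Longrightarrow> k \<le> t \<Longrightarrow> dist (\<rho> s) (\<tau> t) = s + t - 2 * k"
    using rays_from_diverge[OF \<rho>' \<tau> neq] by metis
  obtain a b where ab: "0 \<le> a" "0 \<le> b" "\<And>t. 0 \<le> t \<Longrightarrow> \<tau> (a + t) = \<sigma> (b + t)"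
    using \<tau> end_of_eq_iff[of \<tau> \<sigma>] \<sigma> unfolding ray_from_def same_tail_def by metis
  define D where "D = dist (\<rho> 0) (\<sigma> 0)"
  \<comment> \<open>A point of \<open>\<sigma>\<close> close to a distant point of \<open>\<rho>\<close> is itself distant, hence on \<open>\<tau>\<close>.\<close>
  let ?N = "2 * k + a + b + D + r + 1"
  obtain s t where st: "?N \<le> s" "0 \<le> t" "dist (\<rho> s) (\<sigma> t) \<le> r" using near by blast
  have "0 \<le> r" using st(3) zero_le_dist order_trans by blast
  have "0 \<le> D" by (simp add: D_def)
  have d0: "dist (\<rho> 0) (\<rho> s) = s" "dist (\<sigma> 0) (\<sigma> t) = t"
    using \<rho> \<sigma> st \<open>0 \<le> r\<close> k ab \<open>0 \<le> D\<close> by (auto simp: geodesic_iff)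
  have "s \<le> D + t + r"
    using dist_triangle[of "\<rho> 0" "\<rho> s" "\<sigma> 0"] dist_triangle[of "\<sigma> 0" "\<rho> s" "\<sigma> t"] st d0
    by (auto simp: D_def dist_commute)
  then have tb: "b + k \<le> t" using st k ab by auto
  then have "\<sigma> t = \<tau> (a + (t - b))" using ab(3)[of "t - b"] k by auto
  moreover have "dist (\<rho> s) (\<tau> (a + (t - b))) = s + (a + (t - b)) - 2 * k"
    using k(2)[of s "a + (t - b)"] tb ab k st \<open>0 \<le> r\<close> \<open>0 \<le> D\<close> by auto
  ultimately show False using st tb k ab \<open>0 \<le> D\<close> by auto
qed

end

section \<open>Lines, horofunctions and centers\<close>

definition line :: "(real \<Rightarrow> 'a::metric_space) \<Rightarrow> 'a set set \<Rightarrow> 'a set set \<Rightarrow> bool" where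
  "line \<gamma> u v \<longleftrightarrow> geodesic UNIV \<gamma> \<and> end_of \<gamma> = u \<and> end_of (\<lambda>t. \<gamma> (- t)) = v"

text \<open>
  The Busemann function (horofunction) of an end, as a difference between two points. In a tree
  the limit that usually defines it is attained.
\<close>

definition busemann :: "'a::metric_space set set \<Rightarrow> 'a \<Rightarrow> 'a \<Rightarrow> real" where
  "busemann u x y = (THE r. \<exists>\<rho>. geodesic {0..} \<rho> \<and> end_of \<rho> = u \<and>
     (\<exists>N. \<forall>t\<ge>N. dist x (\<rho> t) - dist y (\<rho> t) = r))"

text \<open>
  The branching point of the tripod spanned by three ends.
\<close>

definition center :: "'a::metric_space \<Rightarrow> 'a set set \<Rightarrow> 'a set set \<Rightarrow> 'a set set \<Rightarrow> bool" where
  "center z u v w \<longleftrightarrow> u \<in> ends \<and> v \<in> ends \<and> w \<in> ends \<and> u \<noteq> v \<and> v \<noteq> w \<and> u \<noteq> w \<and>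
     z \<in> apartment_between u v \<and> z \<in> apartment_between v w \<and> z \<in> apartment_between u w"

lemma line_dist: "line \<gamma> u v \<Longrightarrow> dist (\<gamma> s) (\<gamma> t) = \<bar>s - t\<bar>"
  by (simp add: line_def geodesic_iff)

lemma line_rays:
  assumes "line \<gamma> u v"
  shows "geodesic {0..} \<gamma>" "geodesic {0..} (\<lambda>t. \<gamma> (- t))"
    "geodesic {0..} (\<lambda>t. \<gamma> (a + t))" "geodesic {0..} (\<lambda>t. \<gamma> (a - t))"
  using line_dist[OF assms] by (auto simp: geodesic_iff)

lemma line_reverse: "line \<gamma> u v \<Longrightarrow> line (\<lambda>t. \<gamma> (- t)) v u"
  by (auto simp: line_def geodesic_iff)

context leafless_tree
begin

lemma line_ends: "line \<gamma> u v \<Longrightarrow> u \<in> ends \<and> v \<in> ends" for u :: "'a set set"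
  using line_rays(1,2) end_of_in_ends unfolding line_def by metis

lemma line_shift:
  assumes "line (\<gamma>::real \<Rightarrow> 'a) u v"
  shows "line (\<lambda>t. \<gamma> (a + t)) u v"
proof -
  have "same_tail (\<lambda>t. \<gamma> (a + t)) \<gamma>" unfolding same_tail_def
    by (intro exI[of _ "\<bar>a\<bar>"] conjI exI[of _ "a + \<bar>a\<bar>"]) (auto simp: add.assoc)
  moreover have "same_tail (\<lambda>t. \<gamma> (a - t)) (\<lambda>t. \<gamma> (- t))" unfolding same_tail_def
    by (intro exI[of _ "\<bar>a\<bar>"] conjI exI[of _ "\<bar>a\<bar> - a"]) (auto simp: algebra_simps)
  ultimately show ?thesis
    using assms end_of_eq_iff[OF line_rays(3)[OF assms] line_rays(1)[OF assms]]
      end_of_eq_iff[OF line_rays(4)[OF assms] line_rays(2)[OF assms]]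
    by (simp add: line_def geodesic_iff)
qed

lemma line_ray_from:
  assumes "line (\<gamma>::real \<Rightarrow> 'a) u v"
  shows "ray_from (\<gamma> a) u (\<lambda>t. \<gamma> (a + t))" "ray_from (\<gamma> a) v (\<lambda>t. \<gamma> (a - t))"
  using line_shift[OF assms, of a] line_rays(3,4)[OF assms, of a]
  by (auto simp: line_def ray_from_def)

lemma line_distinct:
  assumes "line (\<gamma>::real \<Rightarrow> 'a) u v"
  shows "u \<noteq> v"
proof
  assume "u = v"
  then have "\<gamma> 1 = \<gamma> (-1)"
    using ray_from_unique[OF line_ray_from(1)[OF assms, of 0], of "\<lambda>t. \<gamma> (0 - t)" 1]
      line_ray_from(2)[OF assms, of 0] by simp
  then show False using line_dist[OF assms, of 1 "-1"] by simp
qed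

lemma line_if_diverge:
  assumes \<rho>: "ray_from p u \<rho>" and \<sigma>: "ray_from p v \<sigma>" and "0 \<le> r"
    and div: "\<And>s t. r \<le> s \<Longrightarrow> r \<le> t \<Longrightarrow> dist (\<rho> s) (\<sigma> t) = s + t - 2 * r"
  shows "line (\<lambda>t. if 0 \<le> t then \<rho> (r + t) else \<sigma> (r - t)) u v" (is "line ?\<gamma> u v")
proof -
  have d: "dist (\<rho> s) (\<rho> t) = \<bar>s - t\<bar>" "dist (\<sigma> s) (\<sigma> t) = \<bar>s - t\<bar>" if "0 \<le> s" "0 \<le> t" for s t
    using \<rho> \<sigma> that by (auto simp: geodesic_iff ray_from_def)
  have d\<gamma>: "dist (?\<gamma> s) (?\<gamma> t) = \<bar>s - t\<bar>" for s t
    using d[of "r + s" "r + t"] d[of "r - s" "r - t"] div[of "r + s" "r - t"]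
      div[of "r + t" "r - s"] \<open>0 \<le> r\<close> by (auto simp: dist_commute)
  from d\<gamma> have g: "geodesic UNIV ?\<gamma>" by (simp add: geodesic_iff)
  have "\<rho> r = \<sigma> r" using div[of r r] by simp
  then have "(\<lambda>t. ?\<gamma> (- t)) (0 + t) = \<sigma> (r + t)" if "0 \<le> t" for t using that by auto
  then have "same_tail (\<lambda>t. ?\<gamma> (- t)) \<sigma>"
    unfolding same_tail_def using \<open>0 \<le> r\<close> by (metis order_refl)
  moreover have "same_tail ?\<gamma> \<rho>"
    unfolding same_tail_def using \<open>0 \<le> r\<close> by (intro exI[of _ 0] conjI exI[of _ r]) auto
  moreover have "geodesic {0..} ?\<gamma>" "geodesic {0..} (\<lambda>t. ?\<gamma> (- t))"
    unfolding geodesic_iff d\<gamma> by auto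
  ultimately show ?thesis
    using g \<rho> \<sigma> end_of_eq_iff[of ?\<gamma> \<rho>] end_of_eq_iff[of "\<lambda>t. ?\<gamma> (- t)" \<sigma>]
    unfolding line_def ray_from_def by blast
qed

lemma line_exists:
  assumes "u \<in> ends" "v \<in> ends" "u \<noteq> v"
  obtains \<gamma> :: "real \<Rightarrow> 'a" where "line \<gamma> u v"
proof -
  obtain \<rho> \<sigma> where \<rho>: "ray_from (undefined::'a) u \<rho>" and \<sigma>: "ray_from (undefined::'a) v \<sigma>"
    using ray_from_exists assms by blast
  obtain r where r: "0 \<le> r" "\<And>s t. r \<le> s \<Longrightarrow> r \<le> t \<Longrightarrow> dist (\<rho> s) (\<sigma> t) = s + t - 2 * r"
    using rays_from_diverge[OF \<rho> \<sigma> assms(3)] by metis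
  show thesis by (rule that[OF line_if_diverge[OF \<rho> \<sigma> r]])
qed

text \<open>
  The lines agree far out towards both ends, and a geodesic is determined by two distant points
  on it.
\<close>

lemma line_unique:
  assumes \<gamma>: "line (\<gamma>::real \<Rightarrow> 'a) u v" and \<delta>: "line \<delta> u v"
  shows "\<exists>a. \<forall>t. \<delta> t = \<gamma> (a + t)"
proof -
  obtain a b where ab: "0 \<le> a" "0 \<le> b" "\<And>t. 0 \<le> t \<Longrightarrow> \<gamma> (a + t) = \<delta> (b + t)"
    using \<gamma> \<delta> end_of_eq_iff[OF line_rays(1)[OF \<gamma>] line_rays(1)[OF \<delta>]]
    unfolding line_def same_tail_def by metis
  obtain c d where cd: "0 \<le> c" "0 \<le> d" "\<And>t. 0 \<le> t \<Longrightarrow> \<gamma> (- (c + t)) = \<delta> (- (d + t))"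
    using \<gamma> \<delta> end_of_eq_iff[OF line_rays(2)[OF \<gamma>] line_rays(2)[OF \<delta>]]
    unfolding line_def same_tail_def by metis
  have "\<gamma> a = \<delta> b" "\<gamma> (- c) = \<delta> (- d)" using ab(3)[of 0] cd(3)[of 0] by auto
  then have sum: "a + c = b + d"
    using line_dist[OF \<gamma>, of a "-c"] line_dist[OF \<delta>, of b "-d"] ab cd by auto
  have "\<delta> t = \<gamma> ((a - b) + t)" for t
  proof -
    let ?N = "\<bar>t\<bar>"
    have 1: "\<gamma> (a + ?N) = \<delta> (b + ?N)" "\<gamma> (- (c + ?N)) = \<delta> (- (d + ?N))"
      using ab(3)[of ?N] cd(3)[of ?N] by auto
    show ?thesis
    proof (rule between_unique[of "\<delta> (- (d + ?N))" _ "\<delta> (b + ?N)"])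
      show "dist (\<delta> (- (d + ?N))) (\<delta> t) + dist (\<delta> t) (\<delta> (b + ?N))
          = dist (\<delta> (- (d + ?N))) (\<delta> (b + ?N))"
        unfolding line_dist[OF \<delta>] using ab cd by auto
      show "dist (\<delta> (- (d + ?N))) (\<gamma> (a - b + t)) + dist (\<gamma> (a - b + t)) (\<delta> (b + ?N))
          = dist (\<delta> (- (d + ?N))) (\<delta> (b + ?N))"
        unfolding 1[symmetric] line_dist[OF \<gamma>] using ab cd sum by auto
      have "dist (\<delta> (- (d + ?N))) (\<gamma> (a - b + t)) = d + ?N + t"
        unfolding 1[symmetric] line_dist[OF \<gamma>] using ab cd sum by auto
      moreover have "dist (\<delta> (- (d + ?N))) (\<delta> t) = d + ?N + t"
        unfolding line_dist[OF \<delta>] using ab cd by auto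
      ultimately show "dist (\<delta> (- (d + ?N))) (\<delta> t) = dist (\<delta> (- (d + ?N))) (\<gamma> (a - b + t))"
        by simp
    qed
  qed
  then show ?thesis by blast
qed

lemma line_unique_range:
  assumes "line (\<gamma>::real \<Rightarrow> 'a) u v" "line \<delta> u v \<or> line \<delta> v u"
  shows "range \<delta> = range \<gamma>"
proof -
  have *: "range \<eta> \<subseteq> range \<gamma>" if "line \<gamma> u v" "line \<eta> u v" for \<gamma> \<eta> :: "real \<Rightarrow> 'a" and u v
    using line_unique[OF that] by auto
  have rev: "range (\<lambda>t. \<delta> (- t)) = range \<delta>"
  proof (intro subset_antisym subsetI)
    fix x assume "x \<in> range \<delta>"
    then obtain t where "x = \<delta> (- (- t))" by auto
    then show "x \<in> range (\<lambda>t. \<delta> (- t))" by blast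
  qed auto
  show ?thesis
    using assms(2)
  proof
    assume "line \<delta> u v"
    then show ?thesis using *[of \<gamma> u v \<delta>] *[of \<delta> u v \<gamma>] assms(1) by blast
  next
    assume "line \<delta> v u"
    then have "line (\<lambda>t. \<delta> (- t)) u v" by (rule line_reverse)
    then show ?thesis using *[of \<gamma> u v] *[of _ u v \<gamma>] assms(1) rev by (metis subset_antisym)
  qed
qed

lemma ends_of_line:
  assumes \<gamma>: "line (\<gamma>::real \<Rightarrow> 'a) u v"
  shows "ends_of (range \<gamma>) = {u, v}"
proof (intro subset_antisym subsetI)
  fix w assume "w \<in> ends_of (range \<gamma>)"
  then obtain R where R: "w \<in> ends" "R \<in> w" "R \<subseteq> range \<gamma>" by (auto simp: ends_of_def)
  obtain \<rho> where \<rho>: "geodesic {0..} \<rho>" "R = \<rho> ` {0..}" "end_of \<rho> = w"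
    using ends_cases[OF R(1)] in_end_of_iff R(2) by metis
  have "\<forall>t\<in>{0..}. \<exists>s. \<rho> t = \<gamma> s" using R(3) \<rho>(2) by auto
  then obtain s where s: "\<And>t. 0 \<le> t \<Longrightarrow> \<rho> t = \<gamma> (s t)" by (metis atLeast_iff)
  have "\<bar>s t - s t'\<bar> = \<bar>t - t'\<bar>" if "0 \<le> t" "0 \<le> t'" for t t'
    using s[OF that(1)] s[OF that(2)] geodesicD[OF \<rho>(1), of t t'] that line_dist[OF \<gamma>] by auto
  from isometric_half_line[of s, OF this] show "w \<in> {u, v}"
  proof
    assume plus: "\<forall>t\<ge>0. s t = s 0 + t"
    have "\<rho> t = \<gamma> (s 0 + t)" if "0 \<le> t" for t
      using s[OF that] plus[rule_format, OF that] by metis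
    then have "\<rho> ` {0..} = (\<lambda>t. \<gamma> (s 0 + t)) ` {0..}" by (intro image_cong) auto
    then have "end_of \<rho> = end_of (\<lambda>t. \<gamma> (s 0 + t))" by (simp add: end_of_def)
    then show ?thesis using \<rho>(3) line_ray_from(1)[OF \<gamma>, of "s 0"] by (simp add: ray_from_def)
  next
    assume minus: "\<forall>t\<ge>0. s t = s 0 - t"
    have "\<rho> t = \<gamma> (s 0 - t)" if "0 \<le> t" for t
      using s[OF that] minus[rule_format, OF that] by metis
    then have "\<rho> ` {0..} = (\<lambda>t. \<gamma> (s 0 - t)) ` {0..}" by (intro image_cong) auto
    then have "end_of \<rho> = end_of (\<lambda>t. \<gamma> (s 0 - t))" by (simp add: end_of_def)
    then show ?thesis using \<rho>(3) line_ray_from(2)[OF \<gamma>, of "s 0"] by (simp add: ray_from_def)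
  qed
next
  fix w assume w: "w \<in> {u, v}"
  have "\<gamma> ` {0..} \<in> u" "(\<lambda>t. \<gamma> (- t)) ` {0..} \<in> v"
    using \<gamma> in_end_of_iff[OF line_rays(1)[OF \<gamma>], of "\<gamma> ` {0..}"]
      in_end_of_iff[OF line_rays(2)[OF \<gamma>], of "(\<lambda>t. \<gamma> (- t)) ` {0..}"] line_rays(1,2)[OF \<gamma>]
    unfolding line_def by blast+
  moreover have "\<gamma> ` {0..} \<subseteq> range \<gamma>" "(\<lambda>t. \<gamma> (- t)) ` {0..} \<subseteq> range \<gamma>" by auto
  ultimately have "u \<in> ends_of (range \<gamma>)" "v \<in> ends_of (range \<gamma>)"
    using line_ends[OF \<gamma>] unfolding ends_of_def mem_Collect_eq by metis+
  then show "w \<in> ends_of (range \<gamma>)" using w by auto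
qed

lemma apartment_cases:
  assumes "apartment (A::'a set)"
  obtains \<gamma> u v where "line \<gamma> u v" "A = range \<gamma>"
  using assms unfolding apartment_def line_def by blast

lemma apartment_between_eq:
  assumes "line (\<gamma>::real \<Rightarrow> 'a) u v"
  shows "apartment_between u v = range \<gamma>"
  unfolding apartment_between_def
proof (rule the_equality)
  show "apartment (range \<gamma>) \<and> ends_of (range \<gamma>) = {u, v}"
    using assms ends_of_line by (auto simp: apartment_def line_def)
next
  fix A :: "'a set" assume "apartment A \<and> ends_of A = {u, v}"
  then obtain \<delta> x y where \<delta>: "line \<delta> x y" "A = range \<delta>" "{x, y} = {u, v}"
    using apartment_cases ends_of_line by metis
  then have "line \<delta> u v \<or> line \<delta> v u" by (auto simp: doubleton_eq_iff)
  then show "A = range \<gamma>" using line_unique_range[OF assms] \<delta>(2) by blast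
qed

lemma apartment_between_commute:
  assumes "u \<in> ends" "v \<in> ends" "u \<noteq> v"
  shows "apartment_between u v = (apartment_between v u :: 'a set)"
  using line_exists[OF assms] apartment_between_eq line_reverse line_unique_range by metis

lemma apartment_between_obtain:
  assumes "(p::'a) \<in> apartment_between u v" "u \<in> ends" "v \<in> ends" "u \<noteq> v"
  obtains \<gamma> where "line \<gamma> u v" "\<gamma> 0 = p"
proof -
  obtain \<gamma> :: "real \<Rightarrow> 'a" where \<gamma>: "line \<gamma> u v" using line_exists assms by blast
  then obtain a where "p = \<gamma> a" using assms(1) apartment_between_eq by blast
  then show thesis using that[OF line_shift[OF \<gamma>, of a]] by simp
qed

lemma center_commute:
  assumes "center (z::'a) u v w"
  shows "center z v u w" "center z u w v" "center z w v u" "center z v w u" "center z w u v"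
  using assms apartment_between_commute unfolding center_def by metis+

lemma line_through: obtains \<gamma> :: "real \<Rightarrow> 'a" and u v where "line \<gamma> u v" "\<gamma> 0 = p" "\<gamma> (dist p q) = q"
proof -
  obtain \<gamma> where g: "geodesic_between p q \<gamma>" using geodesic_between_exists by blast
  then obtain \<delta> where "geodesic UNIV \<delta>" "\<forall>t\<in>{0..dist p q}. \<delta> t = \<gamma> t"
    using leafless unfolding leafless_def geodesic_between_def by metis
  moreover from this g have "\<delta> 0 = p" "\<delta> (dist p q) = q" by (auto simp: geodesic_between_def)
  ultimately show thesis using that unfolding line_def by blast
qed

lemma busemann_along:
  assumes \<rho>: "geodesic {0..} (\<rho>::real \<Rightarrow> 'a)" and u: "end_of \<rho> = u"
  obtains N where "0 \<le> N" "\<And>t. N \<le> t \<Longrightarrow> dist x (\<rho> t) - dist y (\<rho> t) = busemann u x y"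
proof -
  have const: "\<exists>r N. 0 \<le> N \<and> (\<forall>t\<ge>N. dist x (\<sigma> t) - dist y (\<sigma> t) = r)"
    if "geodesic {0..} \<sigma>" for \<sigma> :: "real \<Rightarrow> 'a"
  proof -
    define N where "N = max (dist x (\<sigma> 0)) (dist y (\<sigma> 0))"
    have "dist x (\<sigma> t) - dist y (\<sigma> t) = dist x (\<sigma> N) - dist y (\<sigma> N)" if "N \<le> t" for t
      using dist_ray_eventually[OF \<open>geodesic {0..} \<sigma>\<close>, of _ N t] that by (simp add: N_def)
    moreover have "0 \<le> N" by (simp add: N_def le_max_iff_disj)
    ultimately show ?thesis by blast
  qed
  obtain r N where r: "0 \<le> N" "\<And>t. N \<le> t \<Longrightarrow> dist x (\<rho> t) - dist y (\<rho> t) = r"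
    using const[OF \<rho>] by metis
  have "busemann u x y = r" unfolding busemann_def
  proof (rule the_equality)
    show "\<exists>\<rho>. geodesic {0..} \<rho> \<and> end_of \<rho> = u \<and> (\<exists>N. \<forall>t\<ge>N. dist x (\<rho> t) - dist y (\<rho> t) = r)"
      using \<rho> u r by blast
  next
    fix r' assume "\<exists>\<rho>. geodesic {0..} \<rho> \<and> end_of \<rho> = u \<and>
      (\<exists>N. \<forall>t\<ge>N. dist x (\<rho> t) - dist y (\<rho> t) = r')"
    then obtain \<sigma> M where \<sigma>: "geodesic {0..} \<sigma>" "end_of \<sigma> = u"
      "\<And>t. M \<le> t \<Longrightarrow> dist x (\<sigma> t) - dist y (\<sigma> t) = r'" by blast
    obtain a b where ab: "0 \<le> a" "0 \<le> b" "\<And>t. 0 \<le> t \<Longrightarrow> \<rho> (a + t) = \<sigma> (b + t)"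
      using end_of_eq_iff[OF \<rho> \<sigma>(1)] u \<sigma>(2) unfolding same_tail_def by metis
    let ?t = "N + \<bar>M\<bar>"
    have "\<rho> (a + ?t) = \<sigma> (b + ?t)" using ab r(1) by auto
    then show "r' = r" using r(2)[of "a + ?t"] \<sigma>(3)[of "b + ?t"] ab r(1) by auto
  qed
  then show thesis using that r by blast
qed

lemma busemann_cocycle:
  assumes "u \<in> ends"
  shows "busemann u x y + busemann u y z = busemann u x (z::'a)"
proof -
  obtain \<rho> :: "real \<Rightarrow> 'a" where \<rho>: "geodesic {0..} \<rho>" "end_of \<rho> = u" using ends_cases[OF assms] .
  obtain N1 N2 N3 where "\<And>t. N1 \<le> t \<Longrightarrow> dist x (\<rho> t) - dist y (\<rho> t) = busemann u x y"
    "\<And>t. N2 \<le> t \<Longrightarrow> dist y (\<rho> t) - dist z (\<rho> t) = busemann u y z"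
    "\<And>t. N3 \<le> t \<Longrightarrow> dist x (\<rho> t) - dist z (\<rho> t) = busemann u x z"
    using busemann_along[OF \<rho>, of x y] busemann_along[OF \<rho>, of y z] busemann_along[OF \<rho>, of x z]
    by metis
  from this(1)[of "max N1 (max N2 N3)"] this(2)[of "max N1 (max N2 N3)"]
    this(3)[of "max N1 (max N2 N3)"] show ?thesis by (simp add: le_max_iff_disj)
qed

lemma busemann_self: "u \<in> ends \<Longrightarrow> busemann u x (x::'a) = 0"
  using busemann_cocycle[of u x x x] by simp

lemma busemann_swap: "u \<in> ends \<Longrightarrow> busemann u y x = - busemann u x (y::'a)"
  using busemann_cocycle[of u x y x] busemann_self[of u x] by simp

lemma busemann_le_dist:
  assumes "u \<in> ends"
  shows "\<bar>busemann u x y\<bar> \<le> dist x (y::'a)"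
proof -
  obtain \<rho> :: "real \<Rightarrow> 'a" where \<rho>: "geodesic {0..} \<rho>" "end_of \<rho> = u" using ends_cases[OF assms] .
  obtain N where "\<And>t. N \<le> t \<Longrightarrow> dist x (\<rho> t) - dist y (\<rho> t) = busemann u x y"
    using busemann_along[OF \<rho>, of x y] by metis
  from this[of N] show ?thesis
    using dist_triangle[of x "\<rho> N" y] dist_triangle[of y "\<rho> N" x] by (simp add: dist_commute)
qed

lemma busemann_ray:
  assumes \<rho>: "geodesic {0..} (\<rho>::real \<Rightarrow> 'a)" and st: "0 \<le> s" "0 \<le> t"
  shows "busemann (end_of \<rho>) (\<rho> s) (\<rho> t) = t - s"
proof -
  obtain N where N: "\<And>k. N \<le> k \<Longrightarrow>
      dist (\<rho> s) (\<rho> k) - dist (\<rho> t) (\<rho> k) = busemann (end_of \<rho>) (\<rho> s) (\<rho> t)"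
    using busemann_along[OF \<rho>, of "end_of \<rho>" "\<rho> s" "\<rho> t"] by metis
  then show ?thesis
    using N[of "\<bar>N\<bar> + s + t"] geodesicD[OF \<rho>, of s "\<bar>N\<bar> + s + t"]
      geodesicD[OF \<rho>, of t "\<bar>N\<bar> + s + t"] st by auto
qed

lemma busemann_line:
  assumes "line (\<gamma>::real \<Rightarrow> 'a) u v"
  shows "busemann u (\<gamma> s) (\<gamma> t) = t - s" "busemann v (\<gamma> s) (\<gamma> t) = s - t"
proof -
  have *: "busemann u (\<gamma> s) (\<gamma> t) = t - s" if "line \<gamma> u v" for \<gamma> :: "real \<Rightarrow> 'a" and u v s t
  proof -
    let ?a = "- \<bar>s\<bar> - \<bar>t\<bar>"
    have "end_of (\<lambda>t. \<gamma> (?a + t)) = u" "geodesic {0..} (\<lambda>t. \<gamma> (?a + t))"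
      using line_ray_from(1)[OF that, of ?a] by (auto simp: ray_from_def)
    then show ?thesis
      using busemann_ray[of "\<lambda>t. \<gamma> (?a + t)" "s - ?a" "t - ?a"] by (simp add: algebra_simps)
  qed
  show "busemann u (\<gamma> s) (\<gamma> t) = t - s" using *[OF assms] .
  show "busemann v (\<gamma> s) (\<gamma> t) = s - t" using *[OF line_reverse[OF assms], of "- s" "- t"] by simp
qed

lemma busemann_apartment:
  assumes "u \<in> ends" "v \<in> ends" "u \<noteq> v"
    and "(p::'a) \<in> apartment_between u v" "q \<in> apartment_between u v"
  shows "busemann v p q = - busemann u p q" "dist p q = \<bar>busemann u p q\<bar>"
proof -
  obtain \<gamma> where \<gamma>: "line \<gamma> u v" "\<gamma> 0 = p" using apartment_between_obtain assms by metis
  then obtain t where "q = \<gamma> t" using apartment_between_eq assms(5) by blast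
  then show "busemann v p q = - busemann u p q" "dist p q = \<bar>busemann u p q\<bar>"
    using busemann_line[OF \<gamma>(1), of 0 t] line_dist[OF \<gamma>(1), of 0 t] \<gamma>(2) by auto
qed

lemma apartment_point_at:
  assumes "u \<in> ends" "v \<in> ends" "u \<noteq> v" and "(p::'a) \<in> apartment_between u v"
  obtains q where "q \<in> apartment_between u v" "busemann u q p = r"
proof -
  obtain \<gamma> where \<gamma>: "line \<gamma> u v" "\<gamma> 0 = p" using apartment_between_obtain assms by metis
  then show thesis
    using that[of "\<gamma> (- r)"] apartment_between_eq[OF \<gamma>(1)] busemann_line(1)[OF \<gamma>(1), of "-r" 0]
    by simp
qed

lemma center_unique:
  assumes z: "center z u v w" and z': "center z' u v w"
  shows "z = (z'::'a)"
proof -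
  have "busemann u z z' = - busemann v z z'" "busemann v z z' = - busemann w z z'"
    "busemann u z z' = - busemann w z z'" "dist z z' = \<bar>busemann u z z'\<bar>"
    using busemann_apartment[of u v z z'] busemann_apartment[of v w z z']
      busemann_apartment[of u w z z'] z z' unfolding center_def by auto
  then have "dist z z' = 0" by linarith
  then show ?thesis by simp
qed

lemma diverge_in_apartment:
  assumes "ray_from p u \<rho>" "ray_from p v \<sigma>" "0 \<le> r"
    and "\<And>s t. r \<le> s \<Longrightarrow> r \<le> t \<Longrightarrow> dist (\<rho> s) (\<sigma> t) = s + t - 2 * r" and "r \<le> k"
  shows "\<rho> k \<in> apartment_between u v" "\<sigma> k \<in> apartment_between u v"
proof -
  let ?\<gamma> = "\<lambda>t. if 0 \<le> t then \<rho> (r + t) else \<sigma> (r - t)"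
  have eq: "apartment_between u v = range ?\<gamma>"
    using apartment_between_eq line_if_diverge assms by blast
  have "\<rho> r = \<sigma> r" using assms(4)[of r r] by simp
  then have "\<rho> k = ?\<gamma> (k - r)" "\<sigma> k = ?\<gamma> (r - k)"
    using assms(5) by (simp, cases "k = r", simp_all)
  then show "\<rho> k \<in> apartment_between u v" "\<sigma> k \<in> apartment_between u v"
    unfolding eq by (simp_all only: range_eqI[of _ ?\<gamma>])
qed

lemma center_exists:
  assumes "u \<in> ends" "v \<in> ends" "w \<in> ends" "u \<noteq> v" "v \<noteq> w" "u \<noteq> w"
  obtains z :: 'a where "center z u v w"
proof -
  obtain \<gamma> :: "real \<Rightarrow> 'a" where \<gamma>: "line \<gamma> u v" using line_exists assms by blast
  obtain \<rho> where \<rho>: "ray_from (\<gamma> 0) w \<rho>" using ray_from_exists assms by blast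
  have u: "ray_from (\<gamma> 0) u \<gamma>" and v: "ray_from (\<gamma> 0) v (\<lambda>t. \<gamma> (- t))"
    using line_ray_from[OF \<gamma>, of 0] by auto
  obtain r where r: "0 \<le> r" "\<And>t. 0 \<le> t \<Longrightarrow> t \<le> r \<Longrightarrow> \<gamma> t = \<rho> t"
      "\<And>s t. r \<le> s \<Longrightarrow> r \<le> t \<Longrightarrow> dist (\<gamma> s) (\<rho> t) = s + t - 2 * r"
    using rays_from_diverge[OF u \<rho> assms(6)] by metis
  obtain k where k: "0 \<le> k" "\<And>t. 0 \<le> t \<Longrightarrow> t \<le> k \<Longrightarrow> \<gamma> (- t) = \<rho> t"
      "\<And>s t. k \<le> s \<Longrightarrow> k \<le> t \<Longrightarrow> dist (\<gamma> (- s)) (\<rho> t) = s + t - 2 * k"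
    using rays_from_diverge[OF v \<rho> assms(5)] by metis
  have uw: "\<gamma> r \<in> apartment_between u w" "\<And>t. r \<le> t \<Longrightarrow> \<rho> t \<in> apartment_between u w"
    using diverge_in_apartment[OF u \<rho> r(1,3)] by auto
  have vw: "\<gamma> (- k) \<in> apartment_between v w" "\<And>t. k \<le> t \<Longrightarrow> \<rho> t \<in> apartment_between v w"
    using diverge_in_apartment[OF v \<rho> k(1,3)] by auto
  have "r = 0 \<or> k = 0"
  proof (rule ccontr)
    assume "\<not> (r = 0 \<or> k = 0)"
    then obtain m where m: "0 < m" "m \<le> r" "m \<le> k"
      using r(1) k(1) by (metis less_eq_real_def linear)
    then have "\<gamma> m = \<gamma> (- m)" using r(2)[of m] k(2)[of m] by simp
    then have "dist (\<gamma> m) (\<gamma> (- m)) = 0" by simp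
    then show False using line_dist[OF \<gamma>, of m "- m"] m by simp
  qed
  then show thesis
  proof
    assume "r = 0"
    then have "\<gamma> (- k) = \<rho> k" "\<rho> k \<in> apartment_between u w" using k uw by auto
    then have "center (\<gamma> (- k)) u v w"
      unfolding center_def apartment_between_eq[OF \<gamma>] using assms vw(1)
      by (metis rangeI)
    then show thesis by (rule that)
  next
    assume "k = 0"
    then have "\<gamma> r = \<rho> r" "\<rho> r \<in> apartment_between v w" using r vw by auto
    then have "center (\<gamma> r) u v w"
      unfolding center_def apartment_between_eq[OF \<gamma>] using assms uw(1)
      by (metis rangeI)
    then show thesis by (rule that)
  qed
qed

text \<open>
  The ray from a point of the apartment to the third end runs along the apartment up to the
  center and leaves it there.
\<close>

lemma busemann_third_end:
  assumes z: "center (z::'a) u v x" and p: "p \<in> apartment_between u v"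
  shows "busemann x p z = dist p z" "p \<in> apartment_between u x \<or> p \<in> apartment_between v x"
proof -
  have *: "busemann x (\<gamma> s) z = s \<and> \<gamma> s \<in> apartment_between u x"
    if z: "center (z::'a) u v x" and \<gamma>: "line \<gamma> u v" "\<gamma> 0 = z" and "0 \<le> s" for \<gamma> s u v
  proof -
    obtain \<delta> where \<delta>: "line \<delta> u x" "\<delta> 0 = z"
      using z apartment_between_obtain unfolding center_def by metis
    have "\<gamma> s = \<delta> s"
      using ray_from_unique[OF line_ray_from(1)[OF \<gamma>(1), of 0], of "\<lambda>t. \<delta> (0 + t)" s]
        line_ray_from(1)[OF \<delta>(1), of 0] \<gamma> \<delta> \<open>0 \<le> s\<close> by simp
    then show ?thesis using busemann_line(2)[OF \<delta>(1), of s 0] \<delta> apartment_between_eq[OF \<delta>(1)]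
      by simp
  qed
  obtain \<gamma> where \<gamma>: "line \<gamma> u v" "\<gamma> 0 = z"
    using z apartment_between_obtain unfolding center_def by metis
  then obtain s where s: "p = \<gamma> s" using p apartment_between_eq by blast
  have "busemann x p z = dist p z \<and> (p \<in> apartment_between u x \<or> p \<in> apartment_between v x)"
  proof (cases "0 \<le> s")
    case True
    then show ?thesis using *[OF z \<gamma>] line_dist[OF \<gamma>(1), of s 0] \<gamma>(2) s by auto
  next
    case False
    then show ?thesis
      using *[OF center_commute(1)[OF z] line_reverse[OF \<gamma>(1)], of "- s"]
        line_dist[OF \<gamma>(1), of s 0] \<gamma>(2) s by auto
  qed
  then show "busemann x p z = dist p z" "p \<in> apartment_between u x \<or> p \<in> apartment_between v x"
    by auto
qed

text \<open>
  Along a ray that does not tend to \<open>x\<close>, the Busemann function of \<open>x\<close> eventually decreases.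
\<close>

lemma end_of_eq_if_busemann:
  assumes \<sigma>: "geodesic {0..} (\<sigma>::real \<Rightarrow> 'a)" and x: "x \<in> ends"
    and b: "\<And>t. 0 \<le> t \<Longrightarrow> busemann x (\<sigma> 0) (\<sigma> t) = t"
  shows "end_of \<sigma> = x"
proof (rule ccontr)
  assume neq: "end_of \<sigma> \<noteq> x"
  obtain \<rho> where \<rho>: "ray_from (\<sigma> 0) x \<rho>" using ray_from_exists x by blast
  have \<sigma>': "ray_from (\<sigma> 0) (end_of \<sigma>) \<sigma>" using \<sigma> by (simp add: ray_from_def)
  obtain r where r: "0 \<le> r" "\<And>s t. r \<le> s \<Longrightarrow> r \<le> t \<Longrightarrow> dist (\<sigma> s) (\<rho> t) = s + t - 2 * r"
    using rays_from_diverge[OF \<sigma>' \<rho> neq] by metis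
  have \<rho>': "geodesic {0..} \<rho>" "end_of \<rho> = x" "\<rho> 0 = \<sigma> 0" using \<rho> by (auto simp: ray_from_def)
  obtain N where N: "0 \<le> N" "\<And>t. N \<le> t \<Longrightarrow>
      dist (\<sigma> 0) (\<rho> t) - dist (\<sigma> (r + 1)) (\<rho> t) = busemann x (\<sigma> 0) (\<sigma> (r + 1))"
    using busemann_along[OF \<rho>'(1,2)] by metis
  have "dist (\<sigma> 0) (\<rho> (N + r)) = N + r"
    using geodesicD[OF \<rho>'(1), of 0 "N + r"] N r \<rho>'(3) by auto
  then show False using N(2)[of "N + r"] r(2)[of "r + 1" "N + r"] b[of "r + 1"] r(1) N(1) by auto
qed

end

section \<open>Homotheties, isometries and shifts\<close>

text \<open>
  The action of a map on ends by taking images, in the form in which group actions on ends are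
  defined; it is only used for homotheties, which map ends to ends.
\<close>

definition end_map :: "('a::metric_space \<Rightarrow> 'b::metric_space) \<Rightarrow> 'a set set \<Rightarrow> 'b set set" where
  "end_map h u = (\<lambda>R. h ` R) ` u"

lemma end_map_comp: "end_map g (end_map h u) = end_map (g \<circ> h) u"
  by (simp add: end_map_def image_image image_comp)

lemma end_map_id: "end_map id u = u"
  by (simp add: end_map_def)

abbreviation inv_fun :: "('a \<Rightarrow> 'b) \<Rightarrow> 'b \<Rightarrow> 'a" where
  "inv_fun \<equiv> inv_into UNIV"

lemma isometry_rescaled_inj: "isometry_rescaled c h \<Longrightarrow> inj h"
  unfolding isometry_rescaled_def inj_def by (metis dist_eq_0_iff mult_zero_right)

lemma isometry_rescaled_inv:
  assumes "isometry_rescaled c h" "0 < c"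
  shows "isometry_rescaled (1 / c) (inv_fun h)" "inv_fun h \<circ> h = id" "h \<circ> inv_fun h = id"
    "inv_fun h (h x) = x" "h (inv_fun h y) = y"
proof -
  have inj: "inj h" and surj: "surj h"
    using assms isometry_rescaled_inj by (auto simp: isometry_rescaled_def)
  show 1: "inv_fun h \<circ> h = id" "h \<circ> inv_fun h = id" "inv_fun h (h x) = x" "h (inv_fun h y) = y" for x y
    using inj surj by (auto simp: surj_iff inj_iff[symmetric] surj_f_inv_f)
  have "1 / c * dist (inv_fun h x) (inv_fun h y) = dist x y" for x y
  proof -
    have "c * dist (h (inv_fun h x)) (h (inv_fun h y)) = dist (inv_fun h x) (inv_fun h y)"
      using assms by (auto simp: isometry_rescaled_def)
    then show ?thesis using assms(2) 1(4) by (simp add: field_simps)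
  qed
  moreover have "surj (inv_fun h)" using inj by (rule inj_imp_surj_inv)
  ultimately show "isometry_rescaled (1 / c) (inv_fun h)" by (simp add: isometry_rescaled_def)
qed

lemma isometry_rescaled_dist:
  assumes "isometry_rescaled c h" "0 < c"
  shows "dist (h x) (h y) = dist x y / c"
proof -
  have "c * dist (h x) (h y) = dist x y" using assms by (simp add: isometry_rescaled_def)
  then show ?thesis using assms(2) by (simp add: field_simps)
qed

lemma homothety_ray:
  assumes h: "isometry_rescaled c h" and c: "0 < c" and \<rho>: "geodesic {0..} \<rho>"
  shows "geodesic {0..} (\<lambda>t. h (\<rho> (c * t)))"
proof -
  have "dist (h (\<rho> (c * s))) (h (\<rho> (c * t))) = \<bar>s - t\<bar>" if "0 \<le> s" "0 \<le> t" for s t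
  proof -
    have "\<bar>c * s - c * t\<bar> = c * \<bar>s - t\<bar>" using c by (simp add: abs_mult flip: right_diff_distrib)
    then show ?thesis
      using that c isometry_rescaled_dist[OF h c] geodesicD[OF \<rho>, of "c * s" "c * t"] by simp
  qed
  then show ?thesis by (simp add: geodesic_iff)
qed

lemma same_tail_homothety:
  assumes "same_tail \<rho> \<sigma>" "0 < c"
  shows "same_tail (\<lambda>t. h (\<rho> (c * t))) (\<lambda>t. h (\<sigma> (c * t)))"
proof -
  obtain a b where ab: "0 \<le> a" "0 \<le> b" "\<And>t. 0 \<le> t \<Longrightarrow> \<rho> (a + t) = \<sigma> (b + t)"
    using assms(1) unfolding same_tail_def by metis
  have "h (\<rho> (c * (a / c + t))) = h (\<sigma> (c * (b / c + t)))" if "0 \<le> t" for t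
    using ab(3)[of "c * t"] that assms(2) by (simp add: distrib_left)
  then show ?thesis unfolding same_tail_def
    using ab(1,2) assms(2) by (intro exI[of _ "a / c"] conjI exI[of _ "b / c"]) auto
qed

lemma image_rescaled_half_line: "0 < (c::real) \<Longrightarrow> (\<lambda>t. \<rho> (c * t)) ` {0..} = \<rho> ` {0..}"
proof (intro subset_antisym subsetI)
  fix x assume "0 < c" "x \<in> \<rho> ` {0..}"
  then obtain t where "0 \<le> t" "x = \<rho> (c * (t / c))" by auto
  then show "x \<in> (\<lambda>t. \<rho> (c * t)) ` {0..}" using \<open>0 < c\<close> by (intro image_eqI[of _ _ "t / c"]) auto
qed auto

locale tree_pair = A: leafless_tree TA + B: leafless_tree TB
  for TA :: "'a::metric_space itself" and TB :: "'b::metric_space itself"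
begin

lemma end_map_end_of:
  assumes h: "isometry_rescaled c (h::'a \<Rightarrow> 'b)" and c: "0 < c" and \<rho>: "geodesic {0..} \<rho>"
  shows "end_map h (end_of \<rho>) = end_of (\<lambda>t. h (\<rho> (c * t)))"
proof (intro subset_antisym subsetI)
  note [simp] = isometry_rescaled_inv[OF h c]
  have ray: "geodesic {0..} (\<lambda>t. h (\<rho> (c * t)))" by (rule homothety_ray[OF h c \<rho>])
  fix R
  {
    assume "R \<in> end_map h (end_of \<rho>)"
    then obtain \<sigma> where \<sigma>: "geodesic {0..} \<sigma>" "end_of \<sigma> = end_of \<rho>" "R = h ` \<sigma> ` {0..}"
      using A.in_end_of_iff[OF \<rho>] by (auto simp: end_map_def)
    have "R = (\<lambda>t. h (\<sigma> (c * t))) ` {0..}"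
      using image_rescaled_half_line[OF c, of "\<lambda>t. h (\<sigma> t)"] \<sigma>(3) by (simp add: image_image)
    moreover have "end_of (\<lambda>t. h (\<sigma> (c * t))) = end_of (\<lambda>t. h (\<rho> (c * t)))"
      using same_tail_homothety[OF _ c] \<sigma> \<rho> A.end_of_eq_iff
        B.end_of_eq_iff[OF homothety_ray[OF h c \<sigma>(1)] ray] by blast
    ultimately show "R \<in> end_of (\<lambda>t. h (\<rho> (c * t)))"
      using B.in_end_of_iff[OF ray] homothety_ray[OF h c \<sigma>(1)] by blast
  next
    assume "R \<in> end_of (\<lambda>t. h (\<rho> (c * t)))"
    then obtain \<tau> where \<tau>: "geodesic {0..} \<tau>" "R = \<tau> ` {0..}"
      "end_of \<tau> = end_of (\<lambda>t. h (\<rho> (c * t)))" using B.in_end_of_iff[OF ray] by blast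
    define \<sigma> where "\<sigma> = (\<lambda>t. inv_fun h (\<tau> (1 / c * t)))"
    have c': "0 < 1 / c" using c by simp
    have \<sigma>: "geodesic {0..} \<sigma>"
      unfolding \<sigma>_def by (rule homothety_ray[OF isometry_rescaled_inv(1)[OF h c] c' \<tau>(1)])
    have "same_tail \<tau> (\<lambda>t. h (\<rho> (c * t)))" using \<tau> B.end_of_eq_iff[OF \<tau>(1) ray] by simp
    then have "same_tail \<sigma> \<rho>"
      using same_tail_homothety[OF _ c', of \<tau> "\<lambda>t. h (\<rho> (c * t))" "inv_fun h"] c by (simp add: \<sigma>_def)
    then have "end_of \<sigma> = end_of \<rho>" using A.end_of_eq_iff[OF \<sigma> \<rho>] by simp
    then have "\<sigma> ` {0..} \<in> end_of \<rho>" using A.in_end_of_iff[OF \<rho>] \<sigma> by blast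
    moreover have "R = h ` \<sigma> ` {0..}"
      using image_rescaled_half_line[OF c', of \<tau>] \<tau>(2) by (simp add: \<sigma>_def image_image)
    ultimately show "R \<in> end_map h (end_of \<rho>)" by (auto simp: end_map_def)
  }
qed

lemma end_map_in_ends:
  assumes h: "isometry_rescaled c (h::'a \<Rightarrow> 'b)" and c: "0 < c" and u: "u \<in> ends"
  shows "end_map h u \<in> ends"
proof -
  obtain \<rho> :: "real \<Rightarrow> 'a" where \<rho>: "geodesic {0..} \<rho>" "end_of \<rho> = u" using A.ends_cases[OF u] .
  then show ?thesis
    using end_map_end_of[OF h c \<rho>(1)] B.end_of_in_ends[OF homothety_ray[OF h c \<rho>(1)]] by simp
qed

lemma homothety_line:
  assumes h: "isometry_rescaled c (h::'a \<Rightarrow> 'b)" and c: "0 < c" and \<gamma>: "line \<gamma> u v"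
  shows "line (\<lambda>t. h (\<gamma> (c * t))) (end_map h u) (end_map h v)"
proof -
  have "dist (h (\<gamma> (c * s))) (h (\<gamma> (c * t))) = \<bar>s - t\<bar>" for s t
  proof -
    have "\<bar>c * s - c * t\<bar> = c * \<bar>s - t\<bar>" using c by (simp add: abs_mult flip: right_diff_distrib)
    then show ?thesis
      using c isometry_rescaled_dist[OF h c] line_dist[OF \<gamma>, of "c * s" "c * t"] by simp
  qed
  then show ?thesis
    using end_map_end_of[OF h c line_rays(1)[OF \<gamma>]] end_map_end_of[OF h c line_rays(2)[OF \<gamma>]] \<gamma>
    by (simp add: line_def geodesic_iff)
qed

lemma end_map_inj:
  assumes h: "isometry_rescaled c (h::'a \<Rightarrow> 'b)" and c: "0 < c" and "end_map h u = end_map h v"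
  shows "u = v"
  using assms end_map_comp[of "inv_fun h" h] isometry_rescaled_inv(2)[OF h c] by (metis end_map_id)

lemma homothety_apartment:
  assumes h: "isometry_rescaled c (h::'a \<Rightarrow> 'b)" and c: "0 < c"
    and "u \<in> ends" "v \<in> ends" "u \<noteq> v"
  shows "apartment_between (end_map h u) (end_map h v) = h ` apartment_between u v"
proof -
  obtain \<gamma> :: "real \<Rightarrow> 'a" where \<gamma>: "line \<gamma> u v" using A.line_exists assms by blast
  have "h (\<gamma> x) = (\<lambda>t. h (\<gamma> (c * t))) (x / c)" for x using c by simp
  then have "h (\<gamma> x) \<in> range (\<lambda>t. h (\<gamma> (c * t)))" for x by (rule range_eqI)
  then have "range (\<lambda>t. h (\<gamma> (c * t))) = h ` range \<gamma>" by blast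
  then show ?thesis
    using A.apartment_between_eq[OF \<gamma>] B.apartment_between_eq[OF homothety_line[OF h c \<gamma>]] by simp
qed

lemma homothety_center:
  assumes h: "isometry_rescaled c (h::'a \<Rightarrow> 'b)" and c: "0 < c" and "center z u v w"
  shows "center (h z) (end_map h u) (end_map h v) (end_map h w)"
  using assms(3) homothety_apartment[OF h c] end_map_in_ends[OF h c] end_map_inj[OF h c]
  unfolding center_def by (metis imageI)

lemma homothety_busemann:
  assumes h: "isometry_rescaled c (h::'a \<Rightarrow> 'b)" and c: "0 < c" and u: "u \<in> ends"
  shows "busemann (end_map h u) (h x) (h y) = busemann u x y / c"
proof -
  obtain \<rho> :: "real \<Rightarrow> 'a" where \<rho>: "geodesic {0..} \<rho>" "end_of \<rho> = u" using A.ends_cases[OF u] .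
  obtain N where N: "\<And>t. N \<le> t \<Longrightarrow> dist x (\<rho> t) - dist y (\<rho> t) = busemann u x y"
    using A.busemann_along[OF \<rho>, of x y] by metis
  have "end_of (\<lambda>t. h (\<rho> (c * t))) = end_map h u" using end_map_end_of[OF h c \<rho>(1)] \<rho>(2) by simp
  then obtain M where M: "\<And>t. M \<le> t \<Longrightarrow>
      dist (h x) (h (\<rho> (c * t))) - dist (h y) (h (\<rho> (c * t))) = busemann (end_map h u) (h x) (h y)"
    using B.busemann_along[OF homothety_ray[OF h c \<rho>(1)], of _ "h x" "h y"] by metis
  let ?t = "max M (N / c)"
  have "N \<le> c * ?t" using c by (simp add: max_def field_simps)
  from N[OF this] have "dist x (\<rho> (c * ?t)) / c - dist y (\<rho> (c * ?t)) / c = busemann u x y / c"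
    by (simp flip: diff_divide_distrib)
  then show ?thesis using M[of ?t] isometry_rescaled_dist[OF h c] by simp
qed

end

abbreviation isometry :: "('a::metric_space \<Rightarrow> 'a) \<Rightarrow> bool" where
  "isometry g \<equiv> isometry_rescaled 1 g"

text \<open>
  For an isometry \<open>g\<close> that fixes the end \<open>u\<close>, the displacement towards \<open>u\<close> is the same at all
  points; the choice of the base point only matters for other isometries.
\<close>

definition shift :: "('a::metric_space \<Rightarrow> 'a) \<Rightarrow> 'a set set \<Rightarrow> real" where
  "shift g u = busemann u undefined (g undefined)"

lemma isometry_comp: "isometry g \<Longrightarrow> isometry h \<Longrightarrow> isometry (g \<circ> h)"
  unfolding isometry_rescaled_def using comp_surj[of h g] by simp

lemma isometry_inv: "isometry g \<Longrightarrow> isometry (inv_fun g)"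
  using isometry_rescaled_inv(1)[of 1 g] by simp

context leafless_tree
begin

interpretation self: tree_pair T T by unfold_locales

lemmas isometry_end = self.end_map_in_ends[where c = 1, simplified]
lemmas isometry_apartment = self.homothety_apartment[where c = 1, simplified]
lemmas isometry_center = self.homothety_center[where c = 1, simplified]
lemmas isometry_busemann = self.homothety_busemann[where c = 1, simplified]
lemmas isometry_line = self.homothety_line[where c = 1, simplified]
lemmas isometry_end_of = self.end_map_end_of[where c = 1, simplified]

lemma shift_eq:
  assumes "isometry g" "u \<in> ends" "end_map g u = u"
  shows "busemann u x (g (x::'a)) = shift g u"
proof -
  let ?o = "undefined :: 'a"
  have "busemann u (g ?o) (g x) = busemann u ?o x"
    using isometry_busemann[OF assms(1,2), of ?o x] assms(3) by simp
  then show ?thesis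
    using busemann_cocycle[OF assms(2), of x ?o "g x"] busemann_swap[OF assms(2), of x ?o]
      busemann_cocycle[OF assms(2), of ?o "g ?o" "g x"] by (simp add: shift_def)
qed

lemma shift_comp:
  assumes "isometry g" "isometry h" "u \<in> ends" "end_map g u = u" "end_map h u = u"
  shows "shift (g \<circ> h) u = shift g u + shift (h::'a \<Rightarrow> 'a) u"
proof -
  let ?o = "undefined :: 'a"
  have "busemann u ?o (g (h ?o)) = busemann u ?o (h ?o) + busemann u (h ?o) (g (h ?o))"
    using busemann_cocycle[OF assms(3)] by simp
  then show ?thesis using shift_eq[OF assms(1,3,4), of "h ?o"] by (simp add: shift_def)
qed

lemma shift_conj:
  assumes "isometry g" "isometry k" "u \<in> ends" "end_map g u = u" and "\<And>x. g' (k x) = k (g x)"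
  shows "shift (g'::'a \<Rightarrow> 'a) (end_map k u) = shift g u"
proof -
  let ?o = "undefined :: 'a"
  have surj: "k (inv_fun k ?o) = ?o" using isometry_rescaled_inv(5)[OF assms(2)] by simp
  have "shift g' (end_map k u) = busemann (end_map k u) (k (inv_fun k ?o)) (g' (k (inv_fun k ?o)))"
    by (simp add: shift_def surj)
  also have "\<dots> = busemann u (inv_fun k ?o) (g (inv_fun k ?o))"
    using isometry_busemann[OF assms(2,3)] assms(5) by simp
  also have "\<dots> = shift g u" using shift_eq assms by blast
  finally show ?thesis .
qed

lemma shift_inv:
  assumes "isometry g" "u \<in> ends" "end_map g u = u"
  shows "end_map (inv_fun g) u = u" "shift (inv_fun g) u = - shift (g::'a \<Rightarrow> 'a) u"
proof -
  note inv = isometry_rescaled_inv[OF assms(1), simplified]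
  show 1: "end_map (inv_fun g) u = u" using end_map_comp[of "inv_fun g" g u] inv(2) assms(3) end_map_id
    by metis
  have "shift id u = 0" using busemann_self[OF assms(2)] by (simp add: shift_def)
  then show "shift (inv_fun g) u = - shift g u"
    using shift_comp[OF isometry_inv[OF assms(1)] assms(1,2) 1 assms(3)] inv(2) by simp
qed

text \<open>
  The isometry maps some ray towards the fixed end into itself by a translation. Pulling that
  ray back by the powers of the isometry exhausts a line, and the other end of this line is
  fixed as well.
\<close>

lemma axis_of_positive_shift:
  assumes g: "isometry (g::'a \<Rightarrow> 'a)" and u: "u \<in> ends" and fix_u: "end_map g u = u"
    and s: "0 < shift g u"
  obtains v where "v \<in> ends" "v \<noteq> u" "end_map g v = v"
proof -
  define s where "s = shift g u"
  have "0 < s" using assms by (simp add: s_def)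
  note inv = isometry_rescaled_inv[OF g, simplified]
  obtain \<sigma> :: "real \<Rightarrow> 'a" where \<sigma>: "geodesic {0..} \<sigma>" "end_of \<sigma> = u" using ends_cases[OF u] .
  have g\<sigma>: "geodesic {0..} (\<lambda>t. g (\<sigma> t))" "end_of (\<lambda>t. g (\<sigma> t)) = u"
    using homothety_ray[OF g _ \<sigma>(1)] isometry_end_of[OF g \<sigma>(1)] \<sigma>(2) fix_u by auto
  obtain a b where ab: "0 \<le> a" "0 \<le> b" "\<And>t. 0 \<le> t \<Longrightarrow> \<sigma> (a + t) = g (\<sigma> (b + t))"
    using end_of_eq_iff[OF \<sigma>(1) g\<sigma>(1)] \<sigma>(2) g\<sigma>(2) unfolding same_tail_def by metis
  have "a - b = s"
  proof -
    have "busemann u (\<sigma> b) (\<sigma> a) = a - b" using busemann_ray[OF \<sigma>(1), of b a] \<sigma>(2) ab by simp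
    moreover have "\<sigma> a = g (\<sigma> b)" using ab(3)[of 0] by simp
    ultimately show ?thesis using shift_eq[OF g u fix_u, of "\<sigma> b"] by (simp add: s_def)
  qed
  define \<rho> where "\<rho> = (\<lambda>t. \<sigma> (b + t))"
  have \<rho>: "geodesic {0..} \<rho>" "end_of \<rho> = u"
    using geodesic_shift[OF \<sigma>(1) ab(2)] end_of_shift[OF \<sigma>(1) ab(2)] \<sigma>(2) by (auto simp: \<rho>_def)
  have step: "g (\<rho> t) = \<rho> (s + t)" if "0 \<le> t" for t
  proof -
    have "b + (s + t) = a + t" using \<open>a - b = s\<close> by simp
    then show ?thesis using ab(3)[OF that] unfolding \<rho>_def by metis
  qed
  \<comment> \<open>\<open>P n\<close> parametrizes the \<open>n\<close>-th pullback of the ray by \<open>{- (n * s)..}\<close>, so that it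
    extends the previous one.\<close>
  define P where "P n t = (inv_fun g ^^ n) (\<rho> (t + real n * s))" for n t
  have P_Suc: "P (Suc n) t = P n t" if "0 \<le> t + real n * s" for n t
  proof -
    have eq: "t + real (Suc n) * s = s + (t + real n * s)" by (simp add: algebra_simps)
    have "P (Suc n) t = (inv_fun g ^^ n) (inv_fun g (g (\<rho> (t + real n * s))))"
      by (simp only: P_def eq funpow_Suc_right o_apply step[OF that])
    then show ?thesis using inv(4) by (simp add: P_def)
  qed
  have stable: "P (m + n) t = P n t" if "0 \<le> t + real n * s" for m n t
  proof (induction m)
    case (Suc m)
    have "0 \<le> real m * s" using \<open>0 < s\<close> by simp
    then have "0 \<le> t + real (m + n) * s" using that by (simp add: distrib_right)
    then show ?case using P_Suc[of t "m + n"] Suc by simp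
  qed simp
  define N where "N t = nat \<lceil>\<bar>t\<bar> / s\<rceil>" for t
  have N: "0 \<le> t + real n * s" if "N t \<le> n" for t n
  proof -
    have "\<bar>t\<bar> / s \<le> real n" using that by (simp add: N_def nat_le_iff ceiling_le_iff)
    then have "\<bar>t\<bar> \<le> real n * s" using \<open>0 < s\<close> by (simp add: field_simps)
    then show ?thesis by linarith
  qed
  define \<gamma> where "\<gamma> t = P (N t) t" for t
  have \<gamma>: "\<gamma> t = P n t" if "N t \<le> n" for t n
    using stable[where t = t and n = "N t" and m = "n - N t", OF N[OF order_refl]] that by (simp add: \<gamma>_def)
  have iso: "dist ((inv_fun g ^^ n) x) ((inv_fun g ^^ n) y) = dist x y" for n x y
    by (induction n) (use isometry_inv[OF g] in \<open>auto simp: isometry_rescaled_def\<close>)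
  have "dist (\<gamma> x) (\<gamma> y) = \<bar>x - y\<bar>" for x y
  proof -
    let ?n = "max (N x) (N y)"
    have "dist (\<gamma> x) (\<gamma> y) = dist (P ?n x) (P ?n y)" using \<gamma>[of x ?n] \<gamma>[of y ?n] by simp
    also have "\<dots> = \<bar>x - y\<bar>"
      using iso geodesicD[OF \<rho>(1), of "x + real ?n * s" "y + real ?n * s"] N[of x ?n] N[of y ?n]
      by (simp add: P_def)
    finally show ?thesis .
  qed
  then have geo: "geodesic UNIV \<gamma>" by (simp add: geodesic_iff)
  have "\<gamma> t = \<rho> t" if "0 \<le> t" for t
    using stable[where t = t and n = 0 and m = "N t"] that by (simp add: \<gamma>_def P_def)
  then have "\<gamma> ` {0..} = \<rho> ` {0..}" by (intro image_cong) auto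
  then have "end_of \<gamma> = u" using \<rho>(2) by (simp add: end_of_def)
  then have line: "line \<gamma> u (end_of (\<lambda>t. \<gamma> (- t)))" using geo by (simp add: line_def)
  define v where "v = end_of (\<lambda>t. \<gamma> (- t))"
  have g\<gamma>: "g (\<gamma> t) = \<gamma> (t + s)" for t
  proof -
    let ?n = "max (N t) (N (t + s))"
    have "g (\<gamma> t) = g (P (Suc ?n) t)" using \<gamma>[of t "Suc ?n"] by simp
    also have "\<dots> = (inv_fun g ^^ ?n) (\<rho> (t + real (Suc ?n) * s))"
      using inv(5) by (simp add: P_def)
    also have "\<dots> = P ?n (t + s)" by (simp add: P_def algebra_simps)
    finally show ?thesis using \<gamma>[of "t + s" ?n] by simp
  qed
  have "(\<lambda>t. g (\<gamma> t)) = (\<lambda>t. \<gamma> (s + t))" using g\<gamma> by (simp add: add.commute)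
  then have "line (\<lambda>t. \<gamma> (s + t)) u (end_map g v)"
    using isometry_line[OF g line] fix_u by (simp add: v_def)
  moreover have "line (\<lambda>t. \<gamma> (s + t)) u v" using line_shift[OF line] by (simp add: v_def)
  ultimately have "end_map g v = v" by (simp add: line_def)
  then show thesis using that[of v] line_ends[OF line] line_distinct[OF line] by (auto simp: v_def)
qed

lemma axis:
  assumes g: "isometry (g::'a \<Rightarrow> 'a)" and u: "u \<in> ends" and fix_u: "end_map g u = u"
    and s: "shift g u \<noteq> 0"
  obtains v where "v \<in> ends" "v \<noteq> u" "end_map g v = v"
proof (cases "0 < shift g u")
  case True
  then show thesis using axis_of_positive_shift assms that by metis
next
  case False
  note inv = shift_inv[OF g u fix_u]
  have "0 < shift (inv_fun g) u" using False s inv by simp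
  then obtain v where v: "v \<in> ends" "v \<noteq> u" "end_map (inv_fun g) v = v"
    using axis_of_positive_shift[OF isometry_inv[OF g] u inv(1)] by metis
  then have "end_map g v = v"
    using end_map_comp[of g "inv_fun g" v] isometry_rescaled_inv(3)[OF g] end_map_id by simp
  then show thesis using that v by blast
qed

text \<open>
  The three isometries carry the apartment between \<open>u\<close> and \<open>v\<close> around the tripod, each one
  fixing one end, so that together they exchange \<open>u\<close> and \<open>v\<close>. Since Busemann functions of the
  two ends of an apartment differ only by the sign on it, each shift can be read off from either
  end. It is here that the position of the center enters: the tripod is what makes the
  intermediate points lie on the right apartments.
\<close>

lemma shift_around_tripod:
  assumes z: "center (z::'a) u v w"
    and g: "isometry g1" "isometry g2" "isometry g3"
    and "end_map g1 v = v" "end_map g1 u = w" "end_map g2 w = w" "end_map g2 v = u"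
      "end_map g3 u = u" "end_map g3 w = v"
  shows "busemann u z (g3 (g2 (g1 z))) = shift g1 v - shift g2 w + shift g3 u"
proof -
  have e: "u \<in> ends" "v \<in> ends" "w \<in> ends" "u \<noteq> v" "v \<noteq> w" "u \<noteq> w"
    and zin: "z \<in> apartment_between u v" "z \<in> apartment_between v w" "z \<in> apartment_between u w"
    using z by (auto simp: center_def)
  have "g1 z \<in> apartment_between w v"
    using isometry_apartment[OF g(1), of u v] assms e zin by auto
  moreover have "z \<in> apartment_between w v" using zin(2) apartment_between_commute e by metis
  ultimately have "busemann w z (g1 z) = - busemann v z (g1 z)"
    using busemann_apartment(1)[of v w z "g1 z"] apartment_between_commute[of v w] e by metis
  also have "\<dots> = - shift g1 v" using shift_eq g assms e by simp
  finally have 1: "busemann w z (g1 z) = - shift g1 v" .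
  have 2: "busemann w (g1 z) (g2 (g1 z)) = shift g2 w" using shift_eq g assms e by simp
  have "g2 (g1 z) \<in> apartment_between w u"
    using isometry_apartment[OF g(2), of w v] assms e \<open>g1 z \<in> apartment_between w v\<close> by auto
  then have "busemann u z (g2 (g1 z)) = - busemann w z (g2 (g1 z))"
    using busemann_apartment(1)[of w u z "g2 (g1 z)"] apartment_between_commute[of w u] e zin by metis
  also have "\<dots> = shift g1 v - shift g2 w"
    using 1 2 busemann_cocycle[of w z "g1 z" "g2 (g1 z)"] e by simp
  finally have 3: "busemann u z (g2 (g1 z)) = shift g1 v - shift g2 w" .
  have "busemann u (g2 (g1 z)) (g3 (g2 (g1 z))) = shift g3 u" using shift_eq g assms e by simp
  then show ?thesis using 3 busemann_cocycle[of u z "g2 (g1 z)" "g3 (g2 (g1 z))"] e by simp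
qed

text \<open>
  \<open>k\<close> and \<open>k \<circ> h\<close> both reverse the apartment, as reflections at two points; where they send \<open>z\<close>
  and \<open>z'\<close> and the translation \<open>h\<close> that relates them determine the position of \<open>z'\<close> relative to
  \<open>z\<close>.
\<close>

lemma distance_from_reflections:
  assumes e: "u \<in> ends" "v \<in> ends" "u \<noteq> v"
    and z: "z \<in> apartment_between u v" "z' \<in> apartment_between u v"
    and k: "isometry k" "end_map k v = u" and h: "isometry h" "end_map h u = u" "end_map h v = v"
  shows "2 * busemann u z' z = busemann u z' (k (h z')) - busemann u z (k z) + shift h (u::'a set set)"
proof -
  have "h z' \<in> apartment_between u v" using isometry_apartment[OF h(1) e] h z by auto
  then have "busemann v z (h z') = - busemann u z (h z')" using busemann_apartment[OF e] z by auto
  moreover have "busemann u (k z) (k (h z')) = busemann v z (h z')"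
    using isometry_busemann[OF k(1) e(2), of z "h z'"] k(2) by simp
  moreover have "busemann u z' (h z') = shift h u" using shift_eq h e by simp
  ultimately show ?thesis
    using busemann_cocycle[OF e(1), of z' z "k z"] busemann_cocycle[OF e(1), of z' "k z" "k (h z')"]
      busemann_cocycle[OF e(1), of z z' "h z'"] busemann_swap[OF e(1), of z z'] by simp
qed

end

section \<open>Stability of geodesics under coarse equivalences\<close>

context leafless_tree
begin

lemma segment_subset:
  assumes "dist a p + dist p c = dist a (c::'a)"
  shows "dist a p + dist p b = dist a b \<or> dist b p + dist p c = dist b c"
proof -
  have "dist a c + dist p b \<le> max (dist a p + dist c b) (dist a b + dist c p)"
    by (rule four_point)
  then show ?thesis
    using assms dist_triangle[of a b p] dist_triangle[of b c p] dist_commute[of c b]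
      dist_commute[of c p] dist_commute[of p b] by linarith
qed

text \<open>
  A geodesic from \<open>x\<close> to \<open>x'\<close> that is too short to reach \<open>q\<close> does not contain it, so \<open>q\<close> stays
  on the geodesic when \<open>x\<close> is replaced by \<open>x'\<close>.
\<close>

lemma between_close_endpoints:
  assumes "dist x q + dist q y = dist x (y::'a)" "dist x x' < dist x q" "dist y y' < dist y q"
  shows "dist x' q + dist q y' = dist x' y'"
proof -
  have "dist x' q + dist q y = dist x' y"
    using segment_subset[OF assms(1), of x'] assms(2) zero_le_dist[of q x'] by linarith
  from segment_subset[OF this, of y'] show ?thesis
    using assms(3) dist_commute[of y q] dist_commute[of y y'] zero_le_dist[of y' q] by linarith
qed

lemma line_convex:
  assumes \<gamma>: "line (\<gamma>::real \<Rightarrow> 'a) u v" and q: "dist (\<gamma> a) q + dist q (\<gamma> b) = dist (\<gamma> a) (\<gamma> b)"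
  shows "q \<in> range \<gamma>"
proof -
  define d where "d = dist (\<gamma> a) q"
  define c where "c = (if a \<le> b then a + d else a - d)"
  have d: "0 \<le> d" "d \<le> \<bar>a - b\<bar>"
    using q line_dist[OF \<gamma>, of a b] zero_le_dist[of q "\<gamma> b"] zero_le_dist[of "\<gamma> a" q]
    unfolding d_def by linarith+
  have "q = \<gamma> c"
  proof (rule between_unique[OF q])
    show "dist (\<gamma> a) (\<gamma> c) + dist (\<gamma> c) (\<gamma> b) = dist (\<gamma> a) (\<gamma> b)"
      unfolding line_dist[OF \<gamma>] c_def using d by auto
    show "dist (\<gamma> a) q = dist (\<gamma> a) (\<gamma> c)"
      unfolding line_dist[OF \<gamma>] c_def d_def[symmetric] using d(1) by auto
  qed
  then show ?thesis by blast
qed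

lemma line_subset_if_close:
  assumes \<gamma>: "line (\<gamma>::real \<Rightarrow> 'a) u v" and \<delta>: "line \<delta> u' v'"
    and close: "\<And>t. \<exists>s. dist (\<gamma> t) (\<delta> s) \<le> r"
  shows "range \<gamma> \<subseteq> range \<delta>"
proof
  fix p assume "p \<in> range \<gamma>"
  then obtain t where t: "p = \<gamma> t" by blast
  let ?N = "\<bar>r\<bar> + 1"
  obtain a b where ab: "dist (\<gamma> (t - ?N)) (\<delta> a) \<le> r" "dist (\<gamma> (t + ?N)) (\<delta> b) \<le> r"
    using close by metis
  have "dist (\<delta> a) p + dist p (\<delta> b) = dist (\<delta> a) (\<delta> b)"
    by (rule between_close_endpoints[of "\<gamma> (t - ?N)" _ "\<gamma> (t + ?N)"])
      (use ab t line_dist[OF \<gamma>] in auto)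
  then show "p \<in> range \<delta>" by (rule line_convex[OF \<delta>])
qed

lemma apartment_eq_if_finite_Hausdorff_distance:
  assumes "apartment (A::'a set)" "apartment B"
    and "finite_Hausdorff_distance A C" "finite_Hausdorff_distance B C"
  shows "A = B"
proof -
  have *: "A \<subseteq> B" if AB: "apartment A" "apartment B" "finite_Hausdorff_distance A C"
    "finite_Hausdorff_distance B C" for A B :: "'a set"
  proof -
    obtain \<gamma> u v where \<gamma>: "line \<gamma> u v" "A = range \<gamma>" using apartment_cases[OF AB(1)] .
    obtain \<delta> u' v' where \<delta>: "line \<delta> u' v'" "B = range \<delta>" using apartment_cases[OF AB(2)] .
    obtain r where r: "\<And>x. x \<in> A \<Longrightarrow> \<exists>y\<in>C. dist x y \<le> r"
      using AB(3) unfolding finite_Hausdorff_distance_def by blast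
    obtain r' where r': "\<And>y. y \<in> C \<Longrightarrow> \<exists>x\<in>B. dist x y \<le> r'"
      using AB(4) unfolding finite_Hausdorff_distance_def by blast
    have "\<exists>s. dist (\<gamma> t) (\<delta> s) \<le> r + r'" for t
    proof -
      have "\<gamma> t \<in> A" using \<gamma> by blast
      then obtain y where y: "y \<in> C" "dist (\<gamma> t) y \<le> r" using r by blast
      then obtain x where "x \<in> B" "dist x y \<le> r'" using r' by blast
      moreover from this obtain s where "x = \<delta> s" using \<delta> by blast
      ultimately show ?thesis
        using y dist_triangle[of "\<gamma> t" x y] by (intro exI[of _ s]) (simp add: dist_commute)
    qed
    then show ?thesis using line_subset_if_close[OF \<gamma>(1) \<delta>(1)] \<gamma> \<delta> by blast
  qed
  show ?thesis using *[of A B] *[of B A] assms by blast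
qed

text \<open>
  If \<open>q1\<close> lies on the side of \<open>u\<close> then the path from it to \<open>q2\<close> passes through the center,
  otherwise the one to \<open>q3\<close> does; both are short.
\<close>

lemma close_to_center:
  assumes z: "center (z::'a) u v w"
    and q: "q1 \<in> apartment_between u v" "q2 \<in> apartment_between v w" "q3 \<in> apartment_between u w"
    and M: "dist p q1 \<le> M" "dist p q2 \<le> M" "dist p q3 \<le> M"
  shows "dist p z \<le> 3 * M"
proof -
  have e: "u \<in> ends" "v \<in> ends" "w \<in> ends" "u \<noteq> v" and zin: "z \<in> apartment_between u v"
    using z by (auto simp: center_def)
  have 2: "busemann u q2 z = dist q2 z"
    using busemann_third_end(1)[OF center_commute(4)[OF z] q(2)] .
  have 3: "busemann v q3 z = dist q3 z"
    using busemann_third_end(1)[OF center_commute(2)[OF z] q(3)] .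
  have 1: "busemann v q1 z = - busemann u q1 z" "dist q1 z = \<bar>busemann u q1 z\<bar>"
    using busemann_apartment[OF e(1,2,4) q(1) zin] by auto
  have "dist q1 q2 \<le> 2 * M" "dist q1 q3 \<le> 2 * M"
    using M dist_triangle3[of q1 q2 p] dist_triangle3[of q1 q3 p] by auto
  moreover have "dist q1 z \<le> dist q1 q2 \<or> dist q1 z \<le> dist q1 q3"
    using 1 2 3 busemann_le_dist[OF e(1), of q1 q2] busemann_le_dist[OF e(2), of q1 q3]
      busemann_cocycle[OF e(1), of q1 q2 z] busemann_cocycle[OF e(2), of q1 q3 z]
      zero_le_dist[of q2 z] zero_le_dist[of q3 z] by linarith
  ultimately have "dist q1 z \<le> 2 * M" by linarith
  then show ?thesis using M(1) dist_triangle[of p z q1] by linarith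
qed

end

text \<open>
  A coarse equivalence together with a coarse inverse, in the quantitative form that controlled
  maps between geodesic spaces have.
\<close>

locale coarse_pair = tree_pair TA TB
  for TA :: "'a::metric_space itself" and TB :: "'b::metric_space itself" +
  fixes f :: "'a \<Rightarrow> 'b" and g :: "'b \<Rightarrow> 'a" and L :: real
  assumes L: "1 \<le> L"
    and f_upper: "dist (f x) (f y) \<le> L * dist x y + L"
    and g_upper: "dist (g x') (g y') \<le> L * dist x' y' + L"
    and gf: "dist (g (f x)) x \<le> L"
    and fg: "dist (f (g x')) x' \<le> L"
begin

lemma swapped: "coarse_pair TB TA g f L"
  by unfold_locales (use L f_upper g_upper gf fg in auto)

lemma f_lower: "dist x y \<le> L * dist (f x) (f y) + 3 * L"
  using dist_triangle[of x y "g (f x)"] dist_triangle[of "g (f x)" y "g (f y)"]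
    gf[of x] gf[of y] g_upper[of "f x" "f y"] by (simp add: dist_commute)

lemma dist_image_ge:
  assumes "L * r + 3 * L \<le> dist x y"
  shows "r \<le> dist (f x) (f y)"
proof -
  have "L * r \<le> L * dist (f x) (f y)" using f_lower[of x y] assms by linarith
  then show ?thesis using L by simp
qed

text \<open>
  A geodesic from \<open>x\<close> to \<open>y\<close> is followed in unit steps. As long as \<open>p\<close> lies between the image
  of the current point and \<open>f y\<close> it has not been passed; at the step where this stops, \<open>p\<close> lies
  between two successive images, which are close to each other.
\<close>

lemma segment_near_image:
  assumes p: "dist (f x) p + dist p (f y) = dist (f x) (f y)"
  obtains b where "dist x b + dist b y = dist x y" "dist p (f b) \<le> 2 * L"
proof (cases "p = f y")
  case True
  then show thesis using that[of y] L by simp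
next
  case False
  obtain \<gamma> where \<gamma>: "geodesic_between x y \<gamma>" using A.geodesic_between_exists by blast
  define D where "D = dist x y"
  define b where "b i = \<gamma> (min (real i) D)" for i :: nat
  have "0 \<le> D" by (simp add: D_def)
  have b0: "b 0 = x" using \<gamma> \<open>0 \<le> D\<close> by (simp add: b_def geodesic_between_def)
  define P where "P i \<longleftrightarrow> dist (f (b i)) p + dist p (f y) = dist (f (b i)) (f y)" for i
  obtain n where "D \<le> real n" using real_arch_simple by blast
  then have "b n = y" using \<gamma> by (simp add: b_def geodesic_between_def D_def)
  then have "\<not> P n" using False by (simp add: P_def) (metis dist_eq_0_iff dist_commute add_cancel_right_right add_nonneg_eq_0_iff zero_le_dist)
  moreover have "P 0" using p b0 by (simp add: P_def)
  ultimately obtain j where j: "P j" "\<not> P (Suc j)" by (metis dec_induct le0)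
  have "dist (f (b j)) p + dist p (f (b (Suc j))) = dist (f (b j)) (f (b (Suc j)))"
    using B.segment_subset[of "f (b j)" p "f y" "f (b (Suc j))"] j by (auto simp: P_def)
  moreover have "dist (b j) (b (Suc j)) \<le> 1"
    using geodesicD[of "{0..D}" \<gamma> "min (real j) D" "min (real (Suc j)) D"] \<gamma> \<open>0 \<le> D\<close>
    by (auto simp: b_def geodesic_between_def D_def)
  then have "L * dist (b j) (b (Suc j)) \<le> L * 1" using L by (intro mult_left_mono) auto
  ultimately have "dist p (f (b (Suc j))) \<le> L * 1 + L"
    using f_upper[of "b j" "b (Suc j)"] zero_le_dist[of "f (b j)" p] by linarith
  moreover have "dist x (b (Suc j)) + dist (b (Suc j)) y = dist x y"
    using A.geodesic_between_point[OF \<gamma>, of "min (real (Suc j)) D"] \<open>0 \<le> D\<close>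
    by (simp add: b_def D_def)
  ultimately show thesis using that by simp
qed

definition morse_bound where "morse_bound = 4 * L ^ 3 + 3 * L ^ 2 + 3 * L"

lemma morse_bound_pos: "0 < morse_bound"
  using L by (simp add: morse_bound_def add_pos_pos)

text \<open>
  The projection of \<open>f b\<close> to the geodesic from \<open>f x\<close> to \<open>f y\<close> lies on the geodesics from \<open>f b\<close>
  to both endpoints, hence is close to images of points \<open>b1\<close> and \<open>b2\<close> on either side of \<open>b\<close>.
  These two points are then close to each other, and so is \<open>b\<close>, which lies between them.
\<close>

lemma morse:
  assumes b: "dist x b + dist b y = dist x y"
  obtains q where "dist (f x) q + dist q (f y) = dist (f x) (f y)" "dist (f b) q \<le> morse_bound"
proof -
  obtain q where q: "dist (f x) q + dist q (f y) = dist (f x) (f y)"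
    "dist (f x) q + dist q (f b) = dist (f x) (f b)"
    "dist (f y) q + dist q (f b) = dist (f y) (f b)"
    using B.median_exists[of "f x" "f y" "f b"] by blast
  obtain b1 where b1: "dist x b1 + dist b1 b = dist x b" "dist q (f b1) \<le> 2 * L"
    using segment_near_image[OF q(2)] .
  have "dist (f b) q + dist q (f y) = dist (f b) (f y)" using q(3) by (simp add: dist_commute)
  then obtain b2 where b2: "dist b b2 + dist b2 y = dist b y" "dist q (f b2) \<le> 2 * L"
    using segment_near_image by blast
  have "dist b1 b \<le> dist b1 b2"
    using b b1 b2 dist_triangle[of x y b1] dist_triangle[of b1 y b2] zero_le_dist[of b b2]
    by linarith
  also have "\<dots> \<le> L * dist (f b1) (f b2) + 3 * L" by (rule f_lower)
  also have "\<dots> \<le> L * (4 * L) + 3 * L"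
    using b1 b2 dist_triangle3[of "f b1" "f b2" q] L by (intro add_right_mono mult_left_mono) auto
  finally have "L * dist b b1 \<le> L * (L * (4 * L) + 3 * L)"
    using L by (intro mult_left_mono) (auto simp: dist_commute)
  then have "dist (f b) (f b1) \<le> L * (L * (4 * L) + 3 * L) + L"
    using f_upper[of b b1] by linarith
  then have "dist (f b) q \<le> morse_bound"
    using b1(2) dist_triangle2[of "f b" q "f b1"]
    by (simp add: morse_bound_def algebra_simps power2_eq_square power3_eq_cube)
  then show thesis using that q(1) by blast
qed

text \<open>
  By coarse betweenness, the Gromov products of the images \<open>f (\<rho> s)\<close> and \<open>f (\<rho> t)\<close> grow with
  the parameters, so the geodesics from \<open>f (\<rho> 0)\<close> to these images stabilize to a ray. This
  replaces taking limits, which need not exist in the space.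
\<close>

lemma ray_tracked:
  assumes \<rho>: "geodesic {0..} \<rho>"
  obtains \<sigma> where "geodesic {0..} \<sigma>" "\<And>t. 0 \<le> t \<Longrightarrow> \<exists>s\<ge>0. dist (f (\<rho> t)) (\<sigma> s) \<le> morse_bound"
proof -
  define p where "p t = f (\<rho> t)" for t
  let ?o = "p 0"
  \<comment> \<open>From parameter \<open>T r\<close> on, the images have distance at least \<open>r + morse_bound\<close> from the
    starting point, so that the geodesics to them agree up to \<open>r\<close>.\<close>
  define T where "T r = L * (r + morse_bound) + 3 * L" for r
  have T: "0 \<le> T r" "\<And>t. T r \<le> t \<Longrightarrow> r + morse_bound \<le> dist ?o (p t)" if "0 \<le> r" for r
  proof -
    show "0 \<le> T r" using that L morse_bound_pos by (simp add: T_def)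
    then show "r + morse_bound \<le> dist ?o (p t)" if "T r \<le> t" for t
      using that dist_image_ge[of "r + morse_bound" "\<rho> 0" "\<rho> t"] geodesicD[OF \<rho>, of 0 t]
      by (simp add: p_def T_def)
  qed
  have prod: "dist ?o (p s) - morse_bound \<le> (dist ?o (p s) + dist ?o (p t) - dist (p s) (p t)) / 2"
    if "0 \<le> s" "s \<le> t" for s t
  proof -
    have "dist (\<rho> 0) (\<rho> s) + dist (\<rho> s) (\<rho> t) = dist (\<rho> 0) (\<rho> t)"
      using that geodesicD[OF \<rho>, of 0 s] geodesicD[OF \<rho>, of s t] geodesicD[OF \<rho>, of 0 t] by simp
    then obtain q where "dist ?o q + dist q (p t) = dist ?o (p t)" "dist (p s) q \<le> morse_bound"
      using morse unfolding p_def by blast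
    then show ?thesis
      using dist_triangle[of ?o "p s" q] dist_triangle[of "p s" "p t" q] by (simp add: dist_commute)
  qed
  define \<Gamma> where "\<Gamma> t = (SOME \<gamma>. geodesic_between ?o (p t) \<gamma>)" for t
  have \<Gamma>: "geodesic_between ?o (p t) (\<Gamma> t)" for t
    unfolding \<Gamma>_def by (rule someI_ex[OF B.geodesic_between_exists])
  have agree: "\<Gamma> s r = \<Gamma> t r" if "0 \<le> r" "r \<le> dist ?o (p s) - morse_bound" "r \<le> dist ?o (p t)" "0 \<le> s" "s \<le> t"
    for r s t
  proof -
    have r: "r \<le> dist ?o (p s)" using that morse_bound_pos by simp
    show ?thesis
      by (rule B.agree_up_to_product[of ?o _ "p s" _ "p t"])
        (use B.geodesic_between_point[OF \<Gamma> that(1) r] B.geodesic_between_point[OF \<Gamma> that(1,3)]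
          prod[OF that(4,5)] that(2) in \<open>simp_all\<close>)
  qed
  define \<sigma> where "\<sigma> r = \<Gamma> (T r) r" for r
  have \<sigma>: "\<sigma> r = \<Gamma> t r" if "0 \<le> r" "T r \<le> t" for r t
    unfolding \<sigma>_def using agree[of r "T r" t] T(1)[OF that(1)] that morse_bound_pos T(2)[OF that]
      T(2)[OF that(1) order_refl] by simp
  have "dist (\<sigma> r) (\<sigma> r') = \<bar>r - r'\<bar>" if "0 \<le> r" "0 \<le> r'" for r r'
  proof -
    let ?t = "max (T r) (T r')"
    have "r + morse_bound \<le> dist ?o (p ?t)" "r' + morse_bound \<le> dist ?o (p ?t)"
      using T(2)[OF that(1), of ?t] T(2)[OF that(2), of ?t] by auto
    then show ?thesis
      using \<sigma>[OF that(1), of ?t] \<sigma>[OF that(2), of ?t] \<Gamma>[of ?t] that morse_bound_pos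
        geodesicD[of "{0..dist ?o (p ?t)}" "\<Gamma> ?t" r r'] by (simp add: geodesic_between_def)
  qed
  then have "geodesic {0..} \<sigma>" by (simp add: geodesic_iff)
  moreover have "\<exists>s\<ge>0. dist (f (\<rho> t)) (\<sigma> s) \<le> morse_bound" if "0 \<le> t" for t
  proof -
    \<comment> \<open>Up to distance \<open>r\<close> from the starting point, the geodesic to \<open>f (\<rho> t)\<close> agrees with
      \<open>\<sigma>\<close>.\<close>
    define r where "r = max 0 (dist ?o (p t) - morse_bound)"
    let ?t' = "max t (T r)"
    have "0 \<le> r" by (simp add: r_def)
    have r: "r \<le> dist ?o (p t)" using morse_bound_pos by (simp add: r_def)
    have r': "r \<le> dist ?o (p ?t')" using T(2)[OF \<open>0 \<le> r\<close>, of ?t'] morse_bound_pos by simp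
    have "\<Gamma> t r = \<Gamma> ?t' r"
    proof (cases "r = 0")
      case True
      then show ?thesis using \<Gamma> by (simp add: geodesic_between_def)
    next
      case False
      then show ?thesis using agree[of r t ?t'] \<open>0 \<le> r\<close> r' that by (simp add: r_def max_def split: if_splits)
    qed
    then have "\<sigma> r = \<Gamma> t r" using \<sigma>[OF \<open>0 \<le> r\<close>, of ?t'] by simp
    then have "dist (p t) (\<sigma> r) = dist ?o (p t) - r"
      using B.geodesic_between_point(2)[OF \<Gamma> \<open>0 \<le> r\<close> r] by (simp add: dist_commute)
    then show ?thesis using \<open>0 \<le> r\<close> by (intro exI[of _ r]) (auto simp: r_def p_def)
  qed
  ultimately show thesis using that by blast
qed

definition tracks :: "'a set set \<Rightarrow> 'b set set \<Rightarrow> bool" where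
  "tracks u v \<longleftrightarrow> (\<exists>\<rho> \<sigma> r. geodesic {0..} \<rho> \<and> geodesic {0..} \<sigma> \<and> end_of \<rho> = u \<and> end_of \<sigma> = v \<and>
     (\<forall>t\<ge>0. \<exists>s\<ge>0. dist (f (\<rho> t)) (\<sigma> s) \<le> r))"

lemma tracks_ends: "tracks u v \<Longrightarrow> u \<in> ends \<and> v \<in> ends"
  unfolding tracks_def using A.end_of_in_ends B.end_of_in_ends by blast

lemma tracks_exists:
  assumes "u \<in> ends"
  obtains v where "tracks u v"
proof -
  obtain \<rho> :: "real \<Rightarrow> 'a" where \<rho>: "geodesic {0..} \<rho>" "end_of \<rho> = u" using A.ends_cases[OF assms] .
  obtain \<sigma> where "geodesic {0..} \<sigma>" "\<And>t. 0 \<le> t \<Longrightarrow> \<exists>s\<ge>0. dist (f (\<rho> t)) (\<sigma> s) \<le> morse_bound"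
    using ray_tracked[OF \<rho>(1)] by blast
  then have "tracks u (end_of \<sigma>)" unfolding tracks_def using \<rho> by blast
  then show thesis by (rule that)
qed

text \<open>
  Changing a ray within its end changes only a bounded piece, so the bound becomes worse but
  remains.
\<close>

lemma tracksD:
  assumes "tracks u v" and \<rho>: "geodesic {0..} \<rho>" "end_of \<rho> = u" and \<sigma>: "geodesic {0..} \<sigma>" "end_of \<sigma> = v"
  obtains r where "\<And>t. 0 \<le> t \<Longrightarrow> \<exists>s\<ge>0. dist (f (\<rho> t)) (\<sigma> s) \<le> r"
proof -
  obtain \<rho>' \<sigma>' r where 1: "geodesic {0..} \<rho>'" "geodesic {0..} \<sigma>'" "end_of \<rho>' = u" "end_of \<sigma>' = v"
    "\<And>t. 0 \<le> t \<Longrightarrow> \<exists>s\<ge>0. dist (f (\<rho>' t)) (\<sigma>' s) \<le> r"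
    using assms(1) unfolding tracks_def by blast
  obtain a b where ab: "0 \<le> a" "0 \<le> b" "\<And>t. 0 \<le> t \<Longrightarrow> \<rho> (a + t) = \<rho>' (b + t)"
    using A.end_of_eq_iff[OF \<rho>(1) 1(1)] \<rho>(2) 1(3) unfolding same_tail_def by metis
  obtain c d where cd: "0 \<le> c" "0 \<le> d" "\<And>t. 0 \<le> t \<Longrightarrow> \<sigma>' (c + t) = \<sigma> (d + t)"
    using B.end_of_eq_iff[OF 1(2) \<sigma>(1)] \<sigma>(2) 1(4) unfolding same_tail_def by metis
  have far: "\<exists>s\<ge>0. dist (f (\<rho> t)) (\<sigma> s) \<le> r + c" if at: "a \<le> t" for t
  proof -
    have "\<rho> t = \<rho>' (b + (t - a))" using ab(3)[of "t - a"] at by simp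
    then obtain s where s: "0 \<le> s" "dist (f (\<rho> t)) (\<sigma>' s) \<le> r"
      using 1(5)[of "b + (t - a)"] ab at by auto
    show ?thesis
    proof (cases "c \<le> s")
      case True
      then have "\<sigma>' s = \<sigma> (d + (s - c))" using cd(3)[of "s - c"] by simp
      then show ?thesis using s cd True by (intro exI[of _ "d + (s - c)"]) auto
    next
      case False
      then have "dist (\<sigma>' s) (\<sigma> d) \<le> c"
        using cd(3)[of 0] geodesicD[OF 1(2), of s c] s cd by simp
      then show ?thesis using s cd dist_triangle[of "f (\<rho> t)" "\<sigma> d" "\<sigma>' s"]
        by (intro exI[of _ d]) auto
    qed
  qed
  have "\<exists>s\<ge>0. dist (f (\<rho> t)) (\<sigma> s) \<le> r + c + (L * a + L)" if "0 \<le> t" for t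
  proof (cases "a \<le> t")
    case True
    have "0 \<le> L * a + L" using L ab by simp
    then show ?thesis using far[OF True] by (metis add_increasing2 order_trans order_refl)
  next
    case False
    obtain s where s: "0 \<le> s" "dist (f (\<rho> a)) (\<sigma> s) \<le> r + c" using far[of a] by auto
    have "dist (f (\<rho> t)) (f (\<rho> a)) \<le> L * (a - t) + L"
      using f_upper[of "\<rho> t" "\<rho> a"] geodesicD[OF \<rho>(1), of t a] that False by simp
    also have "\<dots> \<le> L * a + L" using L that by simp
    finally show ?thesis using s dist_triangle[of "f (\<rho> t)" "\<sigma> s" "f (\<rho> a)"]
      by (intro exI[of _ s]) auto
  qed
  then show thesis using that by blast
qed

text \<open>
  \<open>f (\<rho> t)\<close> moves away from \<open>f (\<rho> 0)\<close>, and with it every point of \<open>\<sigma>\<close> that stays close to it.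
\<close>

lemma tracked_far:
  assumes \<rho>: "geodesic {0..} \<rho>" and \<sigma>: "geodesic {0..} \<sigma>"
  obtains T where "\<And>t s. T \<le> t \<Longrightarrow> 0 \<le> s \<Longrightarrow> dist (f (\<rho> t)) (\<sigma> s) \<le> r \<Longrightarrow> N \<le> s"
proof
  define K where "K = N + r + dist (f (\<rho> 0)) (\<sigma> 0)"
  fix t s assume t: "max 0 (L * K + 3 * L) \<le> t" and s: "0 \<le> s" "dist (f (\<rho> t)) (\<sigma> s) \<le> r"
  have "K \<le> dist (f (\<rho> 0)) (f (\<rho> t))"
    using dist_image_ge[of K "\<rho> 0" "\<rho> t"] geodesicD[OF \<rho>, of 0 t] t by simp
  also have "\<dots> \<le> dist (f (\<rho> 0)) (\<sigma> 0) + s + r"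
    using dist_triangle[of "f (\<rho> 0)" "f (\<rho> t)" "\<sigma> 0"] dist_triangle[of "\<sigma> 0" "f (\<rho> t)" "\<sigma> s"]
      geodesicD[OF \<sigma>, of 0 s] s by (simp add: dist_commute)
  finally show "N \<le> s" by (simp add: K_def)
qed

lemma tracks_unique:
  assumes "tracks u v" "tracks u v'"
  shows "v = v'"
proof -
  have e: "u \<in> ends" "v \<in> ends" "v' \<in> ends" using assms tracks_ends by auto
  obtain \<rho> :: "real \<Rightarrow> 'a" where \<rho>: "geodesic {0..} \<rho>" "end_of \<rho> = u" using A.ends_cases[OF e(1)] .
  obtain \<sigma> :: "real \<Rightarrow> 'b" where \<sigma>: "geodesic {0..} \<sigma>" "end_of \<sigma> = v" using B.ends_cases[OF e(2)] .
  obtain \<sigma>' :: "real \<Rightarrow> 'b" where \<sigma>': "geodesic {0..} \<sigma>'" "end_of \<sigma>' = v'" using B.ends_cases[OF e(3)] .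
  obtain r where r: "\<And>t. 0 \<le> t \<Longrightarrow> \<exists>s\<ge>0. dist (f (\<rho> t)) (\<sigma> s) \<le> r"
    using tracksD[OF assms(1) \<rho> \<sigma>] by metis
  obtain r' where r': "\<And>t. 0 \<le> t \<Longrightarrow> \<exists>s\<ge>0. dist (f (\<rho> t)) (\<sigma>' s) \<le> r'"
    using tracksD[OF assms(2) \<rho> \<sigma>'] by metis
  have "\<exists>s\<ge>N. \<exists>t\<ge>0. dist (\<sigma> s) (\<sigma>' t) \<le> r + r'" for N
  proof -
    obtain T where T: "\<And>t s. T \<le> t \<Longrightarrow> 0 \<le> s \<Longrightarrow> dist (f (\<rho> t)) (\<sigma> s) \<le> r \<Longrightarrow> N \<le> s"
      using tracked_far[OF \<rho>(1) \<sigma>(1)] by metis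
    obtain s where s: "0 \<le> s" "dist (f (\<rho> \<bar>T\<bar>)) (\<sigma> s) \<le> r" using r[of "\<bar>T\<bar>"] by auto
    obtain s' where s': "0 \<le> s'" "dist (f (\<rho> \<bar>T\<bar>)) (\<sigma>' s') \<le> r'" using r'[of "\<bar>T\<bar>"] by auto
    have "N \<le> s" using T[of "\<bar>T\<bar>" s] s by simp
    moreover have "dist (\<sigma> s) (\<sigma>' s') \<le> r + r'"
      using s s' dist_triangle3[of "\<sigma> s" "\<sigma>' s'" "f (\<rho> \<bar>T\<bar>)"] by simp
    ultimately show ?thesis using s' by blast
  qed
  then have "end_of \<sigma> = end_of \<sigma>'" by (rule B.end_of_eqI[OF \<sigma>(1) \<sigma>'(1)])
  then show ?thesis using \<sigma> \<sigma>' by simp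
qed

end

section \<open>The boundary map of a coarse equivalence\<close>

context tree_pair
begin

text \<open>
  With at least three ends, the image of \<open>u\<close> is the common end of the images of two apartments
  that end in \<open>u\<close>.
\<close>

lemma boundary_map_unique:
  fixes f :: "'a \<Rightarrow> 'b"
  assumes three: "\<exists>u\<in>(ends :: 'a set set set). \<exists>v\<in>ends. \<exists>w\<in>ends. u \<noteq> v \<and> v \<noteq> w \<and> u \<noteq> w"
    and ext: "\<phi> \<in> extensional ends" and bij: "bij_betw \<phi> ends ends"
    and push: "\<And>u v. u \<in> ends \<Longrightarrow> v \<in> ends \<Longrightarrow> u \<noteq> v \<Longrightarrow>
      push_apartment f (apartment_between u v) = apartment_between (\<phi> u) (\<phi> v)"
  shows "boundary_map f = \<phi>"
  unfolding boundary_map_def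
proof (rule the_equality)
  show "\<phi> \<in> extensional ends \<and> bij_betw \<phi> ends ends \<and> (\<forall>u\<in>ends. \<forall>v\<in>ends. u \<noteq> v \<longrightarrow>
      push_apartment f (apartment_between u v) = apartment_between (\<phi> u) (\<phi> v))"
    using ext bij push by blast
next
  fix \<psi> assume \<psi>: "\<psi> \<in> extensional ends \<and> bij_betw \<psi> ends ends \<and> (\<forall>u\<in>ends. \<forall>v\<in>ends. u \<noteq> v \<longrightarrow>
      push_apartment f (apartment_between u v) = apartment_between (\<psi> u) (\<psi> v))"
  have end_pair: "ends_of (apartment_between x y :: 'b set) = {x, y}"
    if "x \<in> ends" "y \<in> ends" "x \<noteq> y" for x y
  proof -
    obtain \<gamma> :: "real \<Rightarrow> 'b" where "line \<gamma> x y" using B.line_exists \<open>x \<in> ends\<close> \<open>y \<in> ends\<close> \<open>x \<noteq> y\<close> by blast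
    then show ?thesis using B.apartment_between_eq B.ends_of_line by simp
  qed
  have in_ends: "\<phi> u \<in> ends" "\<psi> u \<in> ends" if "u \<in> ends" for u
    using that bij \<psi> by (auto intro: bij_betw_apply)
  have inj: "\<phi> u \<noteq> \<phi> v" "\<psi> u \<noteq> \<psi> v" if "u \<in> ends" "v \<in> ends" "u \<noteq> v" for u v
    using that bij \<psi> inj_onD[OF bij_betw_imp_inj_on[of \<phi> ends ends], of u v]
      inj_onD[OF bij_betw_imp_inj_on[of \<psi> ends ends], of u v] by metis+
  have pair: "{\<psi> u, \<psi> v} = {\<phi> u, \<phi> v}" if "u \<in> ends" "v \<in> ends" "u \<noteq> v" for u v
  proof -
    have "apartment_between (\<psi> u) (\<psi> v) = apartment_between (\<phi> u) (\<phi> v)"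
      using push[OF that] \<psi> that by metis
    then show ?thesis
      using end_pair[OF in_ends(1)[OF that(1)] in_ends(1)[OF that(2)] inj(1)[OF that]]
        end_pair[OF in_ends(2)[OF that(1)] in_ends(2)[OF that(2)] inj(2)[OF that]] by simp
  qed
  have "\<psi> u = \<phi> u" if u: "u \<in> ends" for u
  proof -
    obtain v w where "v \<in> ends" "w \<in> ends" "u \<noteq> v" "u \<noteq> w" "v \<noteq> w" using three u by metis
    then show ?thesis
      using pair[of u v] pair[of u w] inj(1)[of v w] u by (metis doubleton_eq_iff)
  qed
  then show "\<psi> = \<phi>" using ext \<psi> by (intro extensionalityI[of _ ends]) auto
qed

lemma boundary_map_homothety:
  assumes h: "isometry_rescaled c (h::'a \<Rightarrow> 'b)" and c: "0 < c"
    and three: "\<exists>u\<in>(ends :: 'a set set set). \<exists>v\<in>ends. \<exists>w\<in>ends. u \<noteq> v \<and> v \<noteq> w \<and> u \<noteq> w"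
  shows "boundary_map h = restrict (end_map h) ends"
proof (rule boundary_map_unique[OF three])
  note inv = isometry_rescaled_inv[OF h c]
  interpret swap: tree_pair TB TA ..
  have "end_map h (end_map (inv_fun h) v) = v" for v
    using end_map_comp[of h "inv_fun h" v] inv end_map_id by simp
  moreover have "end_map (inv_fun h) v \<in> ends" if "v \<in> ends" for v
    using swap.end_map_in_ends[OF inv(1) _ that] c by simp
  ultimately have "v \<in> end_map h ` ends" if "v \<in> ends" for v using that by (metis image_eqI)
  then have "end_map h ` ends = ends" using end_map_in_ends[OF h c] by blast
  moreover have "inj_on (end_map h) ends" by (rule inj_onI) (rule end_map_inj[OF h c])
  ultimately show "bij_betw (restrict (end_map h) ends) ends ends"
    by (simp add: bij_betw_def inj_on_def)
  fix u v :: "'a set set" assume uv: "u \<in> ends" "v \<in> ends" "u \<noteq> v"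
  let ?B = "apartment_between (end_map h u) (end_map h v)"
  have B: "?B = h ` apartment_between u v" by (rule homothety_apartment[OF h c uv])
  obtain \<gamma> :: "real \<Rightarrow> 'a" where \<gamma>: "line \<gamma> u v" using A.line_exists uv by blast
  have ap: "apartment ?B"
    using B.apartment_between_eq[OF homothety_line[OF h c \<gamma>]] homothety_line[OF h c \<gamma>]
    by (auto simp: apartment_def line_def)
  have refl: "finite_Hausdorff_distance ?B (h ` apartment_between u v)"
    unfolding B finite_Hausdorff_distance_def by (intro exI[of _ 0]) auto
  have "push_apartment h (apartment_between u v) = ?B"
    unfolding push_apartment_def
    by (rule the_equality) (use ap refl B.apartment_eq_if_finite_Hausdorff_distance in blast)+
  then show "push_apartment h (apartment_between u v)
      = apartment_between (restrict (end_map h) ends u) (restrict (end_map h) ends v)"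
    using uv by simp
qed simp

end

context coarse_pair
begin

lemma tracks_inverse:
  assumes "tracks u v"
  shows "coarse_pair.tracks g v u"
proof -
  interpret swap: coarse_pair TB TA g f L by (rule swapped)
  have e: "u \<in> ends" "v \<in> ends" using tracks_ends[OF assms] by auto
  obtain \<rho> :: "real \<Rightarrow> 'a" where \<rho>: "geodesic {0..} \<rho>" "end_of \<rho> = u" using A.ends_cases[OF e(1)] .
  obtain \<sigma> :: "real \<Rightarrow> 'b" where \<sigma>: "geodesic {0..} \<sigma>" "end_of \<sigma> = v" using B.ends_cases[OF e(2)] .
  obtain u' where u': "swap.tracks v u'" using swap.tracks_exists[OF e(2)] .
  then have "u' \<in> ends" using swap.tracks_ends by blast
  then obtain \<tau> :: "real \<Rightarrow> 'a" where \<tau>: "geodesic {0..} \<tau>" "end_of \<tau> = u'" using A.ends_cases by blast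
  obtain r where r: "\<And>t. 0 \<le> t \<Longrightarrow> \<exists>s\<ge>0. dist (f (\<rho> t)) (\<sigma> s) \<le> r"
    using tracksD[OF assms \<rho> \<sigma>] by metis
  obtain r' where r': "\<And>t. 0 \<le> t \<Longrightarrow> \<exists>s\<ge>0. dist (g (\<sigma> t)) (\<tau> s) \<le> r'"
    using swap.tracksD[OF u' \<sigma> \<tau>] by metis
  have "\<exists>s\<ge>N. \<exists>t\<ge>0. dist (\<rho> s) (\<tau> t) \<le> L + (L * r + L) + r'" for N
  proof -
    obtain s where s: "0 \<le> s" "dist (f (\<rho> \<bar>N\<bar>)) (\<sigma> s) \<le> r" using r[of "\<bar>N\<bar>"] by auto
    obtain t where t: "0 \<le> t" "dist (g (\<sigma> s)) (\<tau> t) \<le> r'" using r' s by blast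
    have "L * dist (f (\<rho> \<bar>N\<bar>)) (\<sigma> s) \<le> L * r" using s L by (intro mult_left_mono) auto
    then have "dist (\<rho> \<bar>N\<bar>) (\<tau> t) \<le> L + (L * r + L) + r'"
      using gf[of "\<rho> \<bar>N\<bar>"] g_upper[of "f (\<rho> \<bar>N\<bar>)" "\<sigma> s"] t(2)
        dist_triangle2[of "\<rho> \<bar>N\<bar>" "g (\<sigma> s)" "g (f (\<rho> \<bar>N\<bar>))"]
        dist_triangle[of "\<rho> \<bar>N\<bar>" "\<tau> t" "g (\<sigma> s)"]
        dist_commute[of "\<rho> \<bar>N\<bar>" "g (f (\<rho> \<bar>N\<bar>))"] dist_commute[of "g (\<sigma> s)" "g (f (\<rho> \<bar>N\<bar>))"]
      by linarith
    then show ?thesis using t(1) abs_ge_self by blast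
  qed
  then have "end_of \<rho> = end_of \<tau>" by (rule A.end_of_eqI[OF \<rho>(1) \<tau>(1)])
  then show ?thesis using u' \<rho> \<tau> by simp
qed

text \<open>
  The boundary map, described by rays instead of apartments.
\<close>

definition bd :: "'a set set \<Rightarrow> 'b set set" where
  "bd = restrict (\<lambda>u. THE v. tracks u v) ends"

lemma tracks_bd: "u \<in> ends \<Longrightarrow> tracks u (bd u)"
  unfolding bd_def using tracks_exists tracks_unique by (metis restrict_apply' theI)

lemma bd_eq: "tracks u v \<Longrightarrow> bd u = v"
  using tracks_bd tracks_unique tracks_ends by blast

lemma bd_in_ends: "u \<in> ends \<Longrightarrow> bd u \<in> ends"
  using tracks_bd tracks_ends by blast

lemma bd_bij: "bij_betw bd ends ends"
proof -
  interpret swap: coarse_pair TB TA g f L by (rule swapped)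
  have inj: "u = u'" if "u \<in> ends" "u' \<in> ends" "bd u = bd u'" for u u'
    using tracks_inverse[OF tracks_bd[OF that(1)]] tracks_inverse[OF tracks_bd[OF that(2)]]
      swap.tracks_unique that(3) by simp
  have "v \<in> bd ` ends" if "v \<in> ends" for v
  proof -
    have "tracks (swap.bd v) v" using swap.tracks_inverse[OF swap.tracks_bd[OF that]] .
    then show ?thesis using bd_eq swap.bd_in_ends[OF that] by (metis image_eqI)
  qed
  then show ?thesis using inj bd_in_ends by (auto simp: bij_betw_def inj_on_def)
qed

lemma bd_inj: "u \<in> ends \<Longrightarrow> v \<in> ends \<Longrightarrow> bd u = bd v \<Longrightarrow> u = v"
  using bd_bij by (auto simp: bij_betw_def inj_on_def)

lemma bd_surj:
  assumes "v \<in> ends"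
  obtains u where "u \<in> ends" "v = bd u"
  using bd_bij assms unfolding bij_betw_def by blast

context
  fixes \<gamma> \<sigma> u v
  assumes \<gamma>: "line \<gamma> u v" and \<sigma>: "line \<sigma> (bd u) (bd v)"
begin

lemma line_tracked_far:
  obtains r where
    "\<And>t. 0 \<le> t \<Longrightarrow> \<exists>s\<ge>0. dist (f (\<gamma> t)) (\<sigma> s) \<le> r"
    "\<And>t. 0 \<le> t \<Longrightarrow> \<exists>s\<ge>0. dist (f (\<gamma> (- t))) (\<sigma> (- s)) \<le> r"
    "\<And>N. \<exists>t\<ge>0. (\<forall>s\<ge>0. dist (f (\<gamma> t)) (\<sigma> s) \<le> r \<longrightarrow> N \<le> s) \<and>
       (\<forall>s\<ge>0. dist (f (\<gamma> (- t))) (\<sigma> (- s)) \<le> r \<longrightarrow> N \<le> s)"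
proof -
  have e: "u \<in> ends" "v \<in> ends" using A.line_ends[OF \<gamma>] by auto
  note rays = line_rays(1,2)[OF \<gamma>] line_rays(1,2)[OF \<sigma>]
  have "end_of \<gamma> = u" "end_of (\<lambda>t. \<gamma> (- t)) = v" "end_of \<sigma> = bd u" "end_of (\<lambda>t. \<sigma> (- t)) = bd v"
    using \<gamma> \<sigma> by (auto simp: line_def)
  then obtain r1 r2 where 1: "\<And>t. 0 \<le> t \<Longrightarrow> \<exists>s\<ge>0. dist (f (\<gamma> t)) (\<sigma> s) \<le> r1"
      "\<And>t. 0 \<le> t \<Longrightarrow> \<exists>s\<ge>0. dist (f (\<gamma> (- t))) (\<sigma> (- s)) \<le> r2"
    using tracksD[OF tracks_bd[OF e(1)] rays(1) _ rays(3)] tracksD[OF tracks_bd[OF e(2)] rays(2) _ rays(4)]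
    by metis
  define r where "r = max r1 r2"
  have near: "\<exists>s\<ge>0. dist (f (\<gamma> t)) (\<sigma> s) \<le> r" "\<exists>s\<ge>0. dist (f (\<gamma> (- t))) (\<sigma> (- s)) \<le> r"
    if "0 \<le> t" for t
    using 1(1)[OF that] 1(2)[OF that] unfolding r_def by (metis max.coboundedI1 max.coboundedI2)+
  have "\<exists>t\<ge>0. (\<forall>s\<ge>0. dist (f (\<gamma> t)) (\<sigma> s) \<le> r \<longrightarrow> N \<le> s) \<and>
       (\<forall>s\<ge>0. dist (f (\<gamma> (- t))) (\<sigma> (- s)) \<le> r \<longrightarrow> N \<le> s)" for N
  proof -
    obtain T1 where T1: "\<And>t s. T1 \<le> t \<Longrightarrow> 0 \<le> s \<Longrightarrow> dist (f (\<gamma> t)) (\<sigma> s) \<le> r \<Longrightarrow> N \<le> s"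
      using tracked_far[OF rays(1,3)] by metis
    obtain T2 where T2: "\<And>t s. T2 \<le> t \<Longrightarrow> 0 \<le> s \<Longrightarrow> dist (f (\<gamma> (- t))) (\<sigma> (- s)) \<le> r \<Longrightarrow> N \<le> s"
      using tracked_far[OF rays(2,4)] by metis
    show ?thesis
      by (rule exI[of _ "max 0 (max T1 T2)"])
        (use T1[of "max 0 (max T1 T2)"] T2[of "max 0 (max T1 T2)"] in auto)
  qed
  then show thesis using that[of r] near by blast
qed

text \<open>
  The uniform bound comes from coarse betweenness on long pieces of the line; the nonuniform
  bound is only used at their endpoints.
\<close>

lemma line_image_near: "\<exists>s. dist (f (\<gamma> t)) (\<sigma> s) \<le> morse_bound"
proof -
  obtain r where r: "\<And>t. 0 \<le> t \<Longrightarrow> \<exists>s\<ge>0. dist (f (\<gamma> t)) (\<sigma> s) \<le> r"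
    "\<And>t. 0 \<le> t \<Longrightarrow> \<exists>s\<ge>0. dist (f (\<gamma> (- t))) (\<sigma> (- s)) \<le> r"
    using line_tracked_far by metis
  have near: "\<exists>s. dist (f (\<gamma> x)) (\<sigma> s) \<le> r" for x
    using r(1)[of x] r(2)[of "- x"] by (cases "0 \<le> x") auto
  \<comment> \<open>At parameter distance \<open>K\<close>, images are farther apart than the nonuniform bound \<open>r\<close> and
    the error of coarse betweenness together.\<close>
  define K where "K = L * (\<bar>r\<bar> + 1 + morse_bound) + 3 * L"
  have "0 \<le> K" using L morse_bound_pos by (simp add: K_def)
  have "dist (\<gamma> (t - K)) (\<gamma> t) + dist (\<gamma> t) (\<gamma> (t + K)) = dist (\<gamma> (t - K)) (\<gamma> (t + K))"
    using \<open>0 \<le> K\<close> by (simp add: line_dist[OF \<gamma>])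
  then obtain q where q: "dist (f (\<gamma> (t - K))) q + dist q (f (\<gamma> (t + K)))
      = dist (f (\<gamma> (t - K))) (f (\<gamma> (t + K)))" "dist (f (\<gamma> t)) q \<le> morse_bound"
    using morse by blast
  obtain a b where ab: "dist (f (\<gamma> (t - K))) (\<sigma> a) \<le> r" "dist (f (\<gamma> (t + K))) (\<sigma> b) \<le> r"
    using near by metis
  have "\<bar>r\<bar> + 1 + morse_bound \<le> dist (f (\<gamma> (t - K))) (f (\<gamma> t))" "\<bar>r\<bar> + 1 + morse_bound \<le> dist (f (\<gamma> (t + K))) (f (\<gamma> t))"
    using \<open>0 \<le> K\<close> by (intro dist_image_ge; simp add: line_dist[OF \<gamma>] K_def)+
  then have "dist (f (\<gamma> (t - K))) (\<sigma> a) < dist (f (\<gamma> (t - K))) q"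
    "dist (f (\<gamma> (t + K))) (\<sigma> b) < dist (f (\<gamma> (t + K))) q"
    using ab q(2) dist_triangle2[of "f (\<gamma> (t - K))" "f (\<gamma> t)" q]
      dist_triangle2[of "f (\<gamma> (t + K))" "f (\<gamma> t)" q] by linarith+
  then have "dist (\<sigma> a) q + dist q (\<sigma> b) = dist (\<sigma> a) (\<sigma> b)"
    by (rule B.between_close_endpoints[OF q(1)])
  then obtain s where "q = \<sigma> s" using B.line_convex[OF \<sigma>] by blast
  then show ?thesis using q(2) by blast
qed

lemma line_near_image: "\<exists>t. dist (f (\<gamma> t)) (\<sigma> s) \<le> 2 * L"
proof -
  obtain r where near: "\<And>t. 0 \<le> t \<Longrightarrow> \<exists>s\<ge>0. dist (f (\<gamma> t)) (\<sigma> s) \<le> r"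
    "\<And>t. 0 \<le> t \<Longrightarrow> \<exists>s\<ge>0. dist (f (\<gamma> (- t))) (\<sigma> (- s)) \<le> r"
    and far: "\<And>N. \<exists>t\<ge>0. (\<forall>s\<ge>0. dist (f (\<gamma> t)) (\<sigma> s) \<le> r \<longrightarrow> N \<le> s) \<and>
       (\<forall>s\<ge>0. dist (f (\<gamma> (- t))) (\<sigma> (- s)) \<le> r \<longrightarrow> N \<le> s)"
    using line_tracked_far by metis
  obtain t where t: "0 \<le> t"
    "\<And>s'. 0 \<le> s' \<Longrightarrow> dist (f (\<gamma> t)) (\<sigma> s') \<le> r \<Longrightarrow> \<bar>s\<bar> + \<bar>r\<bar> + 1 \<le> s'"
    "\<And>s'. 0 \<le> s' \<Longrightarrow> dist (f (\<gamma> (- t))) (\<sigma> (- s')) \<le> r \<Longrightarrow> \<bar>s\<bar> + \<bar>r\<bar> + 1 \<le> s'"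
    using far by blast
  obtain a where a: "0 \<le> a" "dist (f (\<gamma> t)) (\<sigma> a) \<le> r" using near(1) t by blast
  obtain b where b: "0 \<le> b" "dist (f (\<gamma> (- t))) (\<sigma> (- b)) \<le> r" using near(2) t by blast
  have ab: "\<bar>s\<bar> + \<bar>r\<bar> + 1 \<le> a" "\<bar>s\<bar> + \<bar>r\<bar> + 1 \<le> b" using t(2)[OF a] t(3)[OF b] by auto
  have "dist (f (\<gamma> (- t))) (\<sigma> s) + dist (\<sigma> s) (f (\<gamma> t)) = dist (f (\<gamma> (- t))) (f (\<gamma> t))"
    by (rule B.between_close_endpoints[of "\<sigma> (- b)" _ "\<sigma> a"])
      (use a b ab in \<open>auto simp: line_dist[OF \<sigma>] dist_commute\<close>)
  then obtain x where x: "dist (\<gamma> (- t)) x + dist x (\<gamma> t) = dist (\<gamma> (- t)) (\<gamma> t)"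
    "dist (\<sigma> s) (f x) \<le> 2 * L" using segment_near_image by blast
  from A.line_convex[OF \<gamma> x(1)] obtain t' where "x = \<gamma> t'" by blast
  then show ?thesis using x(2) by (auto simp: dist_commute)
qed

end

lemma push_apartment_bd:
  assumes "u \<in> ends" "v \<in> ends" "u \<noteq> v"
  shows "push_apartment f (apartment_between u v) = apartment_between (bd u) (bd v)"
proof -
  obtain \<gamma> :: "real \<Rightarrow> 'a" where \<gamma>: "line \<gamma> u v" using A.line_exists assms by blast
  have "bd u \<noteq> bd v" using bd_inj assms by blast
  then obtain \<sigma> :: "real \<Rightarrow> 'b" where \<sigma>: "line \<sigma> (bd u) (bd v)"
    using B.line_exists bd_in_ends assms by blast
  have fH: "finite_Hausdorff_distance (range \<sigma>) (f ` range \<gamma>)"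
    unfolding finite_Hausdorff_distance_def
  proof (intro exI[of _ "max morse_bound (2 * L)"] conjI ballI)
    fix x assume "x \<in> range \<sigma>"
    then obtain s where "x = \<sigma> s" by blast
    then obtain t where "dist (f (\<gamma> t)) x \<le> 2 * L" using line_near_image[OF \<gamma> \<sigma>] by blast
    then show "\<exists>y\<in>f ` range \<gamma>. dist x y \<le> max morse_bound (2 * L)"
      by (intro bexI[of _ "f (\<gamma> t)"]) (auto simp: dist_commute)
  next
    fix y assume "y \<in> f ` range \<gamma>"
    then obtain t where "y = f (\<gamma> t)" by blast
    then obtain s where "dist y (\<sigma> s) \<le> morse_bound" using line_image_near[OF \<gamma> \<sigma>] by blast
    then show "\<exists>x\<in>range \<sigma>. dist x y \<le> max morse_bound (2 * L)"
      by (intro bexI[of _ "\<sigma> s"]) (auto simp: dist_commute)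
  qed
  have ap: "apartment (range \<sigma>)" using \<sigma> by (auto simp: apartment_def line_def)
  have "push_apartment f (range \<gamma>) = range \<sigma>"
    unfolding push_apartment_def
    by (rule the_equality) (use ap fH B.apartment_eq_if_finite_Hausdorff_distance in blast)+
  then show ?thesis using A.apartment_between_eq[OF \<gamma>] B.apartment_between_eq[OF \<sigma>] by simp
qed

lemma boundary_map_eq_bd:
  assumes "\<exists>u\<in>(ends :: 'a set set set). \<exists>v\<in>ends. \<exists>w\<in>ends. u \<noteq> v \<and> v \<noteq> w \<and> u \<noteq> w"
  shows "boundary_map f = bd"
proof (rule boundary_map_unique[OF assms])
qed (use bd_bij push_apartment_bd in \<open>auto simp: bd_def\<close>)

lemma center_image_close:
  assumes z: "center z u v w" and z': "center z' (bd u) (bd v) (bd w)"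
  shows "dist (f z) z' \<le> 3 * morse_bound"
proof -
  have near: "\<exists>q\<in>apartment_between (bd x) (bd y). dist (f z) q \<le> morse_bound"
    if xy: "x \<in> ends" "y \<in> ends" "x \<noteq> y" "z \<in> apartment_between x y" for x y
  proof -
    obtain \<gamma> where \<gamma>: "line \<gamma> x y" "\<gamma> 0 = z" using A.apartment_between_obtain xy by metis
    have "bd x \<noteq> bd y" using bd_inj xy by blast
    then obtain \<sigma> :: "real \<Rightarrow> 'b" where \<sigma>: "line \<sigma> (bd x) (bd y)"
      using B.line_exists bd_in_ends xy by blast
    show ?thesis
      using line_image_near[OF \<gamma>(1) \<sigma>, of 0] \<gamma>(2) B.apartment_between_eq[OF \<sigma>] by auto
  qed
  obtain q1 q2 q3 where "q1 \<in> apartment_between (bd u) (bd v)" "dist (f z) q1 \<le> morse_bound"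
    "q2 \<in> apartment_between (bd v) (bd w)" "dist (f z) q2 \<le> morse_bound"
    "q3 \<in> apartment_between (bd u) (bd w)" "dist (f z) q3 \<le> morse_bound"
    using near[of u v] near[of v w] near[of u w] z unfolding center_def by metis
  then show ?thesis using B.close_to_center[OF z'] by blast
qed

end

section \<open>Shifts under compatible isometries\<close>

lemma le_if_multiples_le:
  fixes x y C :: real
  assumes "\<And>n::nat. real n * x \<le> real n * y + C"
  shows "x \<le> y"
proof (rule ccontr)
  assume "\<not> x \<le> y"
  then have "0 < x - y" by simp
  then obtain n :: nat where "C < real n * (x - y)" using reals_Archimedean3 by blast
  then show False using assms[of n] by (simp add: algebra_simps)
qed

text \<open>
  The numbers are the values of two additive functions, the second one Lipschitz with respect
  to the first. With \<open>m\<close> the integer part of \<open>n * y / x\<close> the right-hand side of the hypothesis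
  stays bounded, and dividing by \<open>n\<close> gives the claim.
\<close>

lemma proportional_if_lipschitz:
  fixes x x' y y' L :: real
  assumes lip: "\<And>m n::nat. \<bar>real m * x' - real n * y'\<bar> \<le> L * \<bar>real m * x - real n * y\<bar>"
    and x: "0 < x" and y: "0 \<le> y"
  shows "y' * x = x' * y"
proof -
  \<comment> \<open>The hypothesis implies that the Lipschitz constant is nonnegative.\<close>
  have "0 \<le> L * \<bar>x\<bar>" using lip[of 1 0] order_trans[OF abs_ge_zero] by fastforce
  then have L: "0 \<le> L" using x by (simp add: zero_le_mult_iff)
  have "real n * \<bar>y / x * x' - y'\<bar> \<le> real n * 0 + (\<bar>x'\<bar> + L * x)" for n
  proof -
    define q where "q = real n * y / x"
    define m where "m = nat \<lfloor>q\<rfloor>"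
    have "0 \<le> q" using x y by (simp add: q_def)
    then have m: "real m \<le> q" "q \<le> real m + 1" unfolding m_def by linarith+
    have "q * x = real n * y" using x by (simp add: q_def)
    then have "real m * x - real n * y = (real m - q) * x" by (simp add: algebra_simps)
    then have "\<bar>real m * x - real n * y\<bar> \<le> 1 * x"
      using m x by (simp add: abs_mult) 
    then have 1: "\<bar>real m * x' - real n * y'\<bar> \<le> L * x"
      using lip[of m n] mult_left_mono[OF _ L, of "\<bar>real m * x - real n * y\<bar>" x] by simp
    have "\<bar>(q - real m) * x'\<bar> \<le> 1 * \<bar>x'\<bar>"
      using m unfolding abs_mult by (intro mult_right_mono) auto
    moreover have "q * x' - real n * y' = (q - real m) * x' + (real m * x' - real n * y')"
      by (simp add: algebra_simps)
    ultimately have "\<bar>q * x' - real n * y'\<bar> \<le> \<bar>x'\<bar> + L * x" using 1 by linarith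
    moreover have "q * x' - real n * y' = real n * (y / x * x' - y')"
      by (simp add: q_def algebra_simps)
    ultimately show ?thesis by (simp add: abs_mult)
  qed
  then have "\<bar>y / x * x' - y'\<bar> \<le> 0" by (rule le_if_multiples_le)
  then show ?thesis using x by (simp add: field_simps)
qed

lemma isometry_id: "isometry id"
  by (simp add: isometry_rescaled_def)

lemma isometry_pow: "isometry g \<Longrightarrow> isometry (g ^^ n)"
  by (induction n) (auto simp: isometry_id[unfolded id_def] id_def intro: isometry_comp)

lemma end_map_pow: "end_map g u = u \<Longrightarrow> end_map (g ^^ n) u = u"
  by (induction n) (auto simp: end_map_id simp flip: end_map_comp)

context leafless_tree
begin

lemma shift_pow:
  assumes "isometry g" "u \<in> ends" "end_map g u = u"
  shows "shift (g ^^ n) u = real n * shift (g::'a \<Rightarrow> 'a) u"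
proof (induction n)
  case 0
  then show ?case using busemann_self[OF assms(2)] by (simp add: shift_def)
next
  case (Suc n)
  have "shift (g ^^ Suc n) u = shift g u + shift (g ^^ n) u"
    unfolding funpow.simps(2) by (rule shift_comp) (simp_all add: assms isometry_pow end_map_pow)
  then show ?case using Suc by (simp only: of_nat_Suc distrib_right mult_1)
qed

lemma apartment_translate:
  assumes "u \<in> ends" "v \<in> ends" "u \<noteq> v" "(z::'a) \<in> apartment_between u v"
    and g: "isometry g" "end_map g u = u" "end_map g v = v"
  shows "(g ^^ n) z \<in> apartment_between u v" "busemann u z ((g ^^ n) z) = real n * shift g u"
    "dist z ((g ^^ n) z) = real n * \<bar>shift g u\<bar>"
proof -
  have g': "isometry (g ^^ n)" "end_map (g ^^ n) u = u" "end_map (g ^^ n) v = v"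
    using g by (simp_all add: isometry_pow end_map_pow)
  show 1: "(g ^^ n) z \<in> apartment_between u v"
    using isometry_apartment[OF g'(1) assms(1-3)] g' assms(4) by auto
  show 2: "busemann u z ((g ^^ n) z) = real n * shift g u"
    using shift_eq[OF g'(1) assms(1) g'(2)] shift_pow[OF g(1) assms(1) g(2)] by simp
  show "dist z ((g ^^ n) z) = real n * \<bar>shift g u\<bar>"
    using busemann_apartment(2)[OF assms(1-4) 1] 2 by (simp add: abs_mult)
qed

lemma dist_attained:
  obtains u where "u \<in> ends" "busemann u p q = dist p (q::'a)"
proof -
  obtain \<gamma> :: "real \<Rightarrow> 'a" and u v where \<gamma>: "line \<gamma> u v" "\<gamma> 0 = p" "\<gamma> (dist p q) = q"
    using line_through .
  then show thesis
    using that[of u] busemann_line(1)[OF \<gamma>(1), of 0 "dist p q"] line_ends[OF \<gamma>(1)] by simp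
qed

end

context coarse_pair
begin

text \<open>
  A pair of isometries that induce corresponding maps of the ends. In the main theorem such
  pairs come from the elements of the group; they are closed under composition and inverses,
  which is how the group structure enters.
\<close>

definition compat :: "('a \<Rightarrow> 'a) \<Rightarrow> ('b \<Rightarrow> 'b) \<Rightarrow> bool" where
  "compat a b \<longleftrightarrow> isometry a \<and> isometry b \<and>
     (\<forall>u\<in>ends. bd (end_map a u) = end_map b (bd u))"

lemma compatD:
  assumes "compat a b"
  shows "isometry a" "isometry b" "\<And>u. u \<in> ends \<Longrightarrow> bd (end_map a u) = end_map b (bd u)"
    "\<And>u. u \<in> ends \<Longrightarrow> end_map a u \<in> ends"
  using assms A.isometry_end unfolding compat_def by auto

lemma compat_comp: "compat a b \<Longrightarrow> compat a' b' \<Longrightarrow> compat (a \<circ> a') (b \<circ> b')"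
  unfolding compat_def by (simp add: isometry_comp A.isometry_end flip: end_map_comp)

lemma compat_id: "compat id id"
  unfolding compat_def by (simp add: isometry_id end_map_id)

lemma compat_pow: "compat a b \<Longrightarrow> compat (a ^^ n) (b ^^ n)"
  by (induction n) (auto simp: compat_id[unfolded id_def] id_def intro: compat_comp)

lemma compat_inv:
  assumes "compat a b"
  shows "compat (inv_fun a) (inv_fun b)"
proof -
  note ab = compatD[OF assms]
  have "bd (end_map (inv_fun a) u) = end_map (inv_fun b) (bd u)" if "u \<in> ends" for u
  proof -
    have e: "end_map (inv_fun a) u \<in> ends" using A.isometry_end[OF isometry_inv[OF ab(1)] that] .
    have "end_map a (end_map (inv_fun a) u) = u"
      using end_map_comp[of a "inv_fun a" u] isometry_rescaled_inv(3)[OF ab(1)] by (simp add: end_map_id)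
    then have "end_map b (bd (end_map (inv_fun a) u)) = bd u" using ab(3)[OF e] by simp
    then have "end_map (inv_fun b) (bd u) = end_map (inv_fun b \<circ> b) (bd (end_map (inv_fun a) u))"
      by (simp flip: end_map_comp)
    then show ?thesis using isometry_rescaled_inv(2)[OF ab(2)] by (simp add: end_map_id)
  qed
  then show ?thesis using ab by (simp add: compat_def isometry_inv)
qed

definition matched :: "'a set set \<Rightarrow> 'a set set \<Rightarrow> 'a set set \<Rightarrow> 'a \<Rightarrow> 'b \<Rightarrow> bool" where
  "matched u v w z z' \<longleftrightarrow> center z u v w \<and> center z' (bd u) (bd v) (bd w)"

lemma matched_commute:
  assumes "matched u v w z z'"
  shows "matched v u w z z'" "matched u w v z z'" "matched w v u z z'" "matched v w u z z'"
    "matched w u v z z'"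
  using assms A.center_commute[of z u v w] B.center_commute[of z' "bd u" "bd v" "bd w"]
  unfolding matched_def by simp_all

lemma matched_exists:
  assumes "u \<in> ends" "v \<in> ends" "w \<in> ends" "u \<noteq> v" "v \<noteq> w" "u \<noteq> w"
  obtains z z' where "matched u v w z z'"
proof -
  obtain z :: 'a where "center z u v w" using A.center_exists assms by blast
  moreover have "bd u \<noteq> bd v" "bd v \<noteq> bd w" "bd u \<noteq> bd w" using bd_inj assms by blast+
  then obtain z' :: 'b where "center z' (bd u) (bd v) (bd w)"
    using B.center_exists bd_in_ends assms by metis
  ultimately show thesis using that unfolding matched_def by blast
qed

lemma matched_compat:
  assumes "compat a b" "matched u v w z z'"
  shows "matched (end_map a u) (end_map a v) (end_map a w) (a z) (b z')"
proof -
  note D = compatD[OF assms(1)]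
  have z: "center z u v w" "center z' (bd u) (bd v) (bd w)" using assms(2) by (auto simp: matched_def)
  then have "u \<in> ends" "v \<in> ends" "w \<in> ends" by (auto simp: center_def)
  then show ?thesis
    using A.isometry_center[OF D(1) z(1)] B.isometry_center[OF D(2) z(2)] D(3)
    by (simp add: matched_def)
qed

lemma matchedD:
  assumes "matched u v w z z'"
  shows "u \<in> ends" "v \<in> ends" "w \<in> ends" "u \<noteq> v" "v \<noteq> w" "u \<noteq> w"
    "bd u \<in> ends" "bd v \<in> ends" "bd w \<in> ends" "bd u \<noteq> bd v" "bd v \<noteq> bd w" "bd u \<noteq> bd w"
    "center z u v w" "center z' (bd u) (bd v) (bd w)"
    "z \<in> apartment_between u v" "z' \<in> apartment_between (bd u) (bd v)"
  using assms unfolding matched_def center_def by blast+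

lemma matched_close: "matched u v w z z' \<Longrightarrow> dist (f z) z' \<le> 3 * morse_bound"
  unfolding matched_def using center_image_close by blast

end

locale two_transitive_pair = coarse_pair +
  assumes three: "\<exists>u\<in>(ends :: 'a set set set). \<exists>v\<in>ends. \<exists>w\<in>ends. u \<noteq> v \<and> v \<noteq> w \<and> u \<noteq> w"
    and transitive: "u \<in> ends \<Longrightarrow> v \<in> ends \<Longrightarrow> u \<noteq> v \<Longrightarrow> u' \<in> ends \<Longrightarrow> v' \<in> ends \<Longrightarrow> u' \<noteq> v' \<Longrightarrow>
      \<exists>a b. compat a b \<and> end_map a u = u' \<and> end_map a v = v'"
begin

lemma third_end:
  obtains w :: "'a set set" where "w \<in> ends" "w \<noteq> u" "w \<noteq> v"
  using three by metis

context
  fixes a b u v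
  assumes ab: "compat a b" and uv: "u \<in> ends" "v \<in> ends" "u \<noteq> v"
    and fixed: "end_map a u = u" "end_map a v = v"
begin

lemma fixed_image: "end_map b (bd u) = bd u" "end_map b (bd v) = bd v"
  using compatD(3)[OF ab] uv fixed by metis+

lemma translates_matched:
  obtains z z' where "z \<in> apartment_between u v" "z' \<in> apartment_between (bd u) (bd v)"
    "\<And>n. dist (f ((a ^^ n) z)) ((b ^^ n) z') \<le> 3 * morse_bound"
proof -
  obtain w where w: "w \<in> ends" "w \<noteq> u" "w \<noteq> v" using third_end .
  then obtain z z' where m: "matched u v w z z'" using matched_exists uv by metis
  have "dist (f ((a ^^ n) z)) ((b ^^ n) z') \<le> 3 * morse_bound" for n
    using matched_close[OF matched_compat[OF compat_pow[OF ab] m]] .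
  then show thesis using that matchedD(15,16)[OF m] by blast
qed

text \<open>
  \<open>f\<close> maps the translates of a center close to the translates of the matched center, so the
  displacements after \<open>n\<close> steps are comparable with constants that do not depend on \<open>n\<close>.
\<close>

lemma shift_lipschitz:
  shows "\<bar>shift b (bd u)\<bar> \<le> L * \<bar>shift a u\<bar>" "\<bar>shift a u\<bar> \<le> L * \<bar>shift b (bd u)\<bar>"
proof -
  obtain z z' where z: "z \<in> apartment_between u v" "z' \<in> apartment_between (bd u) (bd v)"
    "\<And>n. dist (f ((a ^^ n) z)) ((b ^^ n) z') \<le> 3 * morse_bound" using translates_matched by metis
  have uv': "bd u \<in> ends" "bd v \<in> ends" "bd u \<noteq> bd v" using uv bd_in_ends bd_inj by blast+
  have 1: "dist z ((a ^^ n) z) = real n * \<bar>shift a u\<bar>" for n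
    using A.apartment_translate(3)[OF uv z(1) compatD(1)[OF ab] fixed] .
  have 2: "dist z' ((b ^^ n) z') = real n * \<bar>shift b (bd u)\<bar>" for n
    using B.apartment_translate(3)[OF uv' z(2) compatD(2)[OF ab] fixed_image] .
  have 3: "\<bar>dist (f z) (f ((a ^^ n) z)) - dist z' ((b ^^ n) z')\<bar> \<le> 6 * morse_bound" for n
    using z(3)[of n] z(3)[of 0] dist_triangle2[of "f z" "f ((a ^^ n) z)" "(b ^^ n) z'"]
      dist_triangle[of "f z" "(b ^^ n) z'" z'] dist_triangle3[of z' "(b ^^ n) z'" "f z"]
      dist_triangle[of "f z" "(b ^^ n) z'" "f ((a ^^ n) z)"] by simp
  show "\<bar>shift b (bd u)\<bar> \<le> L * \<bar>shift a u\<bar>"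
  proof (rule le_if_multiples_le[of _ _ "6 * morse_bound + L"])
    fix n
    show "real n * \<bar>shift b (bd u)\<bar> \<le> real n * (L * \<bar>shift a u\<bar>) + (6 * morse_bound + L)"
      using f_upper[of z "(a ^^ n) z"] 3[of n] unfolding 1 2 by (simp add: mult.left_commute)
  qed
  show "\<bar>shift a u\<bar> \<le> L * \<bar>shift b (bd u)\<bar>"
  proof (rule le_if_multiples_le[of _ _ "L * (6 * morse_bound) + 3 * L"])
    fix n
    have "dist (f z) (f ((a ^^ n) z)) \<le> real n * \<bar>shift b (bd u)\<bar> + 6 * morse_bound" using 3[of n] 2 by simp
    then have "L * dist (f z) (f ((a ^^ n) z)) \<le> L * (real n * \<bar>shift b (bd u)\<bar> + 6 * morse_bound)"
      using L by (intro mult_left_mono) auto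
    then show "real n * \<bar>shift a u\<bar> \<le> real n * (L * \<bar>shift b (bd u)\<bar>) + (L * (6 * morse_bound) + 3 * L)"
      using f_lower[of z "(a ^^ n) z"] unfolding 1 by (simp add: algebra_simps)
  qed
qed

text \<open>
  Translates of a center towards \<open>u\<close> have images near a ray to \<open>bd u\<close>, so the translates of the
  matched center do not move away from \<open>bd u\<close>.
\<close>

lemma shift_same_sign:
  assumes pos: "0 < shift a u"
  shows "0 \<le> shift b (bd u)"
proof -
  obtain z z' where z: "z \<in> apartment_between u v" "z' \<in> apartment_between (bd u) (bd v)"
    "\<And>n. dist (f ((a ^^ n) z)) ((b ^^ n) z') \<le> 3 * morse_bound" using translates_matched by metis
  have uv': "bd u \<in> ends" "bd v \<in> ends" "bd u \<noteq> bd v" using uv bd_in_ends bd_inj by blast+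
  obtain \<gamma> where \<gamma>: "line \<gamma> u v" "\<gamma> 0 = z" using A.apartment_between_obtain[OF z(1) uv] .
  obtain \<sigma> :: "real \<Rightarrow> 'b" where \<sigma>: "geodesic {0..} \<sigma>" "end_of \<sigma> = bd u" using B.ends_cases[OF uv'(1)] .
  have "end_of \<gamma> = u" using \<gamma> by (simp add: line_def)
  then obtain r where r: "\<And>t. 0 \<le> t \<Longrightarrow> \<exists>s\<ge>0. dist (f (\<gamma> t)) (\<sigma> s) \<le> r"
    using tracksD[OF tracks_bd[OF uv(1)] line_rays(1)[OF \<gamma>(1)] _ \<sigma>] by metis
  define C where "C = dist z' (\<sigma> 0) + r + 3 * morse_bound"
  have "real n * 0 \<le> real n * shift b (bd u) + C" for n
  proof -
    note tr = A.apartment_translate[OF uv z(1) compatD(1)[OF ab] fixed, of n]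
    let ?t = "real n * shift a u"
    have "(a ^^ n) z = \<gamma> ?t"
    proof -
      have "\<gamma> ?t \<in> apartment_between u v" using A.apartment_between_eq[OF \<gamma>(1)] by simp
      moreover have "busemann u z (\<gamma> ?t) = ?t" using A.busemann_line(1)[OF \<gamma>(1), of 0 ?t] \<gamma>(2) by simp
      ultimately have "dist ((a ^^ n) z) (\<gamma> ?t) = 0"
        using A.busemann_apartment(2)[OF uv tr(1)] tr(2)
          A.busemann_cocycle[OF uv(1), of z "(a ^^ n) z" "\<gamma> ?t"] by simp
      then show ?thesis by simp
    qed
    then obtain s where s: "0 \<le> s" "dist (f ((a ^^ n) z)) (\<sigma> s) \<le> r"
      using r[of ?t] pos by auto
    have "dist ((b ^^ n) z') (\<sigma> s) \<le> r + 3 * morse_bound"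
      using s(2) z(3)[of n] dist_triangle3[of "(b ^^ n) z'" "\<sigma> s" "f ((a ^^ n) z)"] by simp
    moreover have "busemann (bd u) (\<sigma> 0) (\<sigma> s) = s" using B.busemann_ray[OF \<sigma>(1), of 0 s] \<sigma>(2) s by simp
    moreover have "busemann (bd u) z' ((b ^^ n) z') = real n * shift b (bd u)"
      using B.apartment_translate(2)[OF uv' z(2) compatD(2)[OF ab] fixed_image] .
    ultimately show ?thesis
      using B.busemann_cocycle[OF uv'(1), of z' "\<sigma> 0" "\<sigma> s"] B.busemann_le_dist[OF uv'(1), of z' "\<sigma> 0"]
        B.busemann_cocycle[OF uv'(1), of z' "(b ^^ n) z'" "\<sigma> s"]
        B.busemann_le_dist[OF uv'(1), of "(b ^^ n) z'" "\<sigma> s"] s(1) by (simp add: C_def)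
  qed
  then show ?thesis by (rule le_if_multiples_le)
qed

end

lemma shifts_inv:
  assumes "compat a b" "u \<in> ends" "end_map a u = u"
  shows "end_map (inv_fun a) u = u" "shift (inv_fun a) u = - shift a u"
    "shift (inv_fun b) (bd u) = - shift b (bd u)"
proof -
  have "end_map b (bd u) = bd u" using compatD(3)[OF assms(1,2)] assms(3) by simp
  then show "end_map (inv_fun a) u = u" "shift (inv_fun a) u = - shift a u"
    "shift (inv_fun b) (bd u) = - shift b (bd u)"
    using A.shift_inv[OF compatD(1)[OF assms(1)] assms(2,3)]
      B.shift_inv[OF compatD(2)[OF assms(1)] bd_in_ends[OF assms(2)]] by auto
qed

lemma shifts_proportional:
  assumes ab: "compat a b" and ab': "compat a' b'" and uv: "u \<in> ends" "v \<in> ends" "u \<noteq> v"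
    and fixed: "end_map a u = u" "end_map a v = v" "end_map a' u = u" "end_map a' v = v"
  shows "shift b' (bd u) * shift a u = shift b (bd u) * shift a' u"
proof -
  have main: "shift b' (bd u) * shift a u = shift b (bd u) * shift a' u"
    if ab: "compat a b" and ab': "compat a' b'"
    and fixed: "end_map a u = u" "end_map a v = v" "end_map a' u = u" "end_map a' v = v"
    and pos: "0 < shift a u" "0 \<le> shift a' u" for a b a' b'
  proof (rule proportional_if_lipschitz[OF _ pos])
    fix m n
    let ?c = "a ^^ m \<circ> inv_fun a' ^^ n" and ?d = "b ^^ m \<circ> inv_fun b' ^^ n"
    note D = compatD[OF ab] compatD[OF ab']
    have fixed': "end_map (inv_fun a') u = u" "end_map (inv_fun a') v = v"
      using shifts_inv(1)[OF ab'] uv fixed by auto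
    have fixed_b: "end_map b (bd u) = bd u" "end_map (inv_fun b') (bd u) = bd u"
      using D(3)[OF uv(1)] compatD(3)[OF compat_inv[OF ab'] uv(1)] fixed fixed' by auto
    have "compat ?c ?d" using ab ab' by (intro compat_comp compat_pow compat_inv)
    moreover have "end_map ?c u = u" "end_map ?c v = v"
      using fixed fixed' by (auto simp: end_map_pow simp flip: end_map_comp)
    ultimately have "\<bar>shift ?d (bd u)\<bar> \<le> L * \<bar>shift ?c u\<bar>" using shift_lipschitz(1) uv by blast
    moreover have "shift ?c u = real m * shift a u - real n * shift a' u"
      using A.shift_comp[OF isometry_pow[OF D(1)] isometry_pow[OF isometry_inv[OF D(5)]] uv(1), of m n]
        A.shift_pow[OF D(1) uv(1) fixed(1)] A.shift_pow[OF isometry_inv[OF D(5)] uv(1) fixed'(1)]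
        end_map_pow[OF fixed(1)] end_map_pow[OF fixed'(1)] shifts_inv(2)[OF ab' uv(1) fixed(3)] by simp
    moreover have "shift ?d (bd u) = real m * shift b (bd u) - real n * shift b' (bd u)"
      using B.shift_comp[OF isometry_pow[OF D(2)] isometry_pow[OF isometry_inv[OF D(6)]]
          bd_in_ends[OF uv(1)], of m n]
        B.shift_pow[OF D(2) bd_in_ends[OF uv(1)] fixed_b(1)]
        B.shift_pow[OF isometry_inv[OF D(6)] bd_in_ends[OF uv(1)] fixed_b(2)]
        end_map_pow[OF fixed_b(1)] end_map_pow[OF fixed_b(2)] shifts_inv(3)[OF ab' uv(1) fixed(3)] by simp
    ultimately show "\<bar>real m * shift b (bd u) - real n * shift b' (bd u)\<bar>
        \<le> L * \<bar>real m * shift a u - real n * shift a' u\<bar>" by simp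
  qed
  have pos: "shift b' (bd u) * shift a u = shift b (bd u) * shift a' u"
    if ab: "compat a b" and ab': "compat a' b'"
    and fixed: "end_map a u = u" "end_map a v = v" "end_map a' u = u" "end_map a' v = v"
    and pos: "0 < shift a u" for a b a' b'
  proof (cases "0 \<le> shift a' u")
    case True
    then show ?thesis using main[OF ab ab' fixed pos] by simp
  next
    case False
    then show ?thesis
      using main[OF ab compat_inv[OF ab'] fixed(1,2) _ _ pos] shifts_inv[OF ab' uv(1) fixed(3)]
        shifts_inv(1)[OF ab' uv(2) fixed(4)] by simp
  qed
  consider "0 < shift a u" | "shift a u < 0" | "shift a u = 0" by linarith
  then show ?thesis
  proof cases
    case 1
    then show ?thesis using pos[OF ab ab' fixed] by simp
  next
    case 2
    then show ?thesis
      using pos[OF compat_inv[OF ab] ab' _ _ fixed(3,4)] shifts_inv[OF ab uv(1) fixed(1)]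
        shifts_inv(1)[OF ab uv(2) fixed(2)] by simp
  next
    case 3
    then show ?thesis using shift_lipschitz(1)[OF ab uv fixed(1,2)] by simp
  qed
qed

text \<open>
  An axis in either tree provides a second fixed end, because the boundary map transports fixed
  ends.
\<close>

lemma second_fixed_end:
  assumes ab: "compat a b" and u: "u \<in> ends" "end_map a u = u"
    and nz: "shift a u \<noteq> 0 \<or> shift b (bd u) \<noteq> 0"
  obtains v where "v \<in> ends" "u \<noteq> v" "end_map a v = v"
  using nz
proof
  assume "shift a u \<noteq> 0"
  then show thesis using A.axis[OF compatD(1)[OF ab] u] that by metis
next
  assume nz: "shift b (bd u) \<noteq> 0"
  have "end_map b (bd u) = bd u" using compatD(3)[OF ab u(1)] u(2) by simp
  then obtain v' where v': "v' \<in> ends" "v' \<noteq> bd u" "end_map b v' = v'"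
    using B.axis[OF compatD(2)[OF ab] bd_in_ends[OF u(1)] _ nz] by metis
  obtain v where v: "v \<in> ends" "v' = bd v" using bd_surj[OF v'(1)] .
  then have "bd (end_map a v) = bd v" using compatD(3)[OF ab v(1)] v' by simp
  then have "end_map a v = v" using bd_inj compatD(4)[OF ab v(1)] v(1) by blast
  then show thesis using that v v' by blast
qed

lemma shifts_conj:
  assumes ab: "compat a b" and kl: "compat k l" and u: "u \<in> ends" "end_map a u = u"
  defines "a' \<equiv> k \<circ> a \<circ> inv_fun k" and "b' \<equiv> l \<circ> b \<circ> inv_fun l"
  shows "compat a' b'" "end_map a' (end_map k u) = end_map k u"
    "shift a' (end_map k u) = shift a u" "shift b' (bd (end_map k u)) = shift b (bd u)"
proof -
  note D = compatD[OF ab] compatD[OF kl]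
  show "compat a' b'" unfolding a'_def b'_def using ab kl by (intro compat_comp compat_inv)
  have "a' \<circ> k = k \<circ> a" unfolding a'_def
    using isometry_rescaled_inv(2)[OF D(5)] by (simp add: comp_assoc)
  then show "end_map a' (end_map k u) = end_map k u"
    using u(2) by (metis end_map_comp)
  show "shift a' (end_map k u) = shift a u"
    by (rule A.shift_conj[OF D(1,5) u])
      (use isometry_rescaled_inv(4)[OF D(5)] in \<open>simp add: a'_def\<close>)
  have "shift b' (end_map l (bd u)) = shift b (bd u)"
    by (rule B.shift_conj[OF D(2,6) bd_in_ends[OF u(1)]])
      (use isometry_rescaled_inv(4)[OF D(6)] D(3)[OF u(1)] u(2) in \<open>simp_all add: b'_def\<close>)
  then show "shift b' (bd (end_map k u)) = shift b (bd u)" using D(7)[OF u(1)] by simp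
qed

text \<open>
  A nonzero shift, in either tree, comes from an isometry with two fixed ends, and by
  2-transitivity these may be conjugated to one fixed pair of ends. There, shifts are
  proportional.
\<close>

lemma ratio_exists:
  obtains c where "0 < c"
    "\<And>a b u. compat a b \<Longrightarrow> u \<in> ends \<Longrightarrow> end_map a u = u \<Longrightarrow> shift b (bd u) = c * shift a u"
proof (cases "\<exists>a b u. compat a b \<and> u \<in> ends \<and> end_map a u = u \<and> shift a u \<noteq> 0")
  case True
  then obtain a b u where a: "compat a b" "u \<in> ends" "end_map a u = u" "0 < shift a u"
    using compat_inv shifts_inv by (metis neg_0_less_iff_less linorder_neqE_linordered_idom)
  then obtain v where v: "v \<in> ends" "u \<noteq> v" "end_map a v = v" using second_fixed_end by (metis less_irrefl)
  define c where "c = shift b (bd u) / shift a u"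
  have "0 \<le> shift b (bd u)" using shift_same_sign[OF a(1,2) v(1,2) a(3) v(3) a(4)] .
  moreover have "shift b (bd u) \<noteq> 0"
    using shift_lipschitz(2)[OF a(1,2) v(1,2) a(3) v(3)] a(4) by auto
  ultimately have "0 < c" using a(4) by (simp add: c_def)
  moreover have "shift b' (bd u') = c * shift a' u'"
    if a': "compat a' b'" "u' \<in> ends" "end_map a' u' = u'" for a' b' u'
  proof (cases "shift a' u' \<noteq> 0 \<or> shift b' (bd u') \<noteq> 0")
    case True
    then obtain v' where v': "v' \<in> ends" "u' \<noteq> v'" "end_map a' v' = v'"
      using second_fixed_end[OF a'] by metis
    obtain k l where k: "compat k l" "end_map k u' = u" "end_map k v' = v"
      using transitive[OF a'(2) v'(1,2) a(2) v(1,2)] by blast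
    note conj = shifts_conj[OF a'(1) k(1) a'(2,3), unfolded k(2)]
    have "shift (l \<circ> b' \<circ> inv_fun l) (bd u) * shift a u
        = shift b (bd u) * shift (k \<circ> a' \<circ> inv_fun k) u"
      using shifts_proportional[OF a(1) conj(1) a(2) v(1,2) a(3) v(3) conj(2)]
        shifts_conj(2)[OF a'(1) k(1) v'(1,3)] k(3) by simp
    then show ?thesis using conj a(4) by (simp add: c_def field_simps)
  qed simp
  ultimately show thesis using that by blast
next
  case False
  have "shift b (bd u) = 1 * shift a u" if a: "compat a b" "u \<in> ends" "end_map a u = u" for a b u
  proof (rule ccontr)
    assume neq: "shift b (bd u) \<noteq> 1 * shift a u"
    have zero: "shift a u = 0" using False a by blast
    then have nz: "shift b (bd u) \<noteq> 0" using neq by simp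
    then obtain v where v: "v \<in> ends" "u \<noteq> v" "end_map a v = v" using second_fixed_end[OF a] by metis
    then show False using shift_lipschitz(1)[OF a(1,2) v(1,2) a(3) v(3)] zero nz by simp
  qed
  then show thesis using that[of 1] by simp
qed

end

section \<open>The equivariant isometry\<close>

locale shift_ratio = two_transitive_pair +
  fixes c :: real
  assumes c: "0 < c"
    and ratio: "compat a b \<Longrightarrow> u \<in> ends \<Longrightarrow> end_map a u = u \<Longrightarrow> shift b (bd u) = c * shift a u"
begin

text \<open>
  All that matters about the tour is that it exchanges \<open>u\<close> and \<open>v\<close> and that the displacements
  \<open>s\<close> and \<open>c * s\<close> of the two centers correspond.
\<close>

lemma tripod_tour:
  assumes m: "matched u v w z z'"
  obtains k l s where "compat k l" "end_map k u = v" "end_map k v = u"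
    "busemann u z (k z) = s" "busemann (bd u) z' (l z') = c * s"
proof -
  note D = matchedD[OF m]
  obtain a1 b1 where 1: "compat a1 b1" "end_map a1 v = v" "end_map a1 u = w"
    using transitive[of v u v w] D by metis
  obtain a2 b2 where 2: "compat a2 b2" "end_map a2 w = w" "end_map a2 v = u"
    using transitive[of w v w u] D by metis
  obtain a3 b3 where 3: "compat a3 b3" "end_map a3 u = u" "end_map a3 w = v"
    using transitive[of u w u v] D by metis
  note C = compatD[OF 1(1)] compatD[OF 2(1)] compatD[OF 3(1)]
  have e: "end_map b1 (bd v) = bd v" "end_map b1 (bd u) = bd w" "end_map b2 (bd w) = bd w"
    "end_map b2 (bd v) = bd u" "end_map b3 (bd u) = bd u" "end_map b3 (bd w) = bd v"
    using C(3)[OF D(2)] C(3)[OF D(1)] C(7)[OF D(3)] C(7)[OF D(2)] C(11)[OF D(1)] C(11)[OF D(3)]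
      1 2 3 by simp_all
  let ?k = "a3 \<circ> (a2 \<circ> a1)" and ?l = "b3 \<circ> (b2 \<circ> b1)"
  have "compat ?k ?l" using 1 2 3 by (intro compat_comp)
  moreover have "end_map ?k u = v" "end_map ?k v = u" using 1 2 3 by (simp_all flip: end_map_comp)
  moreover have "busemann u z (?k z) = shift a1 v - shift a2 w + shift a3 u"
    using A.shift_around_tripod[OF D(13) C(1,5,9) 1(2,3) 2(2,3) 3(2,3)] by simp
  moreover have "busemann (bd u) z' (?l z') = c * (shift a1 v - shift a2 w + shift a3 u)"
    using B.shift_around_tripod[OF D(14) C(2,6,10) e]
      ratio[OF 1(1) D(2) 1(2)] ratio[OF 2(1) D(3) 2(2)] ratio[OF 3(1) D(1) 3(2)]
    by (simp add: algebra_simps)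
  ultimately show thesis by (rule that)
qed

text \<open>
  The positions of centers on an apartment are expressed by shifts alone, and these are scaled
  by \<open>c\<close>.
\<close>

lemma center_displacement:
  assumes m: "matched u v w z z'" and m1: "matched u v w1 z1 z1'"
  shows "busemann (bd u) z1' z' = c * busemann u z1 z"
proof -
  note D = matchedD[OF m] note D1 = matchedD[OF m1]
  obtain k l s where k: "compat k l" "end_map k u = v" "end_map k v = u"
    "busemann u z (k z) = s" "busemann (bd u) z' (l z') = c * s" using tripod_tour[OF m] .
  obtain k1 l1 s1 where k1: "compat k1 l1" "end_map k1 u = v" "end_map k1 v = u"
    "busemann u z1 (k1 z1) = s1" "busemann (bd u) z1' (l1 z1') = c * s1" using tripod_tour[OF m1] .
  \<comment> \<open>The two tours differ by a translation of the apartment, whose shift is scaled by \<open>c\<close>.\<close>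
  define a b where "a = inv_fun k \<circ> k1" and "b = inv_fun l \<circ> l1"
  have ab: "compat a b" unfolding a_def b_def by (intro compat_comp compat_inv k k1)
  have "inv_fun k \<circ> k = id" using isometry_rescaled_inv(2)[OF compatD(1)[OF k(1)]] by simp
  then have "end_map (inv_fun k) v = u" "end_map (inv_fun k) u = v"
    using k(2,3) end_map_comp[of "inv_fun k" k] by (metis end_map_id)+
  then have fixed: "end_map a u = u" "end_map a v = v"
    using k1 by (simp_all add: a_def flip: end_map_comp)
  have fixed': "end_map b (bd u) = bd u" "end_map b (bd v) = bd v" "end_map l (bd v) = bd u"
    using compatD(3)[OF ab D(1)] compatD(3)[OF ab D(2)] compatD(3)[OF k(1) D(2)] fixed k by auto
  have 1: "k (a z1) = k1 z1" "l (b z1') = l1 z1'"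
    using isometry_rescaled_inv(5)[OF compatD(1)[OF k(1)]]
      isometry_rescaled_inv(5)[OF compatD(2)[OF k(1)]] by (simp_all add: a_def b_def)
  have e1: "2 * busemann u z1 z = s1 - s + shift a u"
    using A.distance_from_reflections[OF D(1,2,4) D(15) D1(15) compatD(1)[OF k(1)] k(3)
        compatD(1)[OF ab] fixed] 1 k k1 by simp
  have e2: "2 * busemann (bd u) z1' z' = c * s1 - c * s + c * shift a u"
    using B.distance_from_reflections[OF D(7,8,10) D(16) D1(16) compatD(2)[OF k(1)] fixed'(3)
        compatD(2)[OF ab] fixed'(1,2)] 1 k k1 ratio[OF ab D(1) fixed(1)] by simp
  have "2 * busemann (bd u) z1' z' = c * (2 * busemann u z1 z)"
    unfolding e1 e2 by (simp add: algebra_simps)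
  then show ?thesis by simp
qed

text \<open>
  On an apartment, the Busemann function of a third end is the distance from the center, that
  is the absolute value of the Busemann function of either end of the apartment. Here the ratio
  has to be positive.
\<close>

lemma busemann_scaled_third_end:
  assumes m: "matched u v x y y'" and p: "p \<in> apartment_between u v"
    and q: "q \<in> apartment_between (bd u) (bd v)" and b: "busemann (bd u) q y' = c * busemann u p y"
  shows "busemann (bd x) q y' = c * busemann x p y"
proof -
  note D = matchedD[OF m]
  have "busemann x p y = \<bar>busemann u p y\<bar>"
    using A.busemann_third_end(1)[OF D(13) p] A.busemann_apartment(2)[OF D(1,2,4) p D(15)] by simp
  moreover have "busemann (bd x) q y' = \<bar>busemann (bd u) q y'\<bar>"
    using B.busemann_third_end(1)[OF D(14) q] B.busemann_apartment(2)[OF D(7,8,10) q D(16)] by simp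
  ultimately show ?thesis using b c by (simp add: abs_mult)
qed

text \<open>
  A point of the second tree that corresponds to \<open>p\<close> has to have the same Busemann coordinates
  relative to all matched centers, up to the factor \<open>c\<close>. Asking this for all ends at once makes
  uniqueness, equivariance and the scaling of distances immediate and independent of choices;
  the work is in the existence.
\<close>

definition corresponds :: "'a \<Rightarrow> 'b \<Rightarrow> bool" where
  "corresponds p q \<longleftrightarrow> (\<forall>u v w z z' x. matched u v w z z' \<longrightarrow> x \<in> ends \<longrightarrow>
     busemann (bd x) q z' = c * busemann x p z)"

text \<open>
  Two triples with the common end \<open>x\<close> are connected by triples that share two ends with their
  neighbours.
\<close>

lemma centers_at_same_end:
  assumes m: "matched x v w z z'" and m1: "matched x v1 w1 z1 z1'"
  shows "busemann (bd x) z' z1' = c * busemann x z z1"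
proof (cases "v1 = v")
  case True
  then show ?thesis using center_displacement[OF m1[unfolded True] m] by simp
next
  case False
  note D = matchedD[OF m] note D1 = matchedD[OF m1]
  obtain y y' where y: "matched x v v1 y y'"
    using matched_exists[of x v v1] D D1 False by metis
  have "busemann (bd x) z' y' = c * busemann x z y" using center_displacement[OF y m] .
  moreover have "busemann (bd x) y' z1' = c * busemann x y z1"
    using center_displacement[OF m1 matched_commute(2)[OF y]] .
  ultimately show ?thesis
    using A.busemann_cocycle[OF D(1), of z y z1] B.busemann_cocycle[OF D(7), of z' y' z1']
    by (metis distrib_left)
qed

lemma move_center_to_end:
  assumes m: "matched u v w z z'" and x: "x \<in> ends"
  obtains y y' v1 w1 where "matched x v1 w1 y y'" "busemann (bd x) z' y' = c * busemann x z y"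
proof -
  note D = matchedD[OF m]
  consider "x = u" | "x = v" | "x \<noteq> u" "x \<noteq> v" by blast
  then show thesis
  proof cases
    case 1
    then show thesis using that[of v w z z'] m A.busemann_self[of x z] B.busemann_self[of "bd x" z'] D
      by simp
  next
    case 2
    then show thesis using that[of u w z z'] matched_commute(1)[OF m] A.busemann_self[of x z]
      B.busemann_self[of "bd x" z'] D by simp
  next
    case 3
    obtain y y' where y: "matched u v x y y'" using matched_exists[of u v x] D x 3 by metis
    have "busemann (bd x) z' y' = c * busemann x z y"
      using busemann_scaled_third_end[OF y D(15,16) center_displacement[OF y m]] .
    then show thesis using that matched_commute(5)[OF y] by blast
  qed
qed

lemma matched_corresponds:
  assumes m: "matched u v w z z'"
  shows "corresponds z z'"
  unfolding corresponds_def
proof (intro allI impI)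
  fix u1 v1 w1 z1 z1' and x :: "'a set set" assume m1: "matched u1 v1 w1 z1 z1'" and x: "x \<in> ends"
  note cc = A.busemann_cocycle[OF x] B.busemann_cocycle[OF bd_in_ends[OF x]]
  obtain y y' a b where y: "matched x a b y y'" "busemann (bd x) z' y' = c * busemann x z y"
    using move_center_to_end[OF m x] .
  obtain y1 y1' a1 b1 where y1: "matched x a1 b1 y1 y1'"
    "busemann (bd x) z1' y1' = c * busemann x z1 y1" using move_center_to_end[OF m1 x] .
  have mid: "busemann (bd x) y' y1' = c * busemann x y y1"
    using centers_at_same_end[OF y(1) y1(1)] .
  have 1: "busemann x z z1 = busemann x z y + busemann x y y1 - busemann x z1 y1"
    using cc(1)[of z z1 y1] cc(1)[of z y y1] by simp
  have 2: "busemann (bd x) z' z1'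
      = busemann (bd x) z' y' + busemann (bd x) y' y1' - busemann (bd x) z1' y1'"
    using cc(2)[of z' z1' y1'] cc(2)[of z' y' y1'] by simp
  show "busemann (bd x) z' z1' = c * busemann x z z1"
    unfolding 1 2 mid y(2) y1(2) by (simp add: algebra_simps)
qed

lemma correspondsI:
  assumes m: "matched u v w z z'" and p: "p \<in> apartment_between u v"
    and q: "q \<in> apartment_between (bd u) (bd v)" and b: "busemann (bd u) q z' = c * busemann u p z"
  shows "corresponds p q"
  unfolding corresponds_def
proof (intro allI impI)
  note D = matchedD[OF m]
  fix u1 v1 w1 z1 z1' and x :: "'a set set" assume m1: "matched u1 v1 w1 z1 z1'" and x: "x \<in> ends"
  have x': "bd x \<in> ends" by (rule bd_in_ends[OF x])
  have zz: "busemann (bd y) z' y1' = c * busemann y z y1"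
    if "y \<in> ends" "matched a1 b1 d1 y1 y1'" for y y1 y1' a1 b1 d1
    using matched_corresponds[OF m] that unfolding corresponds_def by blast
  have "busemann (bd x) q z' = c * busemann x p z"
  proof -
    consider "x = u" | "x = v" | "x \<noteq> u" "x \<noteq> v" by blast
    then show ?thesis
    proof cases
      case 1
      then show ?thesis using b by simp
    next
      case 2
      then show ?thesis
        using b A.busemann_apartment(1)[OF D(1,2,4) p D(15)]
          B.busemann_apartment(1)[OF D(7,8,10) q D(16)] by simp
    next
      case 3
      obtain y y' where y: "matched u v x y y'" using matched_exists[of u v x] D x 3 by metis
      have "busemann (bd u) q y' = c * busemann u p y"
        using b zz[OF D(1) y] A.busemann_cocycle[OF D(1), of p z y]
          B.busemann_cocycle[OF D(7), of q z' y'] by (metis distrib_left)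
      then have 1: "busemann (bd x) q y' = c * busemann x p y"
        using busemann_scaled_third_end[OF y p q] by simp
      have 2: "busemann x p z = busemann x p y - busemann x z y"
        "busemann (bd x) q z' = busemann (bd x) q y' - busemann (bd x) z' y'"
        using A.busemann_cocycle[OF x, of p z y] B.busemann_cocycle[OF x', of q z' y'] by simp_all
      show ?thesis unfolding 2 1 zz[OF x y] by (simp add: algebra_simps)
    qed
  qed
  moreover have "busemann (bd x) z' z1' = c * busemann x z z1" by (rule zz[OF x m1])
  ultimately show "busemann (bd x) q z1' = c * busemann x p z1"
    using A.busemann_cocycle[OF x, of p z z1] B.busemann_cocycle[OF x', of q z' z1']
    by (metis distrib_left)
qed

lemma some_matched: obtains u v w z z' where "matched u v w z z'"
  using three matched_exists by metis

lemma corresponds_busemann: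
  assumes "corresponds p q" "corresponds p1 q1" and x: "x \<in> ends"
  shows "busemann (bd x) q q1 = c * busemann x p p1"
proof -
  obtain u v w z z' where m: "matched u v w z z'" using some_matched .
  have "busemann (bd x) q z' = c * busemann x p z" "busemann (bd x) q1 z' = c * busemann x p1 z"
    using assms m unfolding corresponds_def by blast+
  then show ?thesis
    using A.busemann_cocycle[OF x, of p p1 z] B.busemann_cocycle[OF bd_in_ends[OF x], of q q1 z']
    by (metis add_diff_cancel_right' left_diff_distrib mult.commute)
qed

text \<open>
  The distance of two points is the value of some Busemann function, and every Busemann
  function is bounded by the distance.
\<close>

lemma corresponds_dist:
  assumes "corresponds p q" "corresponds p1 q1"
  shows "dist q q1 = c * dist p p1"
proof (rule antisym)
  obtain x' where x': "x' \<in> ends" "busemann x' q q1 = dist q q1" using B.dist_attained .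
  then obtain x where x: "x \<in> ends" "x' = bd x" using bd_surj by blast
  have "dist q q1 = c * busemann x p p1" using corresponds_busemann[OF assms x(1)] x x' by simp
  also have "\<dots> \<le> c * dist p p1"
    using A.busemann_le_dist[OF x(1), of p p1] c by (intro mult_left_mono) auto
  finally show "dist q q1 \<le> c * dist p p1" .
next
  obtain x where x: "x \<in> ends" "busemann x p p1 = dist p p1" using A.dist_attained .
  then have "c * dist p p1 = busemann (bd x) q q1" using corresponds_busemann[OF assms x(1)] by simp
  then show "c * dist p p1 \<le> dist q q1" using B.busemann_le_dist[OF bd_in_ends[OF x(1)], of q q1]
    by linarith
qed

lemma corresponds_unique: "corresponds p q \<Longrightarrow> corresponds p q1 \<Longrightarrow> q = q1"
  using corresponds_dist[of p q p q1] by simp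

lemma corresponds_exists:
  obtains q where "corresponds p q"
proof -
  obtain \<gamma> :: "real \<Rightarrow> 'a" and u v where \<gamma>: "line \<gamma> u v" "\<gamma> 0 = p" using A.line_through[of p p] by metis
  have uv: "u \<in> ends" "v \<in> ends" "u \<noteq> v" using A.line_ends[OF \<gamma>(1)] A.line_distinct[OF \<gamma>(1)] by auto
  have p: "p \<in> apartment_between u v" using A.apartment_between_eq[OF \<gamma>(1)] \<gamma>(2) by blast
  obtain w where w: "w \<in> ends" "w \<noteq> u" "w \<noteq> v" using third_end .
  obtain z z' where m: "matched u v w z z'" using matched_exists[of u v w] uv w by metis
  note D = matchedD[OF m]
  obtain q where "q \<in> apartment_between (bd u) (bd v)" "busemann (bd u) q z' = c * busemann u p z"
    using B.apartment_point_at[OF D(7,8,10) D(16)] by blast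
  then show thesis using that correspondsI[OF m p] by blast
qed

lemma corresponds_surj:
  obtains p where "corresponds p q"
proof -
  obtain \<gamma> :: "real \<Rightarrow> 'b" and u' v' where \<gamma>: "line \<gamma> u' v'" "\<gamma> 0 = q" using B.line_through[of q q] by metis
  have "u' \<in> ends" "v' \<in> ends" using B.line_ends[OF \<gamma>(1)] by auto
  then obtain u v where uv: "u \<in> ends" "v \<in> ends" "u' = bd u" "v' = bd v" using bd_surj by metis
  then have "u \<noteq> v" using B.line_distinct[OF \<gamma>(1)] by blast
  have q: "q \<in> apartment_between (bd u) (bd v)"
    using B.apartment_between_eq[OF \<gamma>(1)] \<gamma>(2) uv by blast
  obtain w where w: "w \<in> ends" "w \<noteq> u" "w \<noteq> v" using third_end .
  obtain z z' where m: "matched u v w z z'" using matched_exists[of u v w] uv w \<open>u \<noteq> v\<close> by metis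
  note D = matchedD[OF m]
  obtain p where "p \<in> apartment_between u v" "busemann u p z = busemann (bd u) q z' / c"
    using A.apartment_point_at[OF D(1,2,4) D(15)] by blast
  then show thesis using that[of p] correspondsI[OF m _ q, of p] c by simp
qed

lemma corresponds_compat:
  assumes ab: "compat a b" and pq: "corresponds p q"
  shows "corresponds (a p) (b q)"
  unfolding corresponds_def
proof (intro allI impI)
  fix u v w z z' and x :: "'a set set" assume m: "matched u v w z z'" and x: "x \<in> ends"
  note ab' = compat_inv[OF ab] note D = compatD[OF ab] and D' = compatD[OF ab']
  let ?x = "end_map (inv_fun a) x"
  have x1: "?x \<in> ends" "end_map a ?x = x"
    using D'(4)[OF x] end_map_comp[of a "inv_fun a" x] isometry_rescaled_inv(3)[OF D(1)]
    by (simp_all add: end_map_id)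
  have "busemann (bd ?x) q (inv_fun b z') = c * busemann ?x p (inv_fun a z)"
    using pq matched_compat[OF ab' m] x1(1) unfolding corresponds_def by blast
  moreover have "busemann x (a p) z = busemann ?x p (inv_fun a z)"
    using A.isometry_busemann[OF D(1) x1(1), of p "inv_fun a z"] x1(2)
      isometry_rescaled_inv(5)[OF D(1)] by simp
  moreover have "busemann (bd x) (b q) z' = busemann (bd ?x) q (inv_fun b z')"
    using B.isometry_busemann[OF D(2) bd_in_ends[OF x1(1)], of q "inv_fun b z'"] D(3)[OF x1(1)] x1(2)
      isometry_rescaled_inv(5)[OF D(2)] by simp
  ultimately show "busemann (bd x) (b q) z' = c * busemann x (a p) z" by simp
qed

definition induced_isometry :: "'a \<Rightarrow> 'b" where
  "induced_isometry p = (THE q. corresponds p q)"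

lemma induced_isometry_corresponds: "corresponds p (induced_isometry p)"
  unfolding induced_isometry_def using corresponds_exists corresponds_unique by (metis theI)

lemma induced_isometry_eq: "corresponds p q \<Longrightarrow> induced_isometry p = q"
  using induced_isometry_corresponds corresponds_unique by blast

lemma induced_isometry_isometry: "isometry_rescaled (1 / c) induced_isometry"
  unfolding isometry_rescaled_def
proof (intro conjI allI)
  have "\<exists>p. q = induced_isometry p" for q
  proof -
    obtain p where "corresponds p q" using corresponds_surj .
    then show ?thesis using induced_isometry_eq by blast
  qed
  then show "surj induced_isometry" by (simp add: surj_def)
  show "1 / c * dist (induced_isometry x) (induced_isometry y) = dist x y" for x y
    using corresponds_dist[OF induced_isometry_corresponds induced_isometry_corresponds, of x y] c by simp
qed

lemma induced_isometry_end_map: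
  assumes u: "u \<in> ends"
  shows "end_map induced_isometry u = bd u"
proof -
  obtain \<rho> :: "real \<Rightarrow> 'a" where \<rho>: "geodesic {0..} \<rho>" "end_of \<rho> = u" using A.ends_cases[OF u] .
  let ?\<sigma> = "\<lambda>t. induced_isometry (\<rho> (1 / c * t))"
  have c': "0 < 1 / c" using c by simp
  have "busemann (bd u) (?\<sigma> 0) (?\<sigma> t) = t" if "0 \<le> t" for t
    using corresponds_busemann[OF induced_isometry_corresponds induced_isometry_corresponds u, of "\<rho> (1 / c * 0)" "\<rho> (1 / c * t)"]
      A.busemann_ray[OF \<rho>(1), of 0 "1 / c * t"] \<rho>(2) that c by simp
  then have "end_of ?\<sigma> = bd u"
    using B.end_of_eq_if_busemann[OF homothety_ray[OF induced_isometry_isometry c' \<rho>(1)] bd_in_ends[OF u]] by simp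
  then show ?thesis using end_map_end_of[OF induced_isometry_isometry c' \<rho>(1)] \<rho>(2) by simp
qed

lemma induced_isometry_boundary: "boundary_map induced_isometry = bd"
proof -
  have "boundary_map induced_isometry = restrict (end_map induced_isometry) ends"
    using boundary_map_homothety[OF induced_isometry_isometry _ three] c by simp
  also have "\<dots> = restrict bd ends" using induced_isometry_end_map by (intro restrict_ext) simp
  also have "\<dots> = bd" by (simp add: bd_def)
  finally show ?thesis .
qed

text \<open>
  An isometry with this boundary map has to match centers; two different centers determine the
  scaling factor, and then the Busemann coordinates of all images are known.
\<close>

lemma induced_isometry_unique:
  assumes h: "isometry_rescaled c' h" and c': "0 < c'" and bd: "boundary_map h = bd"
    and z: "center (z1::'a) u1 v1 w1" "center z2 u2 v2 w2" "z1 \<noteq> z2"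
  shows "h = induced_isometry"
proof
  have ends: "end_map h u = bd u" if "u \<in> ends" for u
    using boundary_map_homothety[OF h c' three] bd that by (metis restrict_apply')
  have matched: "h z = z'" if m: "matched u v w z z'" for u v w z z'
  proof -
    note D = matchedD[OF m]
    have "center (h z) (bd u) (bd v) (bd w)"
      using homothety_center[OF h c' D(13)] ends D(1-3) by simp
    then show ?thesis using B.center_unique D(14) by blast
  qed
  have at_center: "h z = induced_isometry z" if z: "center z u v w" for u v w z
  proof -
    have e: "u \<in> ends" "v \<in> ends" "w \<in> ends" "u \<noteq> v" "v \<noteq> w" "u \<noteq> w"
      using z by (auto simp: center_def)
    obtain y z' where m: "matched u v w y z'" using matched_exists[OF e] .
    then have "y = z" using A.center_unique[OF z] matchedD(13) by blast
    then show ?thesis using matched[OF m] induced_isometry_eq[OF matched_corresponds[OF m]] by simp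
  qed
  have "dist z1 z2 / c' = c * dist z1 z2"
    using isometry_rescaled_dist[OF h c', of z1 z2] at_center[OF z(1)] at_center[OF z(2)]
      corresponds_dist[OF induced_isometry_corresponds induced_isometry_corresponds, of z1 z2] by simp
  then have "1 / c' = c" using z(3) c' by (simp add: field_simps)
  fix p
  have "corresponds p (h p)" unfolding corresponds_def
  proof (intro allI impI)
    fix u v w z z' and x :: "'a set set" assume m: "matched u v w z z'" and x: "x \<in> ends"
    show "busemann (bd x) (h p) z' = c * busemann x p z"
      using homothety_busemann[OF h c' x, of p z] matched[OF m] ends[OF x] \<open>1 / c' = c\<close> by auto
  qed
  then show "h p = induced_isometry p" using induced_isometry_eq by simp
qed

end

context two_transitive_pair
begin

text \<open>
  If all shifts vanished, every positive number would be a shift ratio. Comparing two of them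
  shows that all centers coincide.
\<close>

lemma nonzero_shift:
  assumes z: "center (z::'a) u v w" "center z1 u1 v1 w1" "z \<noteq> z1"
  obtains a b x y where "compat a b" "x \<in> ends" "y \<in> ends" "x \<noteq> y" "end_map a x = x"
    "end_map a y = y" "shift a x \<noteq> 0"
proof (rule ccontr)
  note witness = that
  assume neg: "\<not> thesis"
  have no: "shift a x = 0" if a: "compat a b" "x \<in> ends" "end_map a x = x" for a b x
  proof (rule ccontr)
    assume nz: "shift a x \<noteq> 0"
    then obtain v where "v \<in> ends" "x \<noteq> v" "end_map a v = v" using second_fixed_end[OF a] by metis
    then show False using witness neg a nz by blast
  qed
  obtain c where c: "0 < c"
    "\<And>a b u. compat a b \<Longrightarrow> u \<in> ends \<Longrightarrow> end_map a u = u \<Longrightarrow> shift b (bd u) = c * shift a u"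
    using ratio_exists by metis
  interpret one: shift_ratio TA TB f g L c by unfold_locales (use c in auto)
  interpret two: shift_ratio TA TB f g L "2 * c" by unfold_locales (use c no in auto)
  have e: "u \<in> ends" "v \<in> ends" "w \<in> ends" "u \<noteq> v" "v \<noteq> w" "u \<noteq> w"
    "u1 \<in> ends" "v1 \<in> ends" "w1 \<in> ends" "u1 \<noteq> v1" "v1 \<noteq> w1" "u1 \<noteq> w1"
    using z by (auto simp: center_def)
  obtain y y' where y: "matched u v w y y'" using matched_exists[OF e(1-6)] .
  obtain y1 y1' where y1: "matched u1 v1 w1 y1 y1'" using matched_exists[OF e(7-12)] .
  have "dist y' y1' = c * dist y y1" "dist y' y1' = 2 * c * dist y y1"
    using one.corresponds_dist[OF one.matched_corresponds[OF y] one.matched_corresponds[OF y1]]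
      two.corresponds_dist[OF two.matched_corresponds[OF y] two.matched_corresponds[OF y1]] by auto
  then have "y = y1" using c(1) by simp
  moreover have "y = z" "y1 = z1"
    using A.center_unique matchedD(13)[OF y] matchedD(13)[OF y1] z by blast+
  ultimately show False using z(3) by simp
qed

text \<open>
  A nonzero shift occurs on every apartment, by 2-transitivity with the same absolute value;
  the translates of one center are then spaced evenly along the apartment.
\<close>

lemma centers_dense:
  assumes z: "center (z::'a) u v w" "center z1 u1 v1 w1" "z \<noteq> z1"
  obtains s where "\<And>p. \<exists>u v w y y'. matched u v w y y' \<and> dist p y \<le> s"
proof -
  obtain a0 b0 x0 y0 where 0: "compat a0 b0" "x0 \<in> ends" "y0 \<in> ends" "x0 \<noteq> y0"
    "end_map a0 x0 = x0" "end_map a0 y0 = y0" "shift a0 x0 \<noteq> 0" using nonzero_shift[OF z] .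
  define s where "s = \<bar>shift a0 x0\<bar>"
  have "0 < s" using 0 by (simp add: s_def)
  have "\<exists>u v w y y'. matched u v w y y' \<and> dist p y \<le> s" for p
  proof -
    obtain \<gamma> :: "real \<Rightarrow> 'a" and u v where \<gamma>: "line \<gamma> u v" "\<gamma> 0 = p" using A.line_through[of p p] by metis
    have uv: "u \<in> ends" "v \<in> ends" "u \<noteq> v" using A.line_ends[OF \<gamma>(1)] A.line_distinct[OF \<gamma>(1)] by auto
    have p: "p \<in> apartment_between u v" using A.apartment_between_eq[OF \<gamma>(1)] \<gamma>(2) by blast
    obtain w where w: "w \<in> ends" "w \<noteq> u" "w \<noteq> v" using third_end .
    obtain z z' where m: "matched u v w z z'" using matched_exists[of u v w] uv w by metis
    have zin: "z \<in> apartment_between u v" using matchedD(15)[OF m] .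
    obtain k l where k: "compat k l" "end_map k x0 = u" "end_map k y0 = v"
      using transitive[OF 0(2-4) uv] by blast
    define a1 where "a1 = k \<circ> a0 \<circ> inv_fun k"
    define b1 where "b1 = l \<circ> b0 \<circ> inv_fun l"
    have 1: "compat a1 b1" "end_map a1 u = u" "end_map a1 v = v" "\<bar>shift a1 u\<bar> = s"
      using shifts_conj[OF 0(1) k(1) 0(2,5)] shifts_conj(2)[OF 0(1) k(1) 0(3,6)] k
      by (simp_all add: a1_def b1_def s_def)
    have inv: "compat (inv_fun a1) (inv_fun b1)" "end_map (inv_fun a1) u = u"
      "end_map (inv_fun a1) v = v" "shift (inv_fun a1) u = - shift a1 u"
      using compat_inv[OF 1(1)] shifts_inv[OF 1(1) uv(1) 1(2)] shifts_inv(1)[OF 1(1) uv(2) 1(3)] by auto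
    define \<beta> where "\<beta> = busemann u z p"
    \<comment> \<open>Choose the direction of the translation so that it moves \<open>z\<close> towards \<open>p\<close>.\<close>
    define a where "a = (if (0 \<le> \<beta>) = (0 \<le> shift a1 u) then a1 else inv_fun a1)"
    define b where "b = (if (0 \<le> \<beta>) = (0 \<le> shift a1 u) then b1 else inv_fun b1)"
    have a: "compat a b" "end_map a u = u" "end_map a v = v"
      "shift a u = (if 0 \<le> \<beta> then s else - s)"
      using 1 inv \<open>0 < s\<close> by (auto simp: a_def b_def)
    define n where "n = nat \<lfloor>\<bar>\<beta>\<bar> / s\<rfloor>"
    have "0 \<le> \<bar>\<beta>\<bar> / s" using \<open>0 < s\<close> by simp
    then have "real n \<le> \<bar>\<beta>\<bar> / s" "\<bar>\<beta>\<bar> / s \<le> real n + 1" unfolding n_def by linarith+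
    then have n: "real n * s \<le> \<bar>\<beta>\<bar>" "\<bar>\<beta>\<bar> \<le> real n * s + s" using \<open>0 < s\<close> by (simp_all add: field_simps)
    note tr = A.apartment_translate[OF uv zin compatD(1)[OF a(1)] a(2,3), of n]
    have "busemann u p ((a ^^ n) z) = real n * shift a u - \<beta>"
      using A.busemann_cocycle[OF uv(1), of z p "(a ^^ n) z"] tr(2) by (simp add: \<beta>_def)
    then have "dist p ((a ^^ n) z) \<le> s"
      using A.busemann_apartment(2)[OF uv p tr(1)] a(4) n by (cases "0 \<le> \<beta>") auto
    then show ?thesis using matched_compat[OF compat_pow[OF a(1)] m] by blast
  qed
  then show thesis using that by blast
qed

end

lemma (in shift_ratio) induced_isometry_finite_distance:
  assumes z: "center (z::'a) u v w" "center z1 u1 v1 w1" "z \<noteq> z1"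
  shows "finite_distance induced_isometry f"
proof -
  obtain s where s: "\<And>p. \<exists>u v w y y'. matched u v w y y' \<and> dist p y \<le> s"
    using centers_dense[OF z] by metis
  have "dist (induced_isometry p) (f p) \<le> c * s + 3 * morse_bound + (L * s + L)" for p
  proof -
    obtain u v w y y' where y: "matched u v w y y'" "dist p y \<le> s" using s by blast
    have "dist (induced_isometry p) y' = c * dist p y"
      using corresponds_dist[OF induced_isometry_corresponds matched_corresponds[OF y(1)]] .
    also have "\<dots> \<le> c * s" using y(2) c by simp
    finally have "dist (induced_isometry p) y' \<le> c * s" .
    moreover have "L * dist p y \<le> L * s" using y(2) L by simp
    then have "dist (f p) (f y) \<le> L * s + L" using f_upper[of p y] by linarith
    ultimately show ?thesis
      using matched_close[OF y(1)] dist_triangle[of "induced_isometry p" "f p" y'] dist_triangle3[of y' "f p" "f y"]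
      by (simp add: dist_commute)
  qed
  then show ?thesis unfolding finite_distance_def bounded_iff by auto
qed

context leafless_tree
begin

lemma apartment_between_if_straight:
  assumes \<rho>: "ray_from p u \<rho>" and \<sigma>: "ray_from p v \<sigma>" and st: "0 < s" "0 < t"
    and d: "dist (\<rho> s) (\<sigma> t) = s + t"
  shows "u \<noteq> v" "p \<in> apartment_between u v"
proof -
  have dd: "dist (\<rho> x) (\<rho> y) = \<bar>x - y\<bar>" "dist (\<sigma> x) (\<sigma> y) = \<bar>x - y\<bar>" if "0 \<le> x" "0 \<le> y" for x y
    using \<rho> \<sigma> that by (auto simp: ray_from_def geodesic_iff)
  show uv: "u \<noteq> v"
  proof
    assume "u = v"
    then have "\<sigma> t = \<rho> t" using ray_from_unique \<rho> \<sigma> st by (metis less_imp_le)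
    then show False using dd(1)[of s t] d st by simp
  qed
  obtain r where r: "0 \<le> r" "\<And>t. 0 \<le> t \<Longrightarrow> t \<le> r \<Longrightarrow> \<rho> t = \<sigma> t"
    "\<And>s t. r \<le> s \<Longrightarrow> r \<le> t \<Longrightarrow> dist (\<rho> s) (\<sigma> t) = s + t - 2 * r"
    using rays_from_diverge[OF \<rho> \<sigma> uv] by metis
  have "r = 0"
  proof (rule ccontr)
    assume "r \<noteq> 0"
    define m where "m = min r (min s t)"
    have m: "0 < m" "m \<le> r" "m \<le> s" "m \<le> t" using r(1) \<open>r \<noteq> 0\<close> st by (auto simp: m_def)
    then have "dist (\<rho> s) (\<sigma> t) \<le> (s - m) + (t - m)"
      using dist_triangle[of "\<rho> s" "\<sigma> t" "\<rho> m"] dd(1)[of s m] dd(2)[of m t] r(2)[of m] by simp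
    then show False using d m by simp
  qed
  then show "p \<in> apartment_between u v"
    using diverge_in_apartment(1)[OF \<rho> \<sigma> r(1,3), of 0] \<rho> by (simp add: ray_from_def)
qed

text \<open>
  Extend the three segments from the branch point to rays: their ends span a tripod.
\<close>

lemma branch_point_center:
  assumes "branch_point (z::'a)"
  obtains u v w where "center z u v w"
proof -
  obtain p q r where n: "p \<noteq> z" "q \<noteq> z" "r \<noteq> z"
    and seg: "tree_segment p q \<inter> tree_segment q r \<inter> tree_segment r p = {z}"
    using assms unfolding branch_point_def by blast
  have b: "dist p z + dist z q = dist p q" "dist q z + dist z r = dist q r" "dist r z + dist z p = dist r p"
    using seg segment_iff by blast+
  have ex: "\<exists>u \<rho>. u \<in> ends \<and> ray_from z u \<rho> \<and> \<rho> (dist z x) = x" for x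
  proof -
    obtain \<gamma> :: "real \<Rightarrow> 'a" and u v where \<gamma>: "line \<gamma> u v" "\<gamma> 0 = z" "\<gamma> (dist z x) = x" using line_through .
    then have "ray_from z u \<gamma>" using line_ray_from(1)[OF \<gamma>(1), of 0] by simp
    then show ?thesis using \<gamma> line_ends[OF \<gamma>(1)] by blast
  qed
  obtain u \<rho> where u: "u \<in> ends" "ray_from z u \<rho>" "\<rho> (dist z p) = p" using ex by blast
  obtain v \<sigma> where v: "v \<in> ends" "ray_from z v \<sigma>" "\<sigma> (dist z q) = q" using ex by blast
  obtain w \<tau> where w: "w \<in> ends" "ray_from z w \<tau>" "\<tau> (dist z r) = r" using ex by blast
  have pos: "0 < dist z p" "0 < dist z q" "0 < dist z r" using n by auto
  have "u \<noteq> v" "z \<in> apartment_between u v"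
    using apartment_between_if_straight[OF u(2) v(2) pos(1,2)] u v b(1) by (auto simp: dist_commute)
  moreover have "v \<noteq> w" "z \<in> apartment_between v w"
    using apartment_between_if_straight[OF v(2) w(2) pos(2,3)] v w b(2) by (auto simp: dist_commute)
  moreover have "u \<noteq> w" "z \<in> apartment_between u w"
    using apartment_between_if_straight[OF u(2) w(2) pos(1,3)] u w b(3) by (auto simp: dist_commute)
  ultimately show thesis using that u(1) v(1) w(1) unfolding center_def by blast
qed

text \<open>
  Follow a geodesic in unit steps.
\<close>

lemma controlled_affine:
  fixes f :: "'a \<Rightarrow> 'b::metric_space"
  assumes "controlled f"
  obtains K where "0 \<le> K" "\<And>x y. dist (f x) (f y) \<le> K * dist x y + K"
proof -
  obtain \<rho> :: "real \<Rightarrow> real" where \<rho>: "mono_on {0..} \<rho>" "\<And>t. 0 \<le> t \<Longrightarrow> 0 \<le> \<rho> t"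
    "\<And>x y. dist (f x) (f y) \<le> \<rho> (dist x y)" using assms unfolding controlled_def by blast
  define K where "K = \<rho> 1"
  have "0 \<le> K" using \<rho>(2)[of 1] by (simp add: K_def)
  have unit: "dist (f x) (f y) \<le> K" if "dist x y \<le> 1" for x y
    using \<rho>(3)[of x y] mono_onD[OF \<rho>(1), of "dist x y" 1] that by (simp add: K_def)
  have "dist (f x) (f y) \<le> real n * K" if "dist x y \<le> real n" for n x y
    using that
  proof (induction n arbitrary: y)
    case (Suc n)
    obtain \<gamma> where \<gamma>: "geodesic_between x y \<gamma>" using geodesic_between_exists by blast
    define p where "p = \<gamma> (min (real n) (dist x y))"
    have "dist x p \<le> real n" "dist p y \<le> 1"
      using geodesic_between_point[OF \<gamma>, of "min (real n) (dist x y)"] Suc.prems by (auto simp: p_def)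
    then show ?case
      using Suc.IH[of p] unit[of p y] dist_triangle[of "f x" "f y" "f p"] by (simp add: algebra_simps)
  qed simp
  moreover have "dist x y \<le> real (nat \<lceil>dist x y\<rceil>)" "real (nat \<lceil>dist x y\<rceil>) \<le> dist x y + 1" for x y :: 'a
    using zero_le_dist[of x y] by linarith+
  ultimately have "dist (f x) (f y) \<le> (dist x y + 1) * K" for x y
    using \<open>0 \<le> K\<close> by (meson mult_right_mono order_trans)
  then show thesis using that \<open>0 \<le> K\<close> by (simp add: algebra_simps)
qed

end

lemma coarse_pair_exists:
  fixes f :: "'a::metric_space \<Rightarrow> 'b::metric_space"
  assumes "leafless_tree TYPE('a)" "leafless_tree TYPE('b)" "coarse_equivalence f"
  obtains g L where "coarse_pair TYPE('a) TYPE('b) f g L"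
proof -
  interpret A: leafless_tree "TYPE('a)" by fact
  interpret B: leafless_tree "TYPE('b)" by fact
  obtain g where g: "controlled f" "controlled g" "finite_distance (g \<circ> f) id" "finite_distance (f \<circ> g) id"
    using assms(3) unfolding coarse_equivalence_def coarse_def by blast
  obtain K1 where K1: "0 \<le> K1" "\<And>x y. dist (f x) (f y) \<le> K1 * dist x y + K1"
    using A.controlled_affine[OF g(1)] by blast
  obtain K2 where K2: "0 \<le> K2" "\<And>x y. dist (g x) (g y) \<le> K2 * dist x y + K2"
    using B.controlled_affine[OF g(2)] by blast
  obtain C1 where C1: "\<And>x. dist (g (f x)) x \<le> C1"
    using g(3) unfolding finite_distance_def bounded_iff by (auto simp: abs_le_iff)
  obtain C2 where C2: "\<And>x. dist (f (g x)) x \<le> C2"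
    using g(4) unfolding finite_distance_def bounded_iff by (auto simp: abs_le_iff)
  define L where "L = 1 + K1 + K2 + \<bar>C1\<bar> + \<bar>C2\<bar>"
  have L: "1 \<le> L" "K1 \<le> L" "K2 \<le> L" "C1 \<le> L" "C2 \<le> L" using K1(1) K2(1) by (auto simp: L_def)
  have "coarse_pair TYPE('a) TYPE('b) f g L"
  proof unfold_locales
    show "dist (f x) (f y) \<le> L * dist x y + L" for x y
      using K1(2)[of x y] mult_right_mono[OF L(2), of "dist x y"] L(2) by simp
    show "dist (g x) (g y) \<le> L * dist x y + L" for x y
      using K2(2)[of x y] mult_right_mono[OF L(3), of "dist x y"] L(3) by simp
    show "dist (g (f x)) x \<le> L" for x using C1[of x] L(4) by linarith
    show "dist (f (g x)) x \<le> L" for x using C2[of x] L(5) by linarith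
  qed (fact L)
  then show thesis by (rule that)
qed

lemma isometric_action_isometry:
  assumes "isometric_action G \<alpha>" "k \<in> carrier G"
  shows "isometry (\<alpha> k)"
  using assms group_action.surj_prop[of G UNIV \<alpha> k]
  unfolding isometric_action_def isometry_rescaled_def by simp

theorem theoremA:
  fixes G :: "('g, 'm) monoid_scheme"
    and \<alpha> :: "'g \<Rightarrow> 'a::metric_space \<Rightarrow> 'a"
    and \<beta> :: "'g \<Rightarrow> 'b::metric_space \<Rightarrow> 'b"
    and f :: "'a \<Rightarrow> 'b"
  assumes "tree TYPE('a)" and "leafless TYPE('a)"
    and "tree TYPE('b)" and "leafless TYPE('b)"
    and "isometric_action G \<alpha>" and "isometric_action G \<beta>"
    and "coarse_equivalence f"
    and "\<exists>u\<in>(ends :: 'a set set set). \<exists>v\<in>ends. \<exists>w\<in>ends. u \<noteq> v \<and> v \<noteq> w \<and> u \<noteq> w"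
    and "equivariant_on G ends (end_action \<alpha>) (end_action \<beta>) (boundary_map f)"
    and "two_transitive_on G ends (end_action \<alpha>)"
  shows "\<exists>c>0. \<exists>h :: 'a \<Rightarrow> 'b.
    isometry_rescaled c h \<and> equivariant_on G UNIV \<alpha> \<beta> h \<and> boundary_map f = boundary_map h \<and>
    ((\<exists>z z' :: 'a. z \<noteq> z' \<and> branch_point z \<and> branch_point z') \<longrightarrow>
      (\<forall>c'>0. \<forall>h' :: 'a \<Rightarrow> 'b. isometry_rescaled c' h' \<and> equivariant_on G UNIV \<alpha> \<beta> h' \<and>
         boundary_map f = boundary_map h' \<longrightarrow> h' = h) \<and>
      finite_distance h f)"
proof -
  have trees: "leafless_tree TYPE('a)" "leafless_tree TYPE('b)"
    using assms(1-4) by unfold_locales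
  obtain g L where "coarse_pair TYPE('a) TYPE('b) f g L"
    using coarse_pair_exists[OF trees assms(7)] .
  then interpret coarse_pair "TYPE('a)" "TYPE('b)" f g L .
  have bd: "boundary_map f = bd" by (rule boundary_map_eq_bd[OF assms(8)])
  have act: "end_action \<delta> k u = end_map (\<delta> k) u" for \<delta> :: "'g \<Rightarrow> 'c::metric_space \<Rightarrow> 'c" and k u
    by (simp add: end_action_def end_map_def)
  have compat: "compat (\<alpha> k) (\<beta> k)" if "k \<in> carrier G" for k
    using assms(9) that isometric_action_isometry[OF assms(5)] isometric_action_isometry[OF assms(6)]
    by (simp add: compat_def equivariant_on_def bd act)
  interpret two_transitive_pair "TYPE('a)" "TYPE('b)" f g L
  proof
    fix u v u' v' :: "'a set set"
    assume "u \<in> ends" "v \<in> ends" "u \<noteq> v" "u' \<in> ends" "v' \<in> ends" "u' \<noteq> v'"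
    then obtain k where "k \<in> carrier G" "end_map (\<alpha> k) u = u'" "end_map (\<alpha> k) v = v'"
      using assms(10) unfolding two_transitive_on_def act by metis
    then show "\<exists>a b. compat a b \<and> end_map a u = u' \<and> end_map a v = v'" using compat by blast
  qed (rule assms(8))
  obtain c where c: "0 < c"
    "\<And>a b u. compat a b \<Longrightarrow> u \<in> ends \<Longrightarrow> end_map a u = u \<Longrightarrow> shift b (bd u) = c * shift a u"
    using ratio_exists by metis
  interpret shift_ratio "TYPE('a)" "TYPE('b)" f g L c by unfold_locales (use c in auto)
  have equivariant: "equivariant_on G UNIV \<alpha> \<beta> induced_isometry"
    unfolding equivariant_on_def using corresponds_compat[OF compat induced_isometry_corresponds] induced_isometry_eq by blast
  have two_centers: "\<exists>u v w u' v' w'. center z u v w \<and> center z' u' v' w'"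
    if "branch_point z" "branch_point z'" for z z' :: 'a
    using A.branch_point_center that by metis
  show ?thesis
  proof (intro exI[of _ "1 / c"] exI[of _ induced_isometry] conjI impI allI)
    show "0 < 1 / c" using c(1) by simp
    show "isometry_rescaled (1 / c) induced_isometry" by (rule induced_isometry_isometry)
    show "equivariant_on G UNIV \<alpha> \<beta> induced_isometry" by (rule equivariant)
    show "boundary_map f = boundary_map induced_isometry" using bd induced_isometry_boundary by simp
    assume "\<exists>z z' :: 'a. z \<noteq> z' \<and> branch_point z \<and> branch_point z'"
    then obtain z z' :: 'a and u v w u' v' w'
      where z: "center z u v w" "center z' u' v' w'" "z \<noteq> z'"
      using two_centers by metis
    show "finite_distance induced_isometry f" by (rule induced_isometry_finite_distance[OF z])
    fix c' and h' :: "'a \<Rightarrow> 'b"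
    assume "0 < c'" "isometry_rescaled c' h' \<and> equivariant_on G UNIV \<alpha> \<beta> h' \<and>
      boundary_map f = boundary_map h'"
    then have h': "isometry_rescaled c' h'" "0 < c'" "boundary_map h' = bd" using bd by auto
    show "h' = induced_isometry" by (rule induced_isometry_unique[OF h' z])
  qed
qed

end
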